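(* Let $1\le k<n$, let $\Delta\subset\mathbb{C}$ be the unit disc, and let $u\in\mathcal{E}(\Delta^n)$. Then $\phi_u$ is identically $0$ on $\Delta^k$.
   Context: Write $z=(z',z'')$ with $z'\in\Delta^k$, $z''\in\Delta^{n-k}$. For $u$ plurisubharmonic and $\leq0$ on $\Delta^n$, $\phi_u(z')=\left(-\nu_u(z',\cdot)(0)\right)^*$, where $\nu_u(z',\cdot)(0)$ is the Lelong number at $0$ of $z''\mapsto u(z',z'')$ and ${}^*$ is the upper semicontinuous regularization on $\Delta^k$. For a bounded hyperconvex domain $\Omega\subset\mathbb{C}^n$: $\mathcal{E}_0(\Omega)$ is the set of bounded plurisubharmonic $\varphi$ on $\Omega$ with $\lim_{z\to\partial\Omega}\varphi(z)=0$ and $\int_\Omega(dd^c\varphi)^n<\infty$; $\mathcal{F}(\Omega)$ is the set of plurisubharmonic $\varphi$ for which some sequence $\varphi_j\in\mathcal{E}_0(\Omega)$ decreases to $\varphi$ with $\sup_j\int_\Omega(dd^c\varphi_j)^n<\infty$; $\mathcal{E}(\Omega)$ is the set of plurisubharmonic $\varphi$ such that for every open $\omega\Subset\Omega$ there is $\varphi_\omega\in\mathcal{F}(\Omega)$ with $\varphi_\omega=\varphi$ on $\omega$. Functions in $\mathcal{E}(\Omega)$ are $\le 0$. *)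

theory Defs
  imports "HOL-Analysis.Analysis"
begin

definition polydisc :: "(complex ^ 'n) set" where
  "polydisc = {z. \<forall>i. norm (z $ i) < 1}"

text \<open>Splitting of coordinates: z = (z', z'') with z' in C^k, z'' in C^(n-k);
  the index type of C^n is the disjoint sum of the index types.\<close>
definition join_coords :: "complex ^ 'k \<Rightarrow> complex ^ 'm \<Rightarrow> complex ^ ('k + 'm)" where
  "join_coords z' z'' = (\<chi> i. case i of Inl a \<Rightarrow> z' $ a | Inr b \<Rightarrow> z'' $ b)"

definition usc_on :: "(complex ^ 'n) set \<Rightarrow> (complex ^ 'n \<Rightarrow> ereal) \<Rightarrow> bool" where
  "usc_on \<Omega> u \<longleftrightarrow> (\<forall>z\<in>\<Omega>. u z < \<infinity>) \<and>
     (\<forall>c. openin (top_of_set \<Omega>) {z\<in>\<Omega>. u z < c})"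

text \<open>Sub-mean value inequality on every closed complex disc a + zeta b, |zeta| \<le> 1,
  contained in Omega; the mean of u is written through the truncations max u (-N),
  whose means decrease to the mean of u (monotone convergence).\<close>
definition psh :: "(complex ^ 'n) set \<Rightarrow> (complex ^ 'n \<Rightarrow> ereal) \<Rightarrow> bool" where
  "psh \<Omega> u \<longleftrightarrow> open \<Omega> \<and> usc_on \<Omega> u \<and>
     (\<forall>C\<in>components \<Omega>. \<exists>z\<in>C. u z \<noteq> -\<infinity>) \<and>
     (\<forall>a\<in>\<Omega>. \<forall>b. (\<forall>\<zeta>::complex. norm \<zeta> \<le> 1 \<longrightarrow> a + \<zeta> *s b \<in> \<Omega>) \<longrightarrow>
        (\<forall>N::real. u a \<le> ereal (1 / (2 * pi) *
            integral {0..2*pi} (\<lambda>\<theta>. real_of_ereal (max (u (a + cis \<theta> *s b)) (ereal (- N)))))))"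

definition lelong0 :: "(complex ^ 'm \<Rightarrow> ereal) \<Rightarrow> ereal" where
  "lelong0 v = Liminf (at_right 0) (\<lambda>r::real. Sup (v ` ball 0 r) / ereal (ln r))"

definition usc_reg :: "(complex ^ 'k) set \<Rightarrow> (complex ^ 'k \<Rightarrow> ereal) \<Rightarrow> complex ^ 'k \<Rightarrow> ereal" where
  "usc_reg D f z = (INF r\<in>{r::real. r > 0}. Sup (f ` (ball z r \<inter> D)))"

definition phi_u :: "(complex ^ ('k::finite + 'm::finite) \<Rightarrow> ereal) \<Rightarrow> complex ^ 'k \<Rightarrow> ereal" where
  "phi_u u = usc_reg polydisc (\<lambda>z'. - lelong0 (\<lambda>z''. u (join_coords z' z'')))"

definition C2_on :: "(complex ^ 'n) set \<Rightarrow> (complex ^ 'n \<Rightarrow> real) \<Rightarrow> bool" where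
  "C2_on U f \<longleftrightarrow> open U \<and> (\<forall>x\<in>U. f differentiable (at x)) \<and>
     (\<forall>v. \<forall>x\<in>U. (\<lambda>y. frechet_derivative f (at y) v) differentiable (at x)) \<and>
     (\<forall>v w. continuous_on U
        (\<lambda>y. frechet_derivative (\<lambda>y'. frechet_derivative f (at y') v) (at y) w))"

definition D2 :: "(complex ^ 'n \<Rightarrow> real) \<Rightarrow> complex ^ 'n \<Rightarrow> complex ^ 'n \<Rightarrow> complex ^ 'n \<Rightarrow> real" where
  "D2 f z v w = frechet_derivative (\<lambda>y. frechet_derivative f (at y) v) (at z) w"

text \<open>Complex Hessian  d^2 f / dz_j d(conj z_k).\<close>
definition cx_hessian :: "(complex ^ 'n \<Rightarrow> real) \<Rightarrow> complex ^ 'n \<Rightarrow> complex ^ 'n ^ 'n" where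
  "cx_hessian f z = (\<chi> j k.
     (complex_of_real (D2 f z (axis j 1) (axis k 1) + D2 f z (axis j \<i>) (axis k \<i>))
      + \<i> * complex_of_real (D2 f z (axis j 1) (axis k \<i>) - D2 f z (axis j \<i>) (axis k 1))) / 4)"

text \<open>Density of (dd^c f)^n w.r.t. Lebesgue measure, for dd^c = 2 i ddbar.\<close>
definition MA_density :: "(complex ^ 'n \<Rightarrow> real) \<Rightarrow> complex ^ 'n \<Rightarrow> real" where
  "MA_density f z = 4 ^ CARD('n) * fact CARD('n) * Re (det (cx_hessian f z))"

definition test_fun :: "(complex ^ 'n) set \<Rightarrow> (complex ^ 'n \<Rightarrow> real) \<Rightarrow> bool" where
  "test_fun \<Omega> \<rho> \<longleftrightarrow> continuous_on UNIV \<rho> \<and> (\<forall>z. 0 \<le> \<rho> z \<and> \<rho> z \<le> 1) \<and>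
     compact (closure {z. \<rho> z \<noteq> 0}) \<and> closure {z. \<rho> z \<noteq> 0} \<subseteq> \<Omega>"

definition smooth_approx :: "(complex ^ 'n) set \<Rightarrow> (complex ^ 'n \<Rightarrow> ereal)
     \<Rightarrow> (nat \<Rightarrow> (complex ^ 'n) set) \<Rightarrow> (nat \<Rightarrow> complex ^ 'n \<Rightarrow> real) \<Rightarrow> bool" where
  "smooth_approx \<Omega> \<phi> U f \<longleftrightarrow>
     (\<forall>j. U j \<subseteq> U (Suc j) \<and> C2_on (U j) (f j) \<and> psh (U j) (\<lambda>z. ereal (f j z))) \<and>
     (\<Union>j. U j) = \<Omega> \<and>
     (\<forall>j. \<forall>z\<in>U j. f (Suc j) z \<le> f j z) \<and>
     (\<forall>z\<in>\<Omega>. (\<lambda>j. ereal (f j z)) \<longlonglongrightarrow> \<phi> z)"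

text \<open>Integral of a test function against (dd^c phi)^n for bounded psh phi
  (Bedford-Taylor: the limit exists and is independent of the approximation).\<close>
definition MA_test_integrals :: "(complex ^ 'n) set \<Rightarrow> (complex ^ 'n \<Rightarrow> ereal)
     \<Rightarrow> (complex ^ 'n \<Rightarrow> real) \<Rightarrow> ereal set" where
  "MA_test_integrals \<Omega> \<phi> \<rho> = {ereal L | L. \<exists>U f. smooth_approx \<Omega> \<phi> U f \<and>
     (\<lambda>j. integral UNIV (\<lambda>z. \<rho> z * MA_density (f j) z)) \<longlonglongrightarrow> L}"

definition MA_mass :: "(complex ^ 'n) set \<Rightarrow> (complex ^ 'n \<Rightarrow> ereal) \<Rightarrow> ereal" where
  "MA_mass \<Omega> \<phi> = (SUP \<rho>\<in>{\<rho>. test_fun \<Omega> \<rho>}. Sup (MA_test_integrals \<Omega> \<phi> \<rho>))"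

definition cegrell_E0 :: "(complex ^ 'n) set \<Rightarrow> (complex ^ 'n \<Rightarrow> ereal) set" where
  "cegrell_E0 \<Omega> = {\<phi>. psh \<Omega> \<phi> \<and> (\<exists>M::real. \<forall>z\<in>\<Omega>. \<bar>\<phi> z\<bar> \<le> ereal M) \<and>
     (\<forall>\<epsilon>>0. \<exists>K. compact K \<and> K \<subseteq> \<Omega> \<and> (\<forall>z\<in>\<Omega> - K. \<bar>\<phi> z\<bar> < ereal \<epsilon>)) \<and>
     MA_mass \<Omega> \<phi> < \<infinity>}"

definition cegrell_F :: "(complex ^ 'n) set \<Rightarrow> (complex ^ 'n \<Rightarrow> ereal) set" where
  "cegrell_F \<Omega> = {\<phi>. psh \<Omega> \<phi> \<and> (\<exists>g. (\<forall>j. g j \<in> cegrell_E0 \<Omega>) \<and>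
     (\<forall>j. \<forall>z\<in>\<Omega>. g (Suc j) z \<le> g j z) \<and>
     (\<forall>z\<in>\<Omega>. (\<lambda>j. g j z) \<longlonglongrightarrow> \<phi> z) \<and>
     (SUP j. MA_mass \<Omega> (g j)) < \<infinity>)}"

definition cegrell_E :: "(complex ^ 'n) set \<Rightarrow> (complex ^ 'n \<Rightarrow> ereal) set" where
  "cegrell_E \<Omega> = {\<phi>. psh \<Omega> \<phi> \<and> (\<forall>\<omega>. open \<omega> \<and> compact (closure \<omega>) \<and> closure \<omega> \<subseteq> \<Omega> \<longrightarrow>
     (\<exists>\<psi>\<in>cegrell_F \<Omega>. \<forall>z\<in>\<omega>. \<psi> z = \<phi> z))}"

end

theory Submission
  imports Defs "HOL-Complex_Analysis.Cauchy_Integral_Formula"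
begin

text \<open>
  If \<open>\<phi>\<^sub>u\<close> is negative somewhere, then the Lelong numbers of the slices \<open>u(z', \<cdot>)\<close> at \<open>0\<close> are bounded below by some
  \<open>c > 0\<close> for all \<open>z'\<close> near a point \<open>a\<close>. By Hadamard's three circles argument \<open>u \<le> (c/2) ln s\<close> on the polydisc
  \<open>{|z'\<^sub>i - a\<^sub>i| \<le> h, |z''\<^sub>i| \<le> s}\<close>, and by Dini's theorem almost the same bound holds for the functions in \<open>\<E>\<^sub>0\<close> that
  decrease to \<open>u\<close> there, whose Monge-Ampere masses are bounded by a constant. On the other hand, there is an explicit smooth
  psh function of size \<open>- ln s\<close> that lies above such a function on the small polydisc, below it near the boundary, and has mass
  of order \<open>(- ln s)^k\<close> on the small polydisc. By the comparison principle this mass is at most the constant, which is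
  absurd as \<open>s\<close> tends to \<open>0\<close>.

  The comparison principle is obtained by gluing smooth functions with a smoothed maximum: a compactly supported
  modification of a smooth function does not change the integral of its Monge-Ampere density.
\<close>

section \<open>Functions of class C^k\<close>

text \<open>The contradiction is a matter of scales. In \<open>z'\<close> the small polydisc keeps a
  fixed size \<open>h\<close>, and the bound \<open>u \<le> (c/2) ln s\<close> leaves room for a
  quadratic term with a coefficient of order \<open>- ln s\<close>; each such coordinate contributes
  that order to the mass. In \<open>z''\<close> the size is \<open>s\<close> and the smoothed
  logarithm has second derivatives of order \<open>1/s^2\<close>, so density and volume cancel. The
  mass bound, in contrast, comes from a member of \<open>\<F>\<close> that agrees with
  \<open>u\<close> on a polydisc chosen before \<open>s\<close>.

  \<open>MA_mass\<close> is a supremum of limits of integrals along smooth decreasing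
  approximations, so one approximation with convergent integrals bounds it from below.
  Sup-convolution followed by mollification provides the approximation, a Chern-Levine-Nirenberg
  bound keeps the integrals bounded, and compactness gives a convergent subsequence. All comparisons
  are made between smooth functions.

  The class is C^3 because the integration by parts differentiates first derivatives twice
  more.\<close>

text \<open>Fixing the direction \<open>v\<close> keeps the value type unchanged along the
  recursion, so derivatives of all orders stay ordinary functions instead of multilinear
  maps.\<close>

primrec cdiff :: "nat \<Rightarrow> 'a::real_normed_vector set \<Rightarrow> ('a \<Rightarrow> 'b::real_normed_vector) \<Rightarrow> bool" where
  "cdiff 0 U f \<longleftrightarrow> continuous_on U f"
| "cdiff (Suc n) U f \<longleftrightarrow> (\<forall>x\<in>U. f differentiable (at x)) \<and>
     (\<forall>v. cdiff n U (\<lambda>x. frechet_derivative f (at x) v))"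

lemma cdiff_cong:
  assumes "open U" "\<And>x. x \<in> U \<Longrightarrow> f x = g x" "cdiff n U f"
  shows "cdiff n U g"
  using assms(2,3)
proof (induction n arbitrary: f g)
  case 0
  then show ?case by (metis cdiff.simps(1) continuous_on_cong)
next
  case (Suc n)
  have d: "(g has_derivative frechet_derivative f (at x)) (at x)" if "x \<in> U" for x
    using Suc.prems that assms(1)
    by (metis cdiff.simps(2) frechet_derivative_works has_derivative_transform_within_open)
  have "cdiff n U (\<lambda>x. frechet_derivative g (at x) v)" for v
  proof (rule Suc.IH)
    show "frechet_derivative f (at x) v = frechet_derivative g (at x) v" if "x \<in> U" for x
      using frechet_derivative_at[OF d[OF that]] by simp
    show "cdiff n U (\<lambda>x. frechet_derivative f (at x) v)" using Suc.prems(2) by simp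
  qed
  then show ?case using d by (auto simp: differentiable_def)
qed

text \<open>\<open>frechet_derivative\<close> is a choice operator; uniqueness of derivatives lets
  any explicit \<open>f'\<close> stand for it.\<close>

lemma cdiff_SucI:
  assumes U: "open U" and d: "\<And>x. x \<in> U \<Longrightarrow> (f has_derivative f' x) (at x)"
    and c: "\<And>v. cdiff n U (\<lambda>x. f' x v)"
  shows "cdiff (Suc n) U f"
proof -
  have "cdiff n U (\<lambda>x. frechet_derivative f (at x) v)" for v
  proof (rule cdiff_cong[OF U _ c])
    show "f' x v = frechet_derivative f (at x) v" if "x \<in> U" for x
      using frechet_derivative_at[OF d[OF that]] by simp
  qed
  then show ?thesis using d by (auto simp: differentiable_def)
qed

lemma cdiff_has_derivative:
  assumes "cdiff (Suc n) U f" "x \<in> U"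
  shows "(f has_derivative frechet_derivative f (at x)) (at x)"
  using assms by (simp add: frechet_derivative_works)

lemma cdiff_SucD: "cdiff (Suc n) U f \<Longrightarrow> cdiff n U f"
proof (induction n arbitrary: f)
  case 0
  then show ?case
    by (simp add: continuous_at_imp_continuous_on differentiable_imp_continuous_within)
next
  case (Suc n)
  then show ?case by (metis cdiff.simps(2))
qed

lemma cdiff_le: "cdiff n U f \<Longrightarrow> m \<le> n \<Longrightarrow> cdiff m U f"
  by (induction n) (auto simp: le_Suc_eq simp del: cdiff.simps(2) dest: cdiff_SucD)

lemma cdiff_continuous: "cdiff n U f \<Longrightarrow> continuous_on U f"
  using cdiff_le[of n U f 0] by simp

lemma cdiff_subset: "cdiff n U f \<Longrightarrow> V \<subseteq> U \<Longrightarrow> cdiff n V f"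
  by (induction n arbitrary: f) (auto intro: continuous_on_subset)

lemma cdiff_Un:
  assumes "open U" "open V" "cdiff n U f" "cdiff n V f"
  shows "cdiff n (U \<union> V) f"
  using assms(3,4)
  by (induction n arbitrary: f) (auto intro: continuous_on_open_Un[OF assms(1,2)])

lemma cdiff_const [simp]: "cdiff n U (\<lambda>x. c)"
  by (induction n arbitrary: c) auto

lemma cdiff_linear:
  assumes "bounded_linear L" "open U"
  shows "cdiff n U L"
proof (cases n)
  case 0
  then show ?thesis using assms by (simp add: linear_continuous_on)
next
  case (Suc m)
  have "cdiff (Suc m) U L"
    by (rule cdiff_SucI[OF assms(2), where f' = "\<lambda>x. L"])
      (use assms(1) bounded_linear_imp_has_derivative in auto)
  then show ?thesis using Suc by simp
qed

lemma cdiff_add: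
  assumes "open U" "cdiff n U f" "cdiff n U g"
  shows "cdiff n U (\<lambda>x. f x + g x)"
  using assms(2,3)
proof (induction n arbitrary: f g)
  case 0
  then show ?case by (auto intro: continuous_intros)
next
  case (Suc n)
  have d: "((\<lambda>x. f x + g x) has_derivative (\<lambda>v. frechet_derivative f (at x) v + frechet_derivative g (at x) v)) (at x)"
    if "x \<in> U" for x
    using Suc.prems that by (intro has_derivative_add cdiff_has_derivative)
  show ?case
    using cdiff_SucI[OF assms(1) d] Suc.IH Suc.prems by auto
qed

lemma cdiff_bilinear:
  assumes "bounded_bilinear p" "open U" "cdiff n U f" "cdiff n U g"
  shows "cdiff n U (\<lambda>x. p (f x) (g x))"
  using assms(3,4)
proof (induction n arbitrary: f g)
  case 0
  then show ?case by (auto intro: bounded_bilinear.continuous_on[OF assms(1)])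
next
  case (Suc n)
  have d: "((\<lambda>x. p (f x) (g x)) has_derivative
      (\<lambda>v. p (f x) (frechet_derivative g (at x) v) + p (frechet_derivative f (at x) v) (g x))) (at x)"
    if "x \<in> U" for x
    using Suc.prems that by (intro bounded_bilinear.FDERIV[OF assms(1)] cdiff_has_derivative)
  show ?case
    by (rule cdiff_SucI[OF assms(2) d])
       (use Suc.IH Suc.prems cdiff_SucD[OF Suc.prems(1)] cdiff_SucD[OF Suc.prems(2)] in
         \<open>auto intro!: cdiff_add[OF assms(2)]\<close>)
qed

lemma cdiff_mult:
  fixes f g :: "'a::real_normed_vector \<Rightarrow> 'b::real_normed_algebra"
  shows "open U \<Longrightarrow> cdiff n U f \<Longrightarrow> cdiff n U g \<Longrightarrow> cdiff n U (\<lambda>x. f x * g x)"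
  by (rule cdiff_bilinear[OF bounded_bilinear_mult])

lemma cdiff_inner:
  "open U \<Longrightarrow> cdiff n U f \<Longrightarrow> cdiff n U g \<Longrightarrow> cdiff n U (\<lambda>x. f x \<bullet> g x)"
  by (rule cdiff_bilinear[OF bounded_bilinear_inner])

lemma cdiff_linear_compose:
  assumes "bounded_linear L" "open U" "cdiff n U f"
  shows "cdiff n U (\<lambda>x. L (f x))"
  using assms(3)
proof (induction n arbitrary: f)
  case 0
  then show ?case by (auto intro: bounded_linear.continuous_on[OF assms(1)])
next
  case (Suc n)
  have d: "((\<lambda>x. L (f x)) has_derivative (\<lambda>v. L (frechet_derivative f (at x) v))) (at x)"
    if "x \<in> U" for x
    using Suc.prems that by (intro bounded_linear.has_derivative[OF assms(1)] cdiff_has_derivative)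
  show ?case
    using cdiff_SucI[OF assms(2) d] Suc.IH Suc.prems by auto
qed

lemma cdiff_diff:
  assumes "open U" "cdiff n U f" "cdiff n U g"
  shows "cdiff n U (\<lambda>x. f x - g x)"
  using cdiff_add[OF assms(1,2) cdiff_linear_compose[OF bounded_linear_minus[OF bounded_linear_ident] assms(1,3)]]
  by simp

lemma cdiff_sum:
  assumes "open U" "\<And>i. i \<in> I \<Longrightarrow> cdiff n U (f i)"
  shows "cdiff n U (\<lambda>x. \<Sum>i\<in>I. f i x)"
  using assms(2) by (induction I rule: infinite_finite_induct) (auto intro: cdiff_add[OF assms(1)])

lemma cdiff_prod:
  fixes f :: "'i \<Rightarrow> 'a::real_normed_vector \<Rightarrow> 'b::{real_normed_algebra, comm_ring_1}"
  assumes "open U" "\<And>i. i \<in> I \<Longrightarrow> cdiff n U (f i)"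
  shows "cdiff n U (\<lambda>x. \<Prod>i\<in>I. f i x)"
  using assms(2) by (induction I rule: infinite_finite_induct) (auto intro: cdiff_mult[OF assms(1)])

lemma cdiff_compose_real:
  fixes g :: "real \<Rightarrow> real" and f :: "'a::real_normed_vector \<Rightarrow> real"
  assumes "open U" "open V" "\<And>x. x \<in> U \<Longrightarrow> f x \<in> V" "cdiff n U f" "cdiff n V g"
  shows "cdiff n U (\<lambda>x. g (f x))"
  using assms(4,5)
proof (induction n arbitrary: g)
  case 0
  then show ?case using assms(3) by (auto intro: continuous_on_compose2)
next
  case (Suc n)
  have d: "((\<lambda>x. g (f x)) has_derivative (\<lambda>v. frechet_derivative f (at x) v * frechet_derivative g (at (f x)) 1)) (at x)"
    if x: "x \<in> U" for x
  proof -
    have 1: "(f has_derivative frechet_derivative f (at x)) (at x)"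
      using cdiff_has_derivative Suc.prems(1) x by blast
    have 2: "(g has_derivative frechet_derivative g (at (f x))) (at (f x))"
      using cdiff_has_derivative Suc.prems(2) assms(3) x by blast
    have "frechet_derivative g (at (f x)) w = w * frechet_derivative g (at (f x)) 1" for w
      using linear_scale[OF has_derivative_linear[OF 2], of w 1] by simp
    then have "(\<lambda>v. frechet_derivative f (at x) v * frechet_derivative g (at (f x)) 1)
        = (\<lambda>v. frechet_derivative g (at (f x)) (frechet_derivative f (at x) v))"
      by metis
    then show ?thesis
      using has_derivative_compose[OF 1 2] by (simp only:)
  qed
  show ?case
    by (rule cdiff_SucI[OF assms(1) d])
       (use Suc.IH[OF cdiff_SucD[OF Suc.prems(1)], of "\<lambda>y. frechet_derivative g (at y) 1"] Suc.prems in
         \<open>auto intro!: cdiff_mult[OF assms(1)]\<close>)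
qed

lemma cdiff_SucI_real:
  fixes f :: "real \<Rightarrow> real"
  assumes "open U" "\<And>x. x \<in> U \<Longrightarrow> (f has_real_derivative f' x) (at x)" "cdiff n U f'"
  shows "cdiff (Suc n) U f"
  by (rule cdiff_SucI[OF assms(1), where f' = "\<lambda>x v. f' x * v"])
     (use assms in \<open>auto simp: has_field_derivative_def intro: cdiff_mult\<close>)

section \<open>One-variable building blocks of class C^n\<close>

text \<open>Only \<open>t = 0\<close> is delicate: there the difference quotient lies between 0 and
  \<open>max 0 h ^ (n + 1)\<close>.\<close>

lemma pos_part_power_deriv:
  "((\<lambda>t::real. max 0 t ^ (n + 2)) has_real_derivative real (n + 2) * max 0 t ^ (n + 1)) (at t)"
proof -
  consider "t < 0" | "t > 0" | "t = 0" by linarith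
  then show ?thesis
  proof cases
    case 1
    have "((\<lambda>t::real. 0) has_real_derivative real (n + 2) * max 0 t ^ (n + 1)) (at t)"
      using 1 by auto
    then show ?thesis
      by (rule has_field_derivative_transform_within_open[where S = "{..<0}"]) (use 1 in auto)
  next
    case 2
    have "((\<lambda>t::real. t ^ (n + 2)) has_real_derivative real (n + 2) * max 0 t ^ (n + 1)) (at t)"
      using 2 DERIV_pow[of "n + 2" t UNIV] by (simp add: max_def)
    then show ?thesis
      by (rule has_field_derivative_transform_within_open[where S = "{0<..}"]) (use 2 in auto)
  next
    case 3
    have "((\<lambda>h::real. max 0 h ^ (n + 2) / h) \<longlongrightarrow> 0) (at 0)"
    proof (rule tendsto_sandwich[where f = "\<lambda>h. 0" and h = "\<lambda>h. max 0 h ^ (n + 1)"])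
      show "\<forall>\<^sub>F h::real in at 0. 0 \<le> max 0 h ^ (n + 2) / h"
        by (rule always_eventually) (auto simp: max_def)
      show "\<forall>\<^sub>F h::real in at 0. max 0 h ^ (n + 2) / h \<le> max 0 h ^ (n + 1)"
        by (rule always_eventually) (auto simp: max_def)
      have "((\<lambda>h::real. max 0 h ^ (n + 1)) \<longlongrightarrow> max 0 0 ^ (n + 1)) (at 0)"
        by (intro tendsto_intros)
      then show "((\<lambda>h::real. max 0 h ^ (n + 1)) \<longlongrightarrow> 0) (at 0)" by simp
    qed simp
    then show ?thesis using 3 by (simp add: DERIV_def)
  qed
qed

lemma cdiff_pos_part_power: "cdiff n UNIV (\<lambda>t::real. max 0 t ^ (n + 1))"
proof (induction n)
  case 0
  show ?case by (simp add: continuous_on_max)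
next
  case (Suc n)
  show ?case
    by (rule cdiff_SucI_real[OF open_UNIV, where f' = "\<lambda>t. real (n + 2) * max 0 t ^ (n + 1)"])
       (use Suc pos_part_power_deriv[of n] in \<open>auto intro!: cdiff_mult simp: numeral_2_eq_2\<close>)
qed

text \<open>The derivative is minus the square of the function, so closure under products carries
  the induction.\<close>

lemma cdiff_inverse: "cdiff n {0<..} (inverse :: real \<Rightarrow> real)"
proof (induction n)
  case 0
  then show ?case by (auto intro!: continuous_intros)
next
  case (Suc n)
  show ?case
  proof (rule cdiff_SucI_real)
    show "(inverse has_real_derivative - inverse t * inverse t) (at t)" if "t \<in> {0<..}" for t :: real
      using that by (auto intro!: derivative_eq_intros)
    show "cdiff n {0<..} (\<lambda>t::real. - inverse t * inverse t)"
      by (intro cdiff_mult cdiff_linear_compose[OF bounded_linear_minus[OF bounded_linear_ident]] Suc) simp_all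
  qed simp
qed

lemma cdiff_ln: "cdiff n {0<..} (ln :: real \<Rightarrow> real)"
proof (cases n)
  case 0
  then show ?thesis by (auto intro!: continuous_intros)
next
  case (Suc m)
  have "cdiff (Suc m) {0<..} (ln :: real \<Rightarrow> real)"
    by (rule cdiff_SucI_real[OF _ _ cdiff_inverse])
       (auto intro!: derivative_eq_intros simp: field_simps)
  then show ?thesis using Suc by simp
qed

lemma cdiff_exp: "cdiff n UNIV (exp :: real \<Rightarrow> real)"
proof (induction n)
  case 0
  show ?case by (simp add: continuous_on_exp)
next
  case (Suc n)
  then show ?case by (rule cdiff_SucI_real[OF open_UNIV DERIV_exp])
qed

lemma has_vector_derivative_line:
  assumes "cdiff (Suc n) UNIV f"
  shows "((\<lambda>t. f (p + t *\<^sub>R q)) has_vector_derivative frechet_derivative f (at (p + t *\<^sub>R q)) q) (at t within S)"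
proof -
  have *: "(f has_derivative frechet_derivative f (at (p + t *\<^sub>R q))) (at (p + t *\<^sub>R q))"
    by (rule cdiff_has_derivative[OF assms]) simp
  have "((\<lambda>t. p + t *\<^sub>R q) has_derivative (\<lambda>s. s *\<^sub>R q)) (at t within S)"
    by (auto intro!: derivative_eq_intros)
  from has_derivative_compose[OF this *] show ?thesis
    by (simp add: has_vector_derivative_def linear_scale[OF has_derivative_linear[OF *]])
qed

text \<open>The increment of \<open>f\<close> along \<open>w\<close> is the integral of its
  \<open>w\<close>-derivative. Differentiating this identity in direction \<open>v\<close> under the
  integral sign, and then in the length \<open>t\<close> of the segment at 0, produces the two mixed
  derivatives.\<close>

lemma second_derivative_commute:
  fixes f :: "'a::real_normed_vector \<Rightarrow> 'b::banach"
  assumes f: "cdiff 2 UNIV f"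
  shows "frechet_derivative (\<lambda>y. frechet_derivative f (at y) v) (at x) w
       = frechet_derivative (\<lambda>y. frechet_derivative f (at y) w) (at x) v"
proof -
  let ?D = "\<lambda>v y. frechet_derivative f (at y) v"
  let ?E = "\<lambda>v w y. frechet_derivative (?D v) (at y) w"
  have f2: "cdiff (Suc (Suc 0)) UNIV f" using f by (simp add: numeral_2_eq_2)
  have f1: "cdiff (Suc 0) UNIV (?D v)" for v using f2 by (simp only: cdiff.simps(2)[of "Suc 0"])
  note F = has_vector_derivative_line[OF f2] and G = has_vector_derivative_line[OF f1]
  have cE: "continuous_on UNIV (?E v w)" for v w using f1 by simp
  have cD: "continuous_on UNIV (?D v)" for v using cdiff_continuous[OF f1] .
  have I: "integral {0..t} (\<lambda>\<tau>. ?D w (p + \<tau> *\<^sub>R w)) = f (p + t *\<^sub>R w) - f p" if "0 \<le> t" for t p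
    using fundamental_theorem_of_calculus[OF that F[of p w]] by (simp add: integral_unique)
  have J: "?D v (x + t *\<^sub>R w) - ?D v x = integral {0..t} (\<lambda>\<tau>. ?E w v (x + \<tau> *\<^sub>R w))" if t: "0 \<le> t" for t
  proof -
    have "((\<lambda>s. integral (cbox 0 t) (\<lambda>\<tau>. ?D w ((x + \<tau> *\<^sub>R w) + s *\<^sub>R v))) has_vector_derivative
        integral (cbox 0 t) (\<lambda>\<tau>. ?E w v ((x + \<tau> *\<^sub>R w) + 0 *\<^sub>R v))) (at 0 within UNIV)"
    proof (rule leibniz_rule_vector_derivative)
      show "(\<lambda>\<tau>. ?D w ((x + \<tau> *\<^sub>R w) + s *\<^sub>R v)) integrable_on cbox 0 t" for s
        by (rule integrable_continuous) (auto intro!: continuous_intros continuous_on_compose2[OF cD])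
      show "continuous_on (UNIV \<times> cbox 0 t) (\<lambda>(s, \<tau>). ?E w v (x + \<tau> *\<^sub>R w + s *\<^sub>R v))"
        by (auto simp: split_beta intro!: continuous_intros continuous_on_compose2[OF cE])
    qed (auto intro!: G)
    moreover have "integral (cbox 0 t) (\<lambda>\<tau>. ?D w ((x + \<tau> *\<^sub>R w) + s *\<^sub>R v))
       = f ((x + t *\<^sub>R w) + s *\<^sub>R v) - f (x + s *\<^sub>R v)" for s
      using I[OF t, of "x + s *\<^sub>R v"] by (simp add: algebra_simps)
    ultimately have "((\<lambda>s. f ((x + t *\<^sub>R w) + s *\<^sub>R v) - f (x + s *\<^sub>R v)) has_vector_derivative
        integral {0..t} (\<lambda>\<tau>. ?E w v (x + \<tau> *\<^sub>R w))) (at 0)"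
      by simp
    moreover have "((\<lambda>s. f ((x + t *\<^sub>R w) + s *\<^sub>R v) - f (x + s *\<^sub>R v)) has_vector_derivative
        ?D v ((x + t *\<^sub>R w) + 0 *\<^sub>R v) - ?D v (x + 0 *\<^sub>R v)) (at 0)"
      by (intro has_vector_derivative_diff F)
    ultimately show ?thesis
      using vector_derivative_unique_at by fastforce
  qed
  \<comment> \<open>\<open>J\<close> holds only for nonnegative \<open>t\<close>; one-sided
    derivatives at 0 suffice, since they are unique too.\<close>
  have "((\<lambda>t. integral {0..t} (\<lambda>\<tau>. ?E w v (x + \<tau> *\<^sub>R w))) has_vector_derivative ?E w v (x + 0 *\<^sub>R w)) (at 0 within {0..1})"
    by (rule integral_has_vector_derivative) (auto intro!: continuous_intros continuous_on_compose2[OF cE])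
  then have "((\<lambda>t. ?D v (x + t *\<^sub>R w) - ?D v x) has_vector_derivative ?E w v (x + 0 *\<^sub>R w)) (at 0 within {0..1})"
    by (rule has_vector_derivative_transform_within[where d = 1]) (use J in auto)
  moreover have "((\<lambda>t. ?D v (x + t *\<^sub>R w) - ?D v x) has_vector_derivative ?E v w (x + 0 *\<^sub>R w) - 0) (at 0 within {0..1})"
    by (intro has_vector_derivative_diff G has_vector_derivative_const)
  ultimately have "?E w v (x + 0 *\<^sub>R w) = ?E v w (x + 0 *\<^sub>R w) - 0"
    by (rule vector_derivative_unique_within[rotated]) (simp add: trivial_limit_within islimpt_Icc)
  then show ?thesis by simp
qed

section \<open>Integration by parts for the complex Hessian determinant\<close>

lemma integral_UNIV_eq_cbox:
  fixes h :: "'a::euclidean_space \<Rightarrow> 'b::banach"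
  assumes "\<And>x. x \<notin> S \<Longrightarrow> h x = 0"
  shows "integral S h = integral UNIV h"
proof -
  have "(\<lambda>x. if x \<in> S then h x else 0) = h" using assms by auto
  then show ?thesis by (metis integral_restrict_UNIV)
qed

lemma compact_support_integrable:
  fixes h :: "'a::euclidean_space \<Rightarrow> 'b::banach"
  assumes "continuous_on UNIV h" "bounded {x. h x \<noteq> 0}"
  shows "h integrable_on UNIV"
proof -
  obtain a where a: "{x. h x \<noteq> 0} \<subseteq> cbox (-a) a"
    using bounded_subset_cbox_symmetric[OF assms(2)] by blast
  have "h integrable_on cbox (-a) a"
    using assms(1) by (meson continuous_on_subset integrable_continuous subset_UNIV)
  moreover have "(\<lambda>x. if x \<in> cbox (-a) a then h x else 0) = h" using a by (auto simp: fun_eq_iff)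
  ultimately show ?thesis by (metis integrable_restrict_UNIV)
qed

lemma frechet_derivative_zero_open:
  assumes "open S" "x \<in> S" "\<And>y. y \<in> S \<Longrightarrow> h y = 0"
  shows "frechet_derivative h (at x) v = 0"
proof -
  have "(h has_derivative (\<lambda>v. 0)) (at x)"
    by (rule has_derivative_transform_within_open[OF has_derivative_const assms(1,2)]) (use assms(3) in auto)
  from frechet_derivative_at[OF this] show ?thesis by metis
qed

lemma frechet_derivative_zero_outside_support:
  assumes "x \<notin> closure {x. h x \<noteq> 0}"
  shows "frechet_derivative h (at x) v = 0"
  using assms closure_subset[of "{x. h x \<noteq> 0}"]
  by (intro frechet_derivative_zero_open[of "- closure {x. h x \<noteq> 0}"]) auto

lemma bounded_support_derivative:
  fixes h :: "'a::real_normed_vector \<Rightarrow> 'b::real_normed_vector"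
  assumes "bounded {x. h x \<noteq> 0}"
  shows "bounded {x. frechet_derivative h (at x) v \<noteq> 0}"
proof (rule bounded_subset[OF bounded_closure[OF assms]], safe)
  fix x assume "frechet_derivative h (at x) v \<noteq> 0"
  then show "x \<in> closure {x. h x \<noteq> 0}" by (metis frechet_derivative_zero_outside_support)
qed

text \<open>The integral is the derivative at \<open>t = 0\<close> of \<open>\<integral> h(x + t v) dx\<close>, which is constant by translation invariance.\<close>

lemma has_integral_directional_derivative:
  fixes h :: "'a::euclidean_space \<Rightarrow> 'b::banach"
  assumes h: "cdiff 1 UNIV h" and supp: "bounded {x. h x \<noteq> 0}"
  shows "((\<lambda>x. frechet_derivative h (at x) v) has_integral 0) UNIV"
proof -
  let ?D = "\<lambda>x. frechet_derivative h (at x) v"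
  have h1: "cdiff (Suc 0) UNIV h" using h by simp
  have cD: "continuous_on UNIV ?D" and ch: "continuous_on UNIV h"
    using h1 cdiff_continuous[OF h] by auto
  have bD: "bounded {x. ?D x \<noteq> 0}" by (rule bounded_support_derivative[OF supp])
  obtain r where r: "\<And>x. h x \<noteq> 0 \<Longrightarrow> norm x \<le> r" "\<And>x. ?D x \<noteq> 0 \<Longrightarrow> norm x \<le> r"
    using supp bD unfolding bounded_iff by (metis (mono_tags, lifting) mem_Collect_eq order_trans nle_le)
  \<comment> \<open>The margin \<open>norm v\<close> keeps the support inside the box under every
    translation by \<open>t v\<close> with \<open>\<bar>t\<bar> < 1\<close>.\<close>
  obtain a where a: "cball 0 (r + norm v) \<subseteq> cbox (-a) (a::'a)"
    using bounded_subset_cbox_symmetric[OF bounded_cball] by blast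
  have inb: "x \<in> cbox (-a) a" if "norm x \<le> r + norm v" for x using a that by auto
  have const: "integral (cbox (-a) a) (\<lambda>x. h (x + t *\<^sub>R v)) = integral UNIV h" if t: "\<bar>t\<bar> < 1" for t
  proof -
    have tv: "norm (t *\<^sub>R v) \<le> norm v"
      using t by (simp add: mult_left_le_one_le)
    have "integral (cbox (-a) a) (\<lambda>x. h (x + t *\<^sub>R v)) = integral (cbox (-a) a) (h \<circ> (+) (t *\<^sub>R v))"
      by (simp add: o_def add.commute)
    also have "\<dots> = integral (cbox (-a + t *\<^sub>R v) (a + t *\<^sub>R v)) h"
      by (rule integral_shift_cbox_plus)
    also have "\<dots> = integral UNIV h"
    proof (rule integral_UNIV_eq_cbox, rule ccontr)
      fix x assume x: "x \<notin> cbox (-a + t *\<^sub>R v) (a + t *\<^sub>R v)" and "h x \<noteq> 0"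
      then have "norm x \<le> r" using r by blast
      then have "norm (x - t *\<^sub>R v) \<le> r + norm v"
        using norm_triangle_ineq4[of x "t *\<^sub>R v"] tv by linarith
      then have "x - t *\<^sub>R v \<in> cbox (-a) a" by (rule inb)
      then have "x \<in> cbox (-a + t *\<^sub>R v) (a + t *\<^sub>R v)"
        by (auto simp: mem_box algebra_simps)
      then show False using x by blast
    qed
    finally show ?thesis .
  qed
  have "((\<lambda>t. integral (cbox (-a) a) (\<lambda>x. h (x + t *\<^sub>R v))) has_vector_derivative
      integral (cbox (-a) a) (\<lambda>x. ?D (x + 0 *\<^sub>R v))) (at 0 within UNIV)"
  proof (rule leibniz_rule_vector_derivative)
    show "(\<lambda>x. h (x + t *\<^sub>R v)) integrable_on cbox (-a) a" for t
      by (rule integrable_continuous) (auto intro!: continuous_intros continuous_on_compose2[OF ch])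
    show "continuous_on (UNIV \<times> cbox (-a) a) (\<lambda>(t, x). ?D (x + t *\<^sub>R v))"
      by (auto simp: split_beta intro!: continuous_intros continuous_on_compose2[OF cD])
    show "((\<lambda>t. h (x + t *\<^sub>R v)) has_vector_derivative ?D (x + t *\<^sub>R v)) (at t within UNIV)" for t x
      by (rule has_vector_derivative_line[OF h1])
  qed auto
  then have "((\<lambda>t. integral (cbox (-a) a) (\<lambda>x. h (x + t *\<^sub>R v))) has_vector_derivative
      integral (cbox (-a) a) ?D) (at 0)"
    by simp
  then have "((\<lambda>t. integral UNIV h) has_vector_derivative integral (cbox (-a) a) ?D) (at 0)"
    by (rule has_vector_derivative_transform_within_open[where S = "{-1<..<1}"]) (auto simp: const abs_less_iff)
  then have "integral (cbox (-a) a) ?D = 0"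
    using vector_derivative_unique_at has_vector_derivative_const by blast
  moreover have "integral (cbox (-a) a) ?D = integral UNIV ?D"
  proof (rule integral_UNIV_eq_cbox, rule ccontr)
    fix x assume "x \<notin> cbox (-a) a" "?D x \<noteq> 0"
    then show False using r(2)[of x] inb[of x] norm_ge_zero[of v] by linarith
  qed
  ultimately show ?thesis
    using compact_support_integrable[OF cD bD] by (simp add: has_integral_integrable_integral)
qed

section \<open>Wirtinger derivatives and determinants as null Lagrangians\<close>

text \<open>The Wirtinger derivative in the conjugate of \<open>z_k\<close>. It acts on
  complex-valued functions because it is applied to \<open>dz j f\<close> and iterated, whereas
  \<open>dz\<close> is only applied to real functions.\<close>

definition dbar :: "'n \<Rightarrow> (complex ^ 'n::finite \<Rightarrow> complex) \<Rightarrow> complex ^ 'n \<Rightarrow> complex" where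
  "dbar k q x = (frechet_derivative q (at x) (axis k 1) + \<i> * frechet_derivative q (at x) (axis k \<i>)) / 2"

definition dz :: "'n \<Rightarrow> (complex ^ 'n::finite \<Rightarrow> real) \<Rightarrow> complex ^ 'n \<Rightarrow> complex" where
  "dz j f x = (complex_of_real (frechet_derivative f (at x) (axis j 1))
     - \<i> * complex_of_real (frechet_derivative f (at x) (axis j \<i>))) / 2"

lemma cdiff_dbar:
  assumes "cdiff (Suc n) UNIV q"
  shows "cdiff n UNIV (dbar k q)"
proof -
  have "cdiff n UNIV (\<lambda>x. (1/2) * (frechet_derivative q (at x) (axis k 1) + \<i> * frechet_derivative q (at x) (axis k \<i>)))"
    using assms by (intro cdiff_mult cdiff_add cdiff_const) auto
  then show ?thesis by (simp add: dbar_def[abs_def])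
qed

lemma cdiff_dz:
  assumes "cdiff (Suc n) UNIV f"
  shows "cdiff n UNIV (dz j f)"
proof -
  have "cdiff n UNIV (\<lambda>x. (1/2) * (complex_of_real (frechet_derivative f (at x) (axis j 1))
     - \<i> * complex_of_real (frechet_derivative f (at x) (axis j \<i>))))"
    using assms by (intro cdiff_mult cdiff_diff cdiff_const cdiff_linear_compose[OF bounded_linear_of_real]) auto
  then show ?thesis by (simp add: dz_def[abs_def])
qed

lemma dbar_mult:
  assumes "cdiff 1 UNIV f" "cdiff 1 UNIV g"
  shows "dbar k (\<lambda>x. f x * g x) x = dbar k f x * g x + f x * dbar k g x"
proof -
  have "((\<lambda>x. f x * g x) has_derivative (\<lambda>v. f x * frechet_derivative g (at x) v + frechet_derivative f (at x) v * g x)) (at x)"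
    using assms by (intro has_derivative_mult cdiff_has_derivative[of 0 UNIV]) auto
  then have "frechet_derivative (\<lambda>x. f x * g x) (at x)
      = (\<lambda>v. f x * frechet_derivative g (at x) v + frechet_derivative f (at x) v * g x)"
    by (rule frechet_derivative_at[symmetric])
  then show ?thesis by (simp add: dbar_def field_simps)
qed

lemma dbar_prod:
  assumes "finite I" "\<And>i. i \<in> I \<Longrightarrow> cdiff 1 UNIV (f i)"
  shows "dbar k (\<lambda>x. \<Prod>i\<in>I. f i x) x = (\<Sum>i\<in>I. dbar k (f i) x * (\<Prod>l\<in>I - {i}. f l x))"
  using assms
proof (induction I rule: finite_induct)
  case empty
  then show ?case by (simp add: dbar_def)
next
  case (insert a I)
  have "dbar k (\<lambda>x. \<Prod>i\<in>insert a I. f i x) x = dbar k (\<lambda>x. f a x * (\<Prod>i\<in>I. f i x)) x"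
    using insert by simp
  also have "\<dots> = dbar k (f a) x * (\<Prod>i\<in>I. f i x) + f a x * dbar k (\<lambda>x. \<Prod>i\<in>I. f i x) x"
    using insert by (intro dbar_mult cdiff_prod) auto
  also have "\<dots> = dbar k (f a) x * (\<Prod>i\<in>I. f i x) + (\<Sum>i\<in>I. dbar k (f i) x * (f a x * (\<Prod>l\<in>I - {i}. f l x)))"
    using insert by (simp add: sum_distrib_left algebra_simps)
  also have "(\<Sum>i\<in>I. dbar k (f i) x * (f a x * (\<Prod>l\<in>I - {i}. f l x)))
     = (\<Sum>i\<in>I. dbar k (f i) x * (\<Prod>l\<in>insert a I - {i}. f l x))"
  proof (rule sum.cong[OF refl])
    fix i assume "i \<in> I"
    then have "insert a I - {i} = insert a (I - {i})" "a \<notin> I - {i}" using insert by auto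
    then show "dbar k (f i) x * (f a x * (\<Prod>l\<in>I - {i}. f l x)) = dbar k (f i) x * (\<Prod>l\<in>insert a I - {i}. f l x)"
      using insert by simp
  qed
  also have "dbar k (f a) x * (\<Prod>i\<in>I. f i x) = dbar k (f a) x * (\<Prod>l\<in>insert a I - {a}. f l x)"
    using insert by simp
  finally show ?case using insert by (simp add: insert)
qed

lemma dbar_commute:
  assumes "cdiff 2 UNIV q"
  shows "dbar k (dbar l q) x = dbar l (dbar k q) x"
proof -
  let ?D = "\<lambda>v y. frechet_derivative q (at y) v"
  have q: "cdiff (Suc 0) UNIV (?D v)" for v using assms by (simp add: numeral_2_eq_2)
  have "(dbar l q has_derivative (\<lambda>v. (frechet_derivative (?D (axis l 1)) (at x) v
      + \<i> * frechet_derivative (?D (axis l \<i>)) (at x) v) / 2)) (at x)" for l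
    unfolding dbar_def[abs_def]
    by (intro bounded_linear.has_derivative[OF bounded_linear_divide] has_derivative_add has_derivative_mult_right cdiff_has_derivative[OF q]) auto
  then have *: "frechet_derivative (dbar l q) (at x) = (\<lambda>v. (frechet_derivative (?D (axis l 1)) (at x) v
      + \<i> * frechet_derivative (?D (axis l \<i>)) (at x) v) / 2)" for l
    by (rule frechet_derivative_at[symmetric])
  show ?thesis
    unfolding dbar_def[of k "dbar l q"] dbar_def[of l "dbar k q"] *
    second_derivative_commute[OF assms, of "axis l _" x]
    by (simp add: field_simps)
qed

lemma has_integral_dbar:
  assumes "cdiff 1 UNIV q" "bounded {x. q x \<noteq> 0}"
  shows "(dbar k q has_integral 0) UNIV"
proof -
  have "((\<lambda>x. (frechet_derivative q (at x) (axis k 1) + \<i> * frechet_derivative q (at x) (axis k \<i>)) / 2)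
      has_integral (0 + \<i> * 0) / 2) UNIV"
    by (intro has_integral_divide has_integral_add has_integral_mult_right has_integral_directional_derivative assms)
  then show ?thesis by (simp add: dbar_def[abs_def])
qed

text \<open>Composing with the transposition permutes the summands and flips every sign, so the sum
  equals its own negative.\<close>

lemma alternating_sum_zero:
  fixes T :: "('n::finite \<Rightarrow> 'n) \<Rightarrow> complex"
  assumes "a \<noteq> b" "\<And>p. p permutes UNIV \<Longrightarrow> T (p \<circ> Transposition.transpose a b) = T p"
  shows "(\<Sum>p | p permutes UNIV. of_int (sign p) * T p) = 0"
proof -
  let ?t = "Transposition.transpose a b"
  have "(\<Sum>p | p permutes UNIV. of_int (sign p) * T p)
      = (\<Sum>p | p permutes UNIV. of_int (sign (p \<circ> ?t)) * T (p \<circ> ?t))"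
    by (rule sum_permutations_compose_right) (rule permutes_swap_id; simp)
  also have "\<dots> = (\<Sum>p | p permutes UNIV. - (of_int (sign p) * T p))"
  proof (rule sum.cong[OF refl])
    fix p :: "'n \<Rightarrow> 'n" assume "p \<in> {p. p permutes UNIV}"
    then have p: "p permutes UNIV" by simp
    have "sign (p \<circ> ?t) = - sign p"
      using sign_compose[OF permutes_imp_permutation[OF finite p] permutation_swap_id[of a b]] assms(1)
      by (simp add: sign_swap_id)
    then show "of_int (sign (p \<circ> ?t)) * T (p \<circ> ?t) = - (of_int (sign p) * T p)"
      using assms(2)[OF p] by simp
  qed
  finally show ?thesis by (simp add: sum_negf)
qed

text \<open>The determinant is a null Lagrangian: it is a signed sum of derivatives of products containing the factor
  \<open>q a\<close>, because the terms with two derivatives on one other factor cancel in pairs.\<close>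

lemma has_integral_det_dbar:
  fixes q :: "'n::finite \<Rightarrow> complex ^ 'n \<Rightarrow> complex"
  assumes q: "\<And>j. cdiff 2 UNIV (q j)" and supp: "bounded {x. q a x \<noteq> 0}"
  shows "((\<lambda>x. det (\<chi> j k. dbar k (q j) x)) has_integral 0) UNIV"
proof -
  have q1: "cdiff 1 UNIV (q j)" for j using q cdiff_le[of 2 UNIV "q j" 1] by simp
  have q2: "cdiff 1 UNIV (dbar k (q j))" for j k using q by (intro cdiff_dbar) (simp add: numeral_2_eq_2)
  define R where "R p x = (\<Prod>i\<in>UNIV - {a}. dbar (p i) (q i) x)" for p :: "'n \<Rightarrow> 'n" and x
  have R: "cdiff 1 UNIV (R p)" for p unfolding R_def[abs_def] by (intro cdiff_prod q2) simp
  define T where "T x i p = dbar (p a) (dbar (p i) (q i)) x * (\<Prod>l\<in>UNIV - {a} - {i}. dbar (p l) (q l) x)"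
    for x i and p :: "'n \<Rightarrow> 'n"
  have T0: "(\<Sum>p | p permutes UNIV. of_int (sign p) * T x i p) = 0" if "i \<noteq> a" for x i
  \<comment> \<open>Swapping \<open>p a\<close> and \<open>p i\<close> exchanges the two operators
    applied to \<open>q i\<close>, which commute; the remaining factors involve neither
    index.\<close>
  proof (rule alternating_sum_zero[of a i])
    show "a \<noteq> i" using that by simp
    show "T x i (p \<circ> Transposition.transpose a i) = T x i p" for p
      using dbar_commute[OF q] that unfolding T_def
      by (auto intro!: arg_cong2[where f = "(*)"] prod.cong simp: transpose_apply_other)
  qed
  have d: "dbar (p a) (\<lambda>x. q a x * R p x) x = (\<Prod>i\<in>UNIV. dbar (p i) (q i) x) + q a x * (\<Sum>i\<in>UNIV - {a}. T x i p)" for p x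
  proof -
    have "dbar (p a) (\<lambda>x. q a x * R p x) x = dbar (p a) (q a) x * R p x + q a x * dbar (p a) (R p) x"
      by (rule dbar_mult[OF q1 R])
    also have "dbar (p a) (R p) x = (\<Sum>i\<in>UNIV - {a}. T x i p)"
      unfolding R_def[abs_def] T_def by (rule dbar_prod[OF finite q2])
    also have "dbar (p a) (q a) x * R p x = (\<Prod>i\<in>UNIV. dbar (p i) (q i) x)"
      unfolding R_def by (subst prod.remove[of UNIV a]) auto
    finally show ?thesis .
  qed
  \<comment> \<open>By \<open>d\<close>, each summand is a term of the determinant plus
    \<open>q a\<close> times second-derivative terms; the latter cancel over all \<open>p\<close> by
    \<open>T0\<close>.\<close>
  have e: "det (\<chi> j k. dbar k (q j) x) = (\<Sum>p | p permutes UNIV. of_int (sign p) * dbar (p a) (\<lambda>x. q a x * R p x) x)" for x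
  proof -
    have "(\<Sum>p | p permutes UNIV. of_int (sign p) * (q a x * (\<Sum>i\<in>UNIV - {a}. T x i p)))
      = q a x * (\<Sum>i\<in>UNIV - {a}. \<Sum>p | p permutes UNIV. of_int (sign p) * T x i p)"
      by (subst sum.swap) (simp add: sum_distrib_left mult.left_commute)
    also have "\<dots> = 0" using T0 by simp
    finally show ?thesis unfolding d by (simp add: det_def distrib_left sum.distrib)
  qed
  have "((\<lambda>x. \<Sum>p | p permutes (UNIV::'n set). of_int (sign p) * dbar (p a) (\<lambda>x. q a x * R p x) x) has_integral
      (\<Sum>p | p permutes (UNIV::'n set). of_int (sign p) * 0)) UNIV"
  proof (intro has_integral_sum has_integral_mult_right has_integral_dbar cdiff_mult q1 R)
    show "bounded {x. q a x * R p x \<noteq> 0}" for p by (rule bounded_subset[OF supp]) auto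
  qed auto
  then show ?thesis by (simp add: e)
qed

lemma cx_hessian_eq_dbar_dz:
  assumes "cdiff 2 UNIV f"
  shows "cx_hessian f x = (\<chi> j k. dbar k (dz j f) x)"
proof -
  let ?D = "\<lambda>v y. frechet_derivative f (at y) v"
  have f: "cdiff (Suc 0) UNIV (?D v)" for v using assms by (simp add: numeral_2_eq_2)
  have "(dz j f has_derivative (\<lambda>v. (complex_of_real (frechet_derivative (?D (axis j 1)) (at x) v)
      - \<i> * complex_of_real (frechet_derivative (?D (axis j \<i>)) (at x) v)) / 2)) (at x)" for j
    unfolding dz_def[abs_def]
    by (intro bounded_linear.has_derivative[OF bounded_linear_divide] has_derivative_diff has_derivative_mult_right
          has_derivative_of_real cdiff_has_derivative[OF f]) auto
  then have *: "frechet_derivative (dz j f) (at x) = (\<lambda>v. (complex_of_real (frechet_derivative (?D (axis j 1)) (at x) v)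
      - \<i> * complex_of_real (frechet_derivative (?D (axis j \<i>)) (at x) v)) / 2)" for j
    by (rule frechet_derivative_at[symmetric])
  show ?thesis
    unfolding cx_hessian_def D2_def dbar_def * by (simp add: vec_eq_iff field_simps)
qed

lemma dz_diff:
  assumes "cdiff 1 UNIV f" "cdiff 1 UNIV g"
  shows "dz j (\<lambda>x. f x - g x) x = dz j f x - dz j g x"
proof -
  have "((\<lambda>x. f x - g x) has_derivative (\<lambda>v. frechet_derivative f (at x) v - frechet_derivative g (at x) v)) (at x)"
    using assms by (intro has_derivative_diff cdiff_has_derivative[of 0 UNIV]) auto
  then have "frechet_derivative (\<lambda>x. f x - g x) (at x) = (\<lambda>v. frechet_derivative f (at x) v - frechet_derivative g (at x) v)"
    by (rule frechet_derivative_at[symmetric])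
  then show ?thesis by (simp add: dz_def field_simps)
qed

lemma dbar_add:
  assumes "cdiff 1 UNIV f" "cdiff 1 UNIV g"
  shows "dbar j (\<lambda>x. f x + g x) x = dbar j f x + dbar j g x"
proof -
  have "((\<lambda>x. f x + g x) has_derivative (\<lambda>v. frechet_derivative f (at x) v + frechet_derivative g (at x) v)) (at x)"
    using assms by (intro has_derivative_add cdiff_has_derivative[of 0 UNIV]) auto
  then have "frechet_derivative (\<lambda>x. f x + g x) (at x) = (\<lambda>v. frechet_derivative f (at x) v + frechet_derivative g (at x) v)"
    by (rule frechet_derivative_at[symmetric])
  then show ?thesis by (simp add: dbar_def field_simps)
qed

text \<open>The rows of the Hessian of \<open>g\<close> are replaced by those of \<open>f\<close>
  one at a time. By linearity in a row, each replacement changes the determinant by one whose row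
  comes from the compactly supported \<open>h = f - g\<close>, and such a determinant integrates to
  0. That step needs \<open>dz j f\<close> of class C^2, hence the order 3.\<close>

lemma MA_density_compact_perturbation:
  fixes f g :: "complex ^ 'n::finite \<Rightarrow> real"
  assumes f: "cdiff 3 UNIV f" and g: "cdiff 3 UNIV g" and supp: "bounded {x. f x \<noteq> g x}"
  shows "((\<lambda>x. MA_density f x - MA_density g x) has_integral 0) UNIV"
proof -
  define h where "h = (\<lambda>x. f x - g x)"
  have h: "cdiff 3 UNIV h" unfolding h_def by (intro cdiff_diff f g) simp
  have z: "cdiff 2 UNIV (dz j f)" "cdiff 2 UNIV (dz j g)" "cdiff 2 UNIV (dz j h)" for j
    using f g h by (auto intro!: cdiff_dz simp: numeral_3_eq_3 numeral_2_eq_2 simp del: cdiff.simps)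
  have bh: "bounded {x. h x \<noteq> 0}" using supp by (simp add: h_def)
  have bz: "bounded {x. dz j h x \<noteq> 0}" for j
    by (rule bounded_subset[OF bounded_Un[THEN iffD2, OF conjI[OF bounded_support_derivative[OF bh, of "axis j 1"]
          bounded_support_derivative[OF bh, of "axis j \<i>"]]]])
       (auto simp: dz_def)
  have dzh: "dz j f x = dz j g x + dz j h x" for j x
    unfolding h_def using f g cdiff_le[of 3 UNIV _ 1] by (subst dz_diff) auto
  \<comment> \<open>The rows indexed by \<open>S\<close> already come from \<open>f\<close>, the
    others still from \<open>g\<close>.\<close>
  define M where "M S x = (\<chi> j k. dbar k (if j \<in> S then dz j f else dz j g) x)" for S :: "'n set" and x
  have ins: "det (M (insert a S) x) - det (M S x)
      = det (\<chi> j k. dbar k (if j = a then dz a h else if j \<in> S then dz j f else dz j g) x)"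
    if "a \<notin> S" for a S x
  proof -
    let ?c = "\<lambda>j. \<chi> k. dbar k (if j \<in> S then dz j f else dz j g) x"
    have r: "(\<chi> k. dbar k (dz a f) x) = (\<chi> k. dbar k (dz a g) x) + (\<chi> k. dbar k (dz a h) x)"
    proof -
      have "dz a f = (\<lambda>x. dz a g x + dz a h x)" using dzh by auto
      then show ?thesis
        using dbar_add[OF cdiff_le[OF z(2), of 1] cdiff_le[OF z(3), of 1]] by (simp add: vec_eq_iff)
    qed
    have 1: "M (insert a S) x = (\<chi> j. if j = a then (\<chi> k. dbar k (dz a g) x) + (\<chi> k. dbar k (dz a h) x) else ?c j)"
      unfolding M_def r[symmetric] by (auto simp: vec_eq_iff)
    have 2: "M S x = (\<chi> j. if j = a then (\<chi> k. dbar k (dz a g) x) else ?c j)"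
      unfolding M_def using that by (auto simp: vec_eq_iff)
    have 3: "(\<chi> j k. dbar k (if j = a then dz a h else if j \<in> S then dz j f else dz j g) x)
       = (\<chi> j. if j = a then (\<chi> k. dbar k (dz a h) x) else ?c j)"
      by (auto simp: vec_eq_iff)
    show ?thesis unfolding 1 2 3 by (subst det_row_add) simp
  qed
  have "((\<lambda>x. det (M S x) - det (M {} x)) has_integral 0) UNIV" if "finite S" for S
    using that
  proof (induction S rule: finite_induct)
    case empty
    then show ?case by simp
  next
    case (insert a S)
    have "((\<lambda>x. det (\<chi> j k. dbar k (if j = a then dz a h else if j \<in> S then dz j f else dz j g) x)) has_integral 0) UNIV"
      by (rule has_integral_det_dbar[where a = a]) (use z bz in auto)
    then have "((\<lambda>x. det (M (insert a S) x) - det (M S x)) has_integral 0) UNIV"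
      by (simp add: ins insert)
    from has_integral_add[OF this insert.IH] show ?case by simp
  qed
  from this[of UNIV] have "((\<lambda>x. det (M UNIV x) - det (M {} x)) has_integral 0) UNIV" by simp
  moreover have "M UNIV x = cx_hessian f x" "M {} x = cx_hessian g x" for x
    using cdiff_le[OF f, of 2] cdiff_le[OF g, of 2] by (auto simp: M_def cx_hessian_eq_dbar_dz)
  ultimately have "((\<lambda>x. det (cx_hessian f x) - det (cx_hessian g x)) has_integral 0) UNIV" by simp
  from has_integral_mult_right[OF has_integral_Re[OF this], of "4 ^ CARD('n) * fact CARD('n)"]
  show ?thesis by (simp add: MA_density_def algebra_simps)
qed

section \<open>Determinants of Hermitian matrices\<close>

lemma hermitian_det_real:
  fixes A :: "complex ^ 'n::finite ^ 'n"
  assumes "\<And>j k. A $ k $ j = cnj (A $ j $ k)"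
  shows "Im (det A) = 0"
proof -
  have "cnj (det A) = det (\<chi> i j. cnj (A $ i $ j))"
    by (simp add: det_def)
  also have "(\<chi> i j. cnj (A $ i $ j)) = transpose A"
    by (simp add: vec_eq_iff transpose_def assms[symmetric])
  finally have "cnj (det A) = det A" by (simp add: det_transpose)
  then show ?thesis by (simp add: complex_eq_iff)
qed

text \<open>The determinant is real and nonzero along the segment from the identity to \<open>A\<close>, hence stays positive before \<open>A\<close>.\<close>

lemma hermitian_psd_det_nonneg:
  fixes A :: "complex ^ 'n::finite ^ 'n"
  assumes herm: "\<And>j k. A $ k $ j = cnj (A $ j $ k)"
    and psd: "\<And>b::complex ^ 'n. 0 \<le> Re (\<Sum>j\<in>UNIV. \<Sum>k\<in>UNIV. A $ j $ k * b $ j * cnj (b $ k))"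
  shows "0 \<le> Re (det A)"
proof -
  define B where "B t = (\<chi> j k. complex_of_real t * (A $ j $ k) + (if j = k then complex_of_real (1 - t) else 0))" for t :: real
  have im: "Im (det (B t)) = 0" for t
    by (rule hermitian_det_real) (auto simp: B_def herm[symmetric])
  \<comment> \<open>The Hermitian form of \<open>B t\<close> is at least \<open>(1 - t)\<close>
    times the squared norm, so \<open>B t\<close> has trivial kernel for
    \<open>t < 1\<close>.\<close>
  have nz: "Re (det (B t)) \<noteq> 0" if t: "0 \<le> t" "t < 1" for t
  proof
    assume "Re (det (B t)) = 0"
    then have "det (B t) = 0" using im by (simp add: complex_eq_iff)
    then have "\<not> invertible (B t)" by (simp add: invertible_det_nz)
    then obtain x where x: "B t *v x = 0" "x \<noteq> 0"
      by (meson invertible_left_inverse matrix_left_invertible_ker)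
    \<comment> \<open>The conjugate appears because \<open>psd\<close> pairs the row index with
      \<open>b\<close> and the column index with its conjugate, while \<open>B t *v x\<close>
      contracts the column index with \<open>x\<close>.\<close>
    define b where "b = (\<chi> i. cnj (x $ i))"
    have "(\<Sum>j\<in>UNIV. cnj (x $ j) * (B t *v x) $ j) = 0" using x by simp
    moreover have "(\<Sum>j\<in>UNIV. cnj (x $ j) * (B t *v x) $ j)
       = (\<Sum>j\<in>UNIV. \<Sum>k\<in>UNIV. of_real t * (A $ j $ k * b $ j * cnj (b $ k)) + (if j = k then of_real (1 - t) * (cnj (x $ j) * x $ j) else 0))"
      unfolding matrix_vector_mult_def B_def b_def
      by (simp only: sum_distrib_left vec_lambda_beta, intro sum.cong refl) (auto simp: algebra_simps)
    moreover have "\<dots> = of_real t * (\<Sum>j\<in>UNIV. \<Sum>k\<in>UNIV. A $ j $ k * b $ j * cnj (b $ k))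
       + of_real (1 - t) * (\<Sum>j\<in>UNIV. cnj (x $ j) * x $ j)"
      by (simp add: sum.distrib sum_distrib_left)
    ultimately have "0 = Re (of_real t * (\<Sum>j\<in>UNIV. \<Sum>k\<in>UNIV. A $ j $ k * b $ j * cnj (b $ k))
       + of_real (1 - t) * (\<Sum>j\<in>UNIV. cnj (x $ j) * x $ j))" by simp
    also have "\<dots> = t * Re (\<Sum>j\<in>UNIV. \<Sum>k\<in>UNIV. A $ j $ k * b $ j * cnj (b $ k))
       + (1 - t) * (\<Sum>j\<in>UNIV. (norm (x $ j))\<^sup>2)"
      by (simp add: cmod_power2) (simp add: power2_eq_square)
    finally have "(1 - t) * (\<Sum>j\<in>UNIV. (norm (x $ j))\<^sup>2) \<le> 0"
      using mult_nonneg_nonneg[OF t(1) psd[of b]] by linarith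
    then have "(\<Sum>j\<in>UNIV. (norm (x $ j))\<^sup>2) \<le> 0"
      using t by (simp add: mult_le_0_iff)
    then have "(\<Sum>j\<in>UNIV. (norm (x $ j))\<^sup>2) = 0"
      by (meson antisym sum_nonneg zero_le_power2)
    then have "x = 0" by (simp add: sum_nonneg_eq_0_iff vec_eq_iff)
    then show False using x by simp
  qed
  have cont: "continuous_on UNIV (\<lambda>t. Re (det (B t)))"
  proof -
    have c: "continuous_on UNIV (\<lambda>t. if j = k then complex_of_real (1 - t) else 0)" for j k :: 'n
      by (cases "j = k") (auto intro!: continuous_intros)
    show ?thesis
      unfolding det_def B_def vec_lambda_beta by (intro continuous_intros c)
  qed
  have B0: "det (B 0) = 1"
  proof -
    have "B 0 = mat 1" by (simp add: B_def mat_def vec_eq_iff)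
    then show ?thesis by simp
  qed
  have pos: "0 < Re (det (B t))" if t: "0 \<le> t" "t < 1" for t
  proof (rule ccontr)
    assume "\<not> ?thesis"
    then have "\<exists>s. 0 \<le> s \<and> s \<le> t \<and> Re (det (B s)) = 0"
      using t B0 cont by (intro IVT2') (auto intro: continuous_on_subset)
    then show False using nz t by force
  qed
  have "((\<lambda>t. Re (det (B t))) \<longlongrightarrow> Re (det (B 1))) (at_left 1)"
    using cont by (simp add: continuous_on_eq_continuous_at isCont_def filterlim_at_split)
  moreover have "eventually (\<lambda>t. 0 \<le> Re (det (B t))) (at_left 1)"
    using eventually_at_left_real[of 0 "1::real"] pos by (auto elim!: eventually_mono intro: less_imp_le)
  ultimately have "0 \<le> Re (det (B 1))"
    by (rule tendsto_lowerbound) simp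
  moreover have "B 1 = A" by (simp add: B_def vec_eq_iff)
  ultimately show ?thesis by simp
qed

section \<open>The Levi form and gluing\<close>

text \<open>The Laplacian at 0 of \<open>\<zeta> \<mapsto> f (x + \<zeta> b)\<close>, which is four
  times the Hermitian form of \<open>cx_hessian f x\<close> at \<open>b\<close>. Real second
  derivatives make it convenient for chain rules and circle means.\<close>

definition levi :: "(complex ^ 'n::finite \<Rightarrow> real) \<Rightarrow> complex ^ 'n \<Rightarrow> complex ^ 'n \<Rightarrow> real" where
  "levi f x b = D2 f x b b + D2 f x (\<i> *s b) (\<i> *s b)"

lemma D2_commute:
  assumes "cdiff 2 UNIV f"
  shows "D2 f x v w = D2 f x w v"
  unfolding D2_def by (rule second_derivative_commute[OF assms])

lemma D2_linear:
  assumes "cdiff 2 UNIV f"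
  shows "linear (D2 f x v)" "linear (\<lambda>v. D2 f x v w)"
proof -
  have "(\<lambda>y. frechet_derivative f (at y) v) differentiable (at x)" for v
    using assms by (simp add: numeral_2_eq_2)
  then show l: "linear (D2 f x v)" for v
    unfolding D2_def[abs_def] by (rule linear_frechet_derivative)
  have "(\<lambda>v. D2 f x v w) = D2 f x w" using D2_commute[OF assms] by auto
  then show "linear (\<lambda>v. D2 f x v w)" using l by simp
qed

text \<open>Both sides are expanded over the real basis vectors \<open>axis j 1\<close> and
  \<open>axis j \<i>\<close>. An abstract \<open>Q\<close> reduces this to bilinearity.\<close>

lemma bilinear_levi_form:
  fixes Q :: "complex ^ 'n::finite \<Rightarrow> complex ^ 'n \<Rightarrow> real"
  assumes l: "\<And>v. linear (Q v)" "\<And>w. linear (\<lambda>v. Q v w)"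
  shows "Re (\<Sum>j\<in>UNIV. \<Sum>k\<in>UNIV. ((complex_of_real (Q (axis j 1) (axis k 1) + Q (axis j \<i>) (axis k \<i>))
      + \<i> * complex_of_real (Q (axis j 1) (axis k \<i>) - Q (axis j \<i>) (axis k 1))) / 4) * b $ j * cnj (b $ k))
      = (Q b b + Q (\<i> *s b) (\<i> *s b)) / 4"
proof -
  define u where "u j = Re (b $ j) *\<^sub>R axis j 1 + Im (b $ j) *\<^sub>R axis j \<i>" for j
  define v where "v j = Re (b $ j) *\<^sub>R axis j \<i> - Im (b $ j) *\<^sub>R axis j 1" for j
  have b: "b = (\<Sum>j\<in>UNIV. u j)"
    by (auto simp: vec_eq_iff u_def axis_def complex_eq_iff if_distrib sum.distrib cong: if_cong)
  have ib: "\<i> *s b = (\<Sum>j\<in>UNIV. v j)"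
    by (auto simp: vec_eq_iff v_def axis_def complex_eq_iff if_distrib sum.distrib sum_subtractf cong: if_cong)
  have ss: "Q (\<Sum>j\<in>UNIV. s j) (\<Sum>k\<in>UNIV. s k) = (\<Sum>j\<in>UNIV. \<Sum>k\<in>UNIV. Q (s j) (s k))" for s :: "'n \<Rightarrow> complex ^ 'n"
    by (subst sum.swap) (simp only: linear_sum[OF l(2)] linear_sum[OF l(1)])
  have t: "Re (((complex_of_real (Q (axis j 1) (axis k 1) + Q (axis j \<i>) (axis k \<i>))
      + \<i> * complex_of_real (Q (axis j 1) (axis k \<i>) - Q (axis j \<i>) (axis k 1))) / 4) * b $ j * cnj (b $ k))
     = (Q (u j) (u k) + Q (v j) (v k)) / 4" for j k
    unfolding u_def v_def
    by (simp add: linear_add[OF l(1)] linear_diff[OF l(1)] linear_add[OF l(2)] linear_diff[OF l(2)]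
        linear_scale[OF l(1)] linear_scale[OF l(2)] field_simps)
  show ?thesis
    unfolding Re_sum t using ss[of u] ss[of v]
    by (simp add: b[symmetric] ib[symmetric] sum.distrib flip: sum_divide_distrib)
qed

lemma MA_density_nonneg:
  assumes f: "cdiff 2 UNIV f" and l: "\<And>b. 0 \<le> levi f x b"
  shows "0 \<le> MA_density f x"
proof -
  have "0 \<le> Re (det (cx_hessian f x))"
  proof (rule hermitian_psd_det_nonneg)
    show "cx_hessian f x $ k $ j = cnj (cx_hessian f x $ j $ k)" for j k
      unfolding cx_hessian_def
      by (simp add: complex_eq_iff D2_commute[OF f, of x "axis k _" "axis j _"])
    show "0 \<le> Re (\<Sum>j\<in>UNIV. \<Sum>k\<in>UNIV. cx_hessian f x $ j $ k * b $ j * cnj (b $ k))" for b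
      unfolding cx_hessian_def vec_lambda_beta bilinear_levi_form[OF D2_linear[OF f]]
      using l[of b] by (simp add: levi_def)
  qed
  then show ?thesis by (simp add: MA_density_def)
qed

lemma continuous_on_MA_density:
  assumes "cdiff 2 UNIV f"
  shows "continuous_on UNIV (MA_density f)"
proof -
  have "continuous_on UNIV (\<lambda>x. D2 f x v w)" for v w
    using assms by (simp add: numeral_2_eq_2 D2_def[abs_def])
  then show ?thesis
    unfolding MA_density_def[abs_def] det_def cx_hessian_def vec_lambda_beta
    by (intro continuous_intros) auto
qed

lemma D2_cong_open:
  assumes "open U" "x \<in> U" "\<And>y. y \<in> U \<Longrightarrow> f y = g y" "cdiff 2 U f"
  shows "D2 f x v w = D2 g x v w"
  unfolding D2_def
proof (rule fun_cong[OF frechet_derivative_transform_within_open[OF _ assms(1,2)]])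
  show "(\<lambda>y. frechet_derivative f (at y) v) differentiable at x"
    using assms(2,4) by (simp add: numeral_2_eq_2)
  show "frechet_derivative f (at y) v = frechet_derivative g (at y) v" if "y \<in> U" for y
    by (rule fun_cong[OF frechet_derivative_transform_within_open[OF _ assms(1) that assms(3)]])
       (use assms(4) that in \<open>simp add: numeral_2_eq_2\<close>)
qed

lemma MA_density_cong_open:
  assumes "open U" "x \<in> U" "\<And>y. y \<in> U \<Longrightarrow> f y = g y" "cdiff 2 U f"
  shows "MA_density f x = MA_density g x"
  unfolding MA_density_def cx_hessian_def by (simp only: D2_cong_open[where f = f and g = g, OF assms])

lemma levi_cong_open:
  assumes "open U" "x \<in> U" "\<And>y. y \<in> U \<Longrightarrow> f y = g y" "cdiff 2 U f"
  shows "levi f x b = levi g x b"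
  unfolding levi_def by (simp only: D2_cong_open[where f = f and g = g, OF assms])

text \<open>The normalized third central difference of \<open>max 0 t ^ 4\<close>: a convex function of class \<open>C\<^sup>3\<close> equal to \<open>max 0 t\<close>
  outside \<open>[-3, 3]\<close>. The second and third constants are its derivatives.\<close>

definition soft_pos :: "real \<Rightarrow> real" where
  "soft_pos t = (max 0 (t + 3) ^ 4 - 3 * max 0 (t + 1) ^ 4 + 3 * max 0 (t - 1) ^ 4 - max 0 (t - 3) ^ 4) / 192"

definition soft_pos1 :: "real \<Rightarrow> real" where
  "soft_pos1 t = (max 0 (t + 3) ^ 3 - 3 * max 0 (t + 1) ^ 3 + 3 * max 0 (t - 1) ^ 3 - max 0 (t - 3) ^ 3) / 48"

definition soft_pos2 :: "real \<Rightarrow> real" where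
  "soft_pos2 t = (max 0 (t + 3) ^ 2 - 3 * max 0 (t + 1) ^ 2 + 3 * max 0 (t - 1) ^ 2 - max 0 (t - 3) ^ 2) / 16"

lemma soft_pos_deriv:
  "(soft_pos has_real_derivative soft_pos1 t) (at t)"
  "(soft_pos1 has_real_derivative soft_pos2 t) (at t)"
proof -
  have d: "((\<lambda>t. max 0 (t + a) ^ (n + 2)) has_real_derivative real (n + 2) * max 0 (t + a) ^ (n + 1)) (at t)" for a n
    using DERIV_shift[of "\<lambda>t. max 0 t ^ (n + 2)" _ t a] pos_part_power_deriv[of n "t + a"] by blast
  have d4: "((\<lambda>t. max 0 (t + a) ^ 4) has_real_derivative 4 * max 0 (t + a) ^ 3) (at t)" for a
    using d[of a 2] by simp
  have d3: "((\<lambda>t. max 0 (t + a) ^ 3) has_real_derivative 3 * max 0 (t + a) ^ 2) (at t)" for a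
    using d[of a 1] by (simp add: numeral_3_eq_3 numeral_2_eq_2)
  have "((\<lambda>t. (max 0 (t + 3) ^ 4 - 3 * max 0 (t + 1) ^ 4 + 3 * max 0 (t + (-1)) ^ 4 - max 0 (t + (-3)) ^ 4) / 192)
    has_real_derivative (4 * max 0 (t + 3) ^ 3 - 3 * (4 * max 0 (t + 1) ^ 3) + 3 * (4 * max 0 (t + (-1)) ^ 3) - 4 * max 0 (t + (-3)) ^ 3) / 192) (at t)"
    by (intro DERIV_cdivide DERIV_diff DERIV_add DERIV_cmult d4)
  then show "(soft_pos has_real_derivative soft_pos1 t) (at t)"
    unfolding soft_pos_def[abs_def] diff_conv_add_uminus[of _ 1] diff_conv_add_uminus[of _ 3]
    by (rule DERIV_cong) (simp add: soft_pos1_def field_simps)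
  have "((\<lambda>t. (max 0 (t + 3) ^ 3 - 3 * max 0 (t + 1) ^ 3 + 3 * max 0 (t + (-1)) ^ 3 - max 0 (t + (-3)) ^ 3) / 48)
    has_real_derivative (3 * max 0 (t + 3) ^ 2 - 3 * (3 * max 0 (t + 1) ^ 2) + 3 * (3 * max 0 (t + (-1)) ^ 2) - 3 * max 0 (t + (-3)) ^ 2) / 48) (at t)"
    by (intro DERIV_cdivide DERIV_diff DERIV_add DERIV_cmult d3)
  then show "(soft_pos1 has_real_derivative soft_pos2 t) (at t)"
    unfolding soft_pos1_def[abs_def] diff_conv_add_uminus[of _ 1] diff_conv_add_uminus[of _ 3]
    by (rule DERIV_cong) (simp add: soft_pos2_def field_simps)
qed

lemma soft_pos_left: "t \<le> -3 \<Longrightarrow> soft_pos t = 0" "t \<le> -3 \<Longrightarrow> soft_pos1 t = 0"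
  by (auto simp: soft_pos_def soft_pos1_def max_def)

lemma soft_pos_right: "3 \<le> t \<Longrightarrow> soft_pos t = t" "3 \<le> t \<Longrightarrow> soft_pos1 t = 1"
  by (auto simp: soft_pos_def soft_pos1_def max_def power4_eq_xxxx power3_eq_cube field_simps)

text \<open>Up to the factor 1/16 this is a quadratic spline with knots -3, -1, 1, 3: its pieces are
  \<open>(t + 3)^2\<close>, \<open>6 - 2 t^2\<close> and \<open>(t - 3)^2\<close>, and it vanishes
  outside.\<close>

lemma soft_pos2_nonneg: "0 \<le> soft_pos2 t"
proof -
  consider "t \<le> -3" | "-3 < t" "t \<le> -1" | "-1 < t" "t \<le> 1" | "1 < t" "t \<le> 3" | "3 < t" by linarith
  then show ?thesis
  proof cases
    case 3
    then have "t * t \<le> 1"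
      by (metis abs_le_square_iff abs_le_iff abs_one less_eq_real_def minus_le_iff one_power2 power2_eq_square)
    then show ?thesis using 3 by (simp add: soft_pos2_def max_def power2_eq_square algebra_simps)
  next
    case 4
    have "0 \<le> (t - 3)\<^sup>2" by simp
    then show ?thesis using 4 by (simp add: soft_pos2_def max_def power2_eq_square algebra_simps)
  next
    case 5
    then show ?thesis by (simp add: soft_pos2_def max_def power2_eq_square algebra_simps)
  next
    case 2
    then have "max 0 (t + 1) = 0" "max 0 (t - 1) = 0" "max 0 (t - 3) = 0" by auto
    then show ?thesis by (simp add: soft_pos2_def)
  qed (simp add: soft_pos2_def max_def)
qed

lemma soft_pos1_bounds: "0 \<le> soft_pos1 t" "soft_pos1 t \<le> 1"
proof -
  have mono: "soft_pos1 s \<le> soft_pos1 t" if "s \<le> t" for s t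
    using DERIV_nonneg_imp_nondecreasing[OF that] soft_pos_deriv(2) soft_pos2_nonneg by blast
  show "0 \<le> soft_pos1 t"
    using mono[of "min t (-3)" t] soft_pos_left(2)[of "min t (-3)"] by simp
  show "soft_pos1 t \<le> 1"
    using mono[of t "max t 3"] soft_pos_right(2)[of "max t 3"] by simp
qed

lemma cdiff_soft_pos: "cdiff 3 UNIV soft_pos"
proof -
  have "cdiff 3 UNIV (\<lambda>t::real. max 0 t ^ 4)"
    using cdiff_pos_part_power[of 3] by simp
  then have p: "cdiff 3 UNIV (\<lambda>t::real. max 0 (t + a) ^ 4)" for a
    using cdiff_compose_real[where U = UNIV and V = UNIV and f = "\<lambda>t. t + a" and g = "\<lambda>t. max 0 t ^ 4" and n = 3]
    by (simp add: cdiff_add cdiff_linear bounded_linear_ident del: cdiff.simps)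
  have "cdiff 3 UNIV (\<lambda>t::real. (1/192) * (max 0 (t + 3) ^ 4 - 3 * max 0 (t + 1) ^ 4 + 3 * max 0 (t + (-1)) ^ 4 - max 0 (t + (-3)) ^ 4))"
    by (intro cdiff_mult cdiff_add cdiff_diff cdiff_const p open_UNIV)
  then show ?thesis by (simp add: soft_pos_def[abs_def])
qed

text \<open>By the chain rule the Levi form is a convex combination of those of \<open>w\<close> and
  \<open>f\<close> with weights \<open>1 - soft_pos1\<close> and \<open>soft_pos1\<close>, plus
  \<open>soft_pos2\<close> times a sum of squares of first derivatives of
  \<open>f - w\<close>.\<close>

lemma levi_soft_max:
  fixes f w :: "complex ^ 'n::finite \<Rightarrow> real"
  assumes f: "cdiff 2 UNIV f" and w: "cdiff 2 UNIV w"
    and "\<And>b. 0 \<le> levi f x b" "\<And>b. 0 \<le> levi w x b"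
  shows "0 \<le> levi (\<lambda>x. w x + soft_pos (f x - w x)) x b"
proof -
  define g where "g = (\<lambda>x. w x + soft_pos (f x - w x))"
  let ?f = "\<lambda>v y. frechet_derivative f (at y) v" and ?w = "\<lambda>v y. frechet_derivative w (at y) v"
  have f2: "cdiff (Suc (Suc 0)) UNIV f" and w2: "cdiff (Suc (Suc 0)) UNIV w"
    using f w by (simp_all add: numeral_2_eq_2 del: cdiff.simps)
  have f1: "cdiff (Suc 0) UNIV (?f v)" and w1: "cdiff (Suc 0) UNIV (?w v)" for v
    using f2 w2 cdiff.simps(2) by blast+
  have d: "(g has_derivative (\<lambda>v. ?w v y + soft_pos1 (f y - w y) * (?f v y - ?w v y))) (at y)" for y
  proof -
    have "((\<lambda>y. soft_pos (f y - w y)) has_derivative (\<lambda>v. soft_pos1 (f y - w y) * (?f v y - ?w v y))) (at y)"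
      using has_derivative_compose[OF has_derivative_diff[OF cdiff_has_derivative[OF f2 UNIV_I] cdiff_has_derivative[OF w2 UNIV_I]]
          soft_pos_deriv(1)[unfolded has_field_derivative_def]] by simp
    then show ?thesis
      unfolding g_def by (intro has_derivative_add cdiff_has_derivative[OF w2]) auto
  qed
  have e: "frechet_derivative g (at y) = (\<lambda>v. ?w v y + soft_pos1 (f y - w y) * (?f v y - ?w v y))" for y
    using frechet_derivative_at[OF d] by metis
  have d2: "((\<lambda>y. ?w v y + soft_pos1 (f y - w y) * (?f v y - ?w v y)) has_derivative
      (\<lambda>u. D2 w x v u + (soft_pos1 (f x - w x) * (D2 f x v u - D2 w x v u)
         + soft_pos2 (f x - w x) * (?f u x - ?w u x) * (?f v x - ?w v x)))) (at x)" for v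
  proof -
    have "((\<lambda>y. soft_pos1 (f y - w y)) has_derivative (\<lambda>v. soft_pos2 (f x - w x) * (?f v x - ?w v x))) (at x)"
      using has_derivative_compose[OF has_derivative_diff[OF cdiff_has_derivative[OF f2 UNIV_I] cdiff_has_derivative[OF w2 UNIV_I]]
          soft_pos_deriv(2)[unfolded has_field_derivative_def]] by simp
    then show ?thesis
      unfolding D2_def
      by (intro has_derivative_add has_derivative_mult has_derivative_diff cdiff_has_derivative[OF w1] cdiff_has_derivative[OF f1]) auto
  qed
  have D: "D2 g x v v = (1 - soft_pos1 (f x - w x)) * D2 w x v v + soft_pos1 (f x - w x) * D2 f x v v
     + soft_pos2 (f x - w x) * (?f v x - ?w v x)\<^sup>2" for v
  proof -
    have "D2 g x v v = D2 w x v v + (soft_pos1 (f x - w x) * (D2 f x v v - D2 w x v v)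
         + soft_pos2 (f x - w x) * (?f v x - ?w v x) * (?f v x - ?w v x))"
      unfolding D2_def[of g] e using frechet_derivative_at[OF d2] by metis
    then show ?thesis by (simp add: algebra_simps power2_eq_square)
  qed
  have "levi g x b = (1 - soft_pos1 (f x - w x)) * levi w x b + soft_pos1 (f x - w x) * levi f x b
     + soft_pos2 (f x - w x) * ((?f b x - ?w b x)\<^sup>2 + (?f (\<i> *s b) x - ?w (\<i> *s b) x)\<^sup>2)"
    unfolding levi_def D by (simp add: algebra_simps)
  then show ?thesis
    using assms(3)[of b] assms(4)[of b] soft_pos1_bounds[of "f x - w x"] soft_pos2_nonneg[of "f x - w x"]
    unfolding g_def[symmetric] by simp
qed

section \<open>Polydiscs, gluing and invariance of weighted masses\<close>

definition pdisc :: "real \<Rightarrow> (complex ^ 'n::finite) set" where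
  "pdisc r = {z. \<forall>i. norm (z $ i) < r}"

lemma polydisc_eq_pdisc: "polydisc = pdisc 1"
  by (simp add: polydisc_def pdisc_def)

lemma pdisc_mono: "r \<le> s \<Longrightarrow> pdisc r \<subseteq> pdisc s"
  unfolding pdisc_def by (auto intro: less_le_trans)

lemma open_pdisc: "open (pdisc r :: (complex ^ 'n::finite) set)"
proof -
  have "pdisc r = (\<Inter>i. {z::complex ^ 'n. norm (z $ i) < r})" by (auto simp: pdisc_def)
  moreover have "open {z::complex ^ 'n. norm (z $ i) < r}" for i
    by (intro open_Collect_less continuous_intros)
  ultimately show ?thesis by (auto intro!: open_INT)
qed

lemma closed_pdisc: "closed {z::complex ^ 'n::finite. \<forall>i. norm (z $ i) \<le> r}"
proof -
  have "{z::complex ^ 'n. \<forall>i. norm (z $ i) \<le> r} = (\<Inter>i. {z. norm (z $ i) \<le> r})" by auto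
  moreover have "closed {z::complex ^ 'n. norm (z $ i) \<le> r}" for i
    by (intro closed_Collect_le continuous_intros)
  ultimately show ?thesis by auto
qed

lemma norm_pdisc_le:
  fixes z :: "complex ^ 'n::finite" and r :: real
  assumes "\<And>i. norm (z $ i) \<le> r"
  shows "norm z \<le> CARD('n) * r"
proof -
  have "norm z \<le> (\<Sum>i\<in>UNIV. norm (z $ i))" unfolding norm_vec_def by (rule L2_set_le_sum) simp
  also have "\<dots> \<le> (\<Sum>i\<in>(UNIV::'n set). r)" by (rule sum_mono) (rule assms)
  finally show ?thesis by simp
qed

lemma bounded_pdisc: "bounded {z::complex ^ 'n::finite. \<forall>i. norm (z $ i) \<le> r}"
  unfolding bounded_iff using norm_pdisc_le by blast

lemma compact_pdisc: "compact {z::complex ^ 'n::finite. \<forall>i. norm (z $ i) \<le> r}"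
  using closed_pdisc bounded_pdisc compact_eq_bounded_closed by blast

text \<open>The glued function is the smoothed maximum \<open>w + soft_pos (f - w)\<close>. As
  \<open>soft_pos\<close> is exact outside \<open>[-3, 3]\<close>, a gap of 3 yields exactly the
  larger function, and \<open>out\<close> allows an extension by \<open>f\<close> beyond
  \<open>pdisc r\<close>.\<close>

lemma psh_glue:
  fixes f w :: "complex ^ 'n::finite \<Rightarrow> real"
  assumes f: "cdiff 3 UNIV f" and w: "cdiff 3 UNIV w" and r: "r' < r"
    and lf: "\<And>z b. z \<in> pdisc r \<Longrightarrow> 0 \<le> levi f z b" and lw: "\<And>z b. z \<in> pdisc r \<Longrightarrow> 0 \<le> levi w z b"
    and out: "\<And>z. z \<in> pdisc r \<Longrightarrow> z \<notin> pdisc r' \<Longrightarrow> w z + 3 \<le> f z"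
  obtains F where "cdiff 3 UNIV F" "\<And>z b. z \<in> pdisc r \<Longrightarrow> 0 \<le> levi F z b"
    "\<And>z. z \<notin> pdisc r' \<Longrightarrow> F z = f z"
    "\<And>z. z \<in> pdisc r \<Longrightarrow> f z + 3 \<le> w z \<Longrightarrow> F z = w z"
    "\<And>z. z \<in> pdisc r \<Longrightarrow> w z + 3 \<le> f z \<Longrightarrow> F z = f z"
proof -
  define G where "G = (\<lambda>z. w z + soft_pos (f z - w z))"
  define F where "F = (\<lambda>z. if z \<in> pdisc r then G z else f z)"
  \<comment> \<open>As \<open>r' < r\<close>, the sets \<open>pdisc r\<close> and \<open>V\<close>
    cover the space; \<open>F\<close> is the smoothed maximum on one and \<open>f\<close> on the
    other.\<close>
  define V where "V = - {z::complex ^ 'n. \<forall>i. norm (z $ i) \<le> r'}"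
  have V: "open V" unfolding V_def using closed_pdisc by blast
  have G: "cdiff 3 UNIV G"
    unfolding G_def
    by (intro cdiff_add w cdiff_compose_real[OF open_UNIV open_UNIV _ _ cdiff_soft_pos] cdiff_diff f) auto
  have out': "F z = f z" if "z \<notin> pdisc r'" for z
    using out[OF _ that] soft_pos_right(1)[of "f z - w z"] by (auto simp: F_def G_def)
  have "cdiff 3 (pdisc r) F"
    by (rule cdiff_cong[OF open_pdisc _ cdiff_subset[OF G]]) (auto simp: F_def)
  moreover have "cdiff 3 V F"
    by (rule cdiff_cong[OF V _ cdiff_subset[OF f]]) (auto simp: V_def pdisc_def intro!: out'[symmetric] intro: less_imp_le)
  moreover have "pdisc r \<union> V = UNIV"
  proof -
    have "z \<in> pdisc r" if "z \<notin> V" for z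
      using that r le_less_trans by (auto simp: V_def pdisc_def)
    then show ?thesis by blast
  qed
  ultimately have F: "cdiff 3 UNIV F" using cdiff_Un[OF open_pdisc V] by metis
  show ?thesis
  proof (rule that[of F])
    show "0 \<le> levi F z b" if z: "z \<in> pdisc r" for z b
    proof -
      have "levi F z b = levi G z b"
        by (rule levi_cong_open[OF open_pdisc z]) (simp add: F_def, rule cdiff_le[OF cdiff_subset[OF F]], auto)
      also have "\<dots> \<ge> 0"
        unfolding G_def by (rule levi_soft_max) (use lf lw z cdiff_le[OF f] cdiff_le[OF w] in auto)
      finally show ?thesis .
    qed
    show "F z = w z" if "z \<in> pdisc r" "f z + 3 \<le> w z" for z
      using that soft_pos_left(1)[of "f z - w z"] by (simp add: F_def G_def)
    show "F z = f z" if "z \<in> pdisc r" "w z + 3 \<le> f z" for z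
      using that soft_pos_right(1)[of "f z - w z"] by (simp add: F_def G_def)
  qed (use F out' in auto)
qed

lemma weighted_MA_integrable:
  fixes f :: "complex ^ 'n::finite \<Rightarrow> real"
  assumes "cdiff 2 UNIV f" "continuous_on UNIV \<rho>" "bounded {z. \<rho> z \<noteq> 0}"
  shows "(\<lambda>z. \<rho> z * MA_density f z) integrable_on UNIV"
proof (rule compact_support_integrable)
  show "continuous_on UNIV (\<lambda>z. \<rho> z * MA_density f z)"
    by (intro continuous_intros assms continuous_on_MA_density)
  show "bounded {z. \<rho> z * MA_density f z \<noteq> 0}"
    by (rule bounded_subset[OF assms(3)]) auto
qed

text \<open>The weight equals 1 wherever the two densities can differ, so the weighted difference is
  the unweighted one, which integrates to 0.\<close>

lemma weighted_MA_eq: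
  fixes f F :: "complex ^ 'n::finite \<Rightarrow> real"
  assumes f: "cdiff 3 UNIV f" and F: "cdiff 3 UNIV F" and eq: "\<And>z. z \<notin> pdisc r \<Longrightarrow> F z = f z"
    and rho: "continuous_on UNIV \<rho>" "bounded {z. \<rho> z \<noteq> 0}" "\<And>z. (\<forall>i. norm (z $ i) \<le> r) \<Longrightarrow> \<rho> z = 1"
  shows "integral UNIV (\<lambda>z. \<rho> z * MA_density F z) = integral UNIV (\<lambda>z. \<rho> z * MA_density f z)"
proof -
  have "{z. F z \<noteq> f z} \<subseteq> {z. \<forall>i. norm (z $ i) \<le> r}"
    using eq by (auto simp: pdisc_def) (meson less_imp_le)
  then have "bounded {z. F z \<noteq> f z}" using bounded_pdisc bounded_subset by blast
  then have i: "((\<lambda>z. MA_density F z - MA_density f z) has_integral 0) UNIV"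
    by (rule MA_density_compact_perturbation[OF F f])
  have e: "\<rho> z * MA_density F z - \<rho> z * MA_density f z = MA_density F z - MA_density f z" for z
  proof (cases "\<forall>i. norm (z $ i) \<le> r")
    case True
    then show ?thesis using rho(3) by simp
  next
    case False
    have "MA_density F z = MA_density f z"
    proof (rule MA_density_cong_open)
      show "open (- {z::complex ^ 'n. \<forall>i. norm (z $ i) \<le> r})" using closed_pdisc by blast
      show "cdiff 2 (- {z. \<forall>i. norm (z $ i) \<le> r}) F"
        using cdiff_le[OF cdiff_subset[OF F]] by auto
      show "F y = f y" if "y \<in> - {z. \<forall>i. norm (z $ i) \<le> r}" for y
        by (rule eq) (use that in \<open>auto simp: pdisc_def intro: less_imp_le\<close>)
    qed (use False in auto)
    then show ?thesis by simp
  qed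
  have "integral UNIV (\<lambda>z. \<rho> z * MA_density F z) - integral UNIV (\<lambda>z. \<rho> z * MA_density f z)
      = integral UNIV (\<lambda>z. \<rho> z * MA_density F z - \<rho> z * MA_density f z)"
    using cdiff_le[OF f, of 2] cdiff_le[OF F, of 2] rho
    by (intro integral_diff[symmetric] weighted_MA_integrable) auto
  also have "\<dots> = 0" unfolding e using i by (rule integral_unique)
  finally show ?thesis by simp
qed

section \<open>Sums of radial functions of the single coordinates\<close>

text \<open>The profiles are functions of the squared modulus, which keeps them smooth at the
  centre. The open set \<open>V\<close> admits profiles such as \<open>ln (t + s^2)\<close> that are
  not smooth on the whole line.\<close>

lemma separable_cdiff:
  fixes h :: "'n::finite \<Rightarrow> real \<Rightarrow> real" and a :: "complex ^ 'n"
  assumes "open V" "{0..} \<subseteq> V" "\<And>i. cdiff n V (h i)"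
  shows "cdiff n UNIV (\<lambda>z. \<Sum>i\<in>UNIV. h i ((z $ i - a $ i) \<bullet> (z $ i - a $ i)))"
proof (intro cdiff_sum open_UNIV)
  fix i
  have "cdiff n UNIV (\<lambda>z::complex ^ 'n. z $ i - a $ i)"
    by (intro cdiff_diff cdiff_const cdiff_linear bounded_linear_vec_nth open_UNIV)
  then have "cdiff n UNIV (\<lambda>z::complex ^ 'n. (z $ i - a $ i) \<bullet> (z $ i - a $ i))"
    by (intro cdiff_inner open_UNIV)
  then show "cdiff n UNIV (\<lambda>z. h i ((z $ i - a $ i) \<bullet> (z $ i - a $ i)))"
    by (rule cdiff_compose_real[OF open_UNIV assms(1) _ _ assms(3), rotated]) (use assms(2) in auto)
qed

lemma separable_D2:
  fixes h h1 h2 :: "'n::finite \<Rightarrow> real \<Rightarrow> real" and a :: "complex ^ 'n"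
  assumes d1: "\<And>i t. 0 \<le> t \<Longrightarrow> (h i has_real_derivative h1 i t) (at t)"
    and d2: "\<And>i t. 0 \<le> t \<Longrightarrow> (h1 i has_real_derivative h2 i t) (at t)"
  shows "D2 (\<lambda>z. \<Sum>i\<in>UNIV. h i ((z $ i - a $ i) \<bullet> (z $ i - a $ i))) z v w =
     (\<Sum>i\<in>UNIV. 4 * h2 i ((z $ i - a $ i) \<bullet> (z $ i - a $ i)) * ((z $ i - a $ i) \<bullet> v $ i) * ((z $ i - a $ i) \<bullet> w $ i)
         + 2 * h1 i ((z $ i - a $ i) \<bullet> (z $ i - a $ i)) * (v $ i \<bullet> w $ i))"
proof -
  let ?s = "\<lambda>i z. z $ i - a $ i" and ?t = "\<lambda>i z. (z $ i - a $ i) \<bullet> (z $ i - a $ i)"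
  let ?f = "\<lambda>z. \<Sum>i\<in>UNIV. h i (?t i z)"
  have s: "(?s i has_derivative (\<lambda>v. v $ i)) (at z)" for i z
    by (auto intro!: derivative_eq_intros bounded_linear_imp_has_derivative bounded_linear_vec_nth)
  have t: "(?t i has_derivative (\<lambda>v. 2 * (?s i z \<bullet> v $ i))) (at z)" for i z
    using has_derivative_inner[OF s[of i z] s[of i z]] by (simp add: inner_commute)
  have ht: "((\<lambda>z. h i (?t i z)) has_derivative (\<lambda>v. h1 i (?t i z) * (2 * (?s i z \<bullet> v $ i)))) (at z)" for i z
    using has_derivative_compose[OF t d1[OF inner_ge_zero, unfolded has_field_derivative_def]] .
  have h1t: "((\<lambda>z. h1 i (?t i z)) has_derivative (\<lambda>v. h2 i (?t i z) * (2 * (?s i z \<bullet> v $ i)))) (at z)" for i z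
    using has_derivative_compose[OF t d2[OF inner_ge_zero, unfolded has_field_derivative_def]] .
  have "(?f has_derivative (\<lambda>v. \<Sum>i\<in>UNIV. h1 i (?t i z) * (2 * (?s i z \<bullet> v $ i)))) (at z)" for z
    by (intro has_derivative_sum ht)
  then have e: "frechet_derivative ?f (at z) = (\<lambda>v. \<Sum>i\<in>UNIV. h1 i (?t i z) * (2 * (?s i z \<bullet> v $ i)))" for z
    by (rule frechet_derivative_at[symmetric])
  have "((\<lambda>z. \<Sum>i\<in>UNIV. h1 i (?t i z) * (2 * (?s i z \<bullet> v $ i))) has_derivative
     (\<lambda>w. \<Sum>i\<in>UNIV. h1 i (?t i z) * (2 * (w $ i \<bullet> v $ i)) + h2 i (?t i z) * (2 * (?s i z \<bullet> w $ i)) * (2 * (?s i z \<bullet> v $ i)))) (at z)"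
    by (intro has_derivative_sum has_derivative_mult h1t has_derivative_mult_right has_derivative_inner_left s)
  note F2 = this
  have "frechet_derivative (\<lambda>z. \<Sum>i\<in>UNIV. h1 i (?t i z) * (2 * (?s i z \<bullet> v $ i))) (at z) w
     = (\<Sum>i\<in>UNIV. h1 i (?t i z) * (2 * (w $ i \<bullet> v $ i)) + h2 i (?t i z) * (2 * (?s i z \<bullet> w $ i)) * (2 * (?s i z \<bullet> v $ i)))"
    by (rule fun_cong[OF frechet_derivative_at[OF F2, symmetric]])
  then show ?thesis unfolding D2_def e
    by (auto intro!: sum.cong simp: algebra_simps inner_commute)
qed

text \<open>The complex Hessian is diagonal: applying \<open>d^2 / dz d(conj z)\<close> to a profile
  of the squared modulus \<open>t\<close> gives \<open>h1 + t * h2\<close>.\<close>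

lemma separable_MA_density:
  fixes h h1 h2 :: "'n::finite \<Rightarrow> real \<Rightarrow> real" and a :: "complex ^ 'n"
  assumes d1: "\<And>i t. 0 \<le> t \<Longrightarrow> (h i has_real_derivative h1 i t) (at t)"
    and d2: "\<And>i t. 0 \<le> t \<Longrightarrow> (h1 i has_real_derivative h2 i t) (at t)"
  shows "MA_density (\<lambda>z. \<Sum>i\<in>UNIV. h i ((z $ i - a $ i) \<bullet> (z $ i - a $ i))) z = 4 ^ CARD('n) * fact CARD('n) *
     (\<Prod>i\<in>UNIV. h1 i ((z $ i - a $ i) \<bullet> (z $ i - a $ i)) + ((z $ i - a $ i) \<bullet> (z $ i - a $ i)) * h2 i ((z $ i - a $ i) \<bullet> (z $ i - a $ i)))"
proof -
  let ?s = "\<lambda>i z. z $ i - a $ i" and ?t = "\<lambda>i z. (z $ i - a $ i) \<bullet> (z $ i - a $ i)"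
  let ?f = "\<lambda>z. \<Sum>i\<in>UNIV. h i (?t i z)"
  have S: "D2 (\<lambda>z. \<Sum>i\<in>UNIV. h i ((z $ i - a $ i) \<bullet> (z $ i - a $ i))) z v w =
     (\<Sum>i\<in>UNIV. 4 * h2 i ((z $ i - a $ i) \<bullet> (z $ i - a $ i)) * ((z $ i - a $ i) \<bullet> v $ i) * ((z $ i - a $ i) \<bullet> w $ i)
         + 2 * h1 i ((z $ i - a $ i) \<bullet> (z $ i - a $ i)) * (v $ i \<bullet> w $ i))" for v w
    by (rule separable_D2) (use d1 d2 in auto)
  have D: "D2 ?f z (axis j x) (axis k y) = (if j = k then 4 * h2 j (?t j z) * (?s j z \<bullet> x) * (?s j z \<bullet> y) + 2 * h1 j (?t j z) * (x \<bullet> y) else 0)" for j k x y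
    unfolding S by (subst sum.remove[of UNIV j]) (auto simp: axis_def intro!: sum.neutral)
  have n: "(?s j z \<bullet> 1) * (?s j z \<bullet> 1) + (?s j z \<bullet> \<i>) * (?s j z \<bullet> \<i>) = ?t j z" for j
    by (simp add: inner_complex_def power2_eq_square)
  have H: "cx_hessian ?f z $ j $ k = (if j = k then complex_of_real (h1 j (?t j z) + ?t j z * h2 j (?t j z)) else 0)" for j k
  proof (cases "j = k")
    case True
    have "D2 ?f z (axis j 1) (axis j 1) + D2 ?f z (axis j \<i>) (axis j \<i>)
      = 4 * h2 j (?t j z) * ((?s j z \<bullet> 1) * (?s j z \<bullet> 1) + (?s j z \<bullet> \<i>) * (?s j z \<bullet> \<i>)) + 4 * h1 j (?t j z)"
      unfolding D by (simp add: algebra_simps)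
    moreover have "D2 ?f z (axis j 1) (axis j \<i>) - D2 ?f z (axis j \<i>) (axis j 1) = 0"
      unfolding D by (simp add: inner_commute)
    ultimately have "cx_hessian ?f z $ j $ j = (complex_of_real (4 * h2 j (?t j z) * ?t j z + 4 * h1 j (?t j z)) + \<i> * complex_of_real 0) / 4"
      unfolding cx_hessian_def n vec_lambda_beta by (simp only:)
    also have "\<dots> = complex_of_real (h1 j (?t j z) + ?t j z * h2 j (?t j z))" by simp
    finally show ?thesis using True by simp
  next
    case False
    then show ?thesis unfolding cx_hessian_def by (simp add: D)
  qed
  have "det (cx_hessian ?f z) = (\<Prod>i\<in>UNIV. complex_of_real (h1 i (?t i z) + ?t i z * h2 i (?t i z)))"
    by (subst det_diagonal) (auto simp: H)
  then show ?thesis unfolding MA_density_def by (simp only: of_real_prod[symmetric] Re_complex_of_real)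
qed

lemma separable_levi_nonneg:
  fixes h h1 h2 :: "'n::finite \<Rightarrow> real \<Rightarrow> real" and a :: "complex ^ 'n"
  assumes d1: "\<And>i t. 0 \<le> t \<Longrightarrow> (h i has_real_derivative h1 i t) (at t)"
    and d2: "\<And>i t. 0 \<le> t \<Longrightarrow> (h1 i has_real_derivative h2 i t) (at t)"
    and pos: "\<And>i t. 0 \<le> t \<Longrightarrow> 0 \<le> h1 i t + t * h2 i t"
  shows "0 \<le> levi (\<lambda>z. \<Sum>i\<in>UNIV. h i ((z $ i - a $ i) \<bullet> (z $ i - a $ i))) z b"
proof -
  let ?s = "\<lambda>i. z $ i - a $ i" and ?t = "\<lambda>i. (z $ i - a $ i) \<bullet> (z $ i - a $ i)"
  have S: "D2 (\<lambda>z. \<Sum>i\<in>UNIV. h i ((z $ i - a $ i) \<bullet> (z $ i - a $ i))) z v w =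
     (\<Sum>i\<in>UNIV. 4 * h2 i ((z $ i - a $ i) \<bullet> (z $ i - a $ i)) * ((z $ i - a $ i) \<bullet> v $ i) * ((z $ i - a $ i) \<bullet> w $ i)
         + 2 * h1 i ((z $ i - a $ i) \<bullet> (z $ i - a $ i)) * (v $ i \<bullet> w $ i))" for v w
    by (rule separable_D2) (use d1 d2 in auto)
  \<comment> \<open>\<open>b\<close> and \<open>\<i> * b\<close> are orthogonal of equal length, so
    this is Pythagoras; it merges the two directions of the Levi form.\<close>
  have n: "(s \<bullet> b) * (s \<bullet> b) + (s \<bullet> (\<i> * b)) * (s \<bullet> (\<i> * b)) = (s \<bullet> s) * (b \<bullet> b)" for s b :: complex
    by (simp add: inner_complex_def algebra_simps)
  have m: "(\<i> * b) \<bullet> (\<i> * b) = b \<bullet> b" for b by (simp add: inner_complex_def)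
  have "levi (\<lambda>z. \<Sum>i\<in>UNIV. h i ((z $ i - a $ i) \<bullet> (z $ i - a $ i))) z b
     = (\<Sum>i\<in>UNIV. 4 * h2 i (?t i) * ((?s i \<bullet> b $ i) * (?s i \<bullet> b $ i) + (?s i \<bullet> (\<i> * b $ i)) * (?s i \<bullet> (\<i> * b $ i))) + 4 * h1 i (?t i) * (b $ i \<bullet> b $ i))"
    unfolding levi_def S sum.distrib[symmetric]
    by (rule sum.cong) (auto simp: m algebra_simps)
  also have "\<dots> = (\<Sum>i\<in>UNIV. 4 * (b $ i \<bullet> b $ i) * (h1 i (?t i) + ?t i * h2 i (?t i)))"
    unfolding n by (auto intro!: sum.cong simp: algebra_simps)
  also have "\<dots> \<ge> 0" by (intro sum_nonneg mult_nonneg_nonneg pos) auto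
  finally show ?thesis .
qed

section \<open>Circle means and the Levi form\<close>

lemma trig_integrals:
  "((\<lambda>x. cos x) has_integral 0) {0..2*pi}" "((\<lambda>x. sin x) has_integral 0) {0..2*pi}"
  "((\<lambda>x. cos x * cos x) has_integral pi) {0..2*pi}" "((\<lambda>x. sin x * sin x) has_integral pi) {0..2*pi}"
  "((\<lambda>x. cos x * sin x) has_integral 0) {0..2*pi}"
proof -
  have p: "0 \<le> 2 * pi" by simp
  have cs: "cos x * cos x = 1 - sin x * sin x" for x :: real
    using sin_cos_squared_add[of x] by (simp add: power2_eq_square)
  have F: "(g' has_integral g (2*pi) - g 0) {0..2*pi}" if "\<And>x. (g has_real_derivative g' x) (at x)" for g g'
    using that by (intro fundamental_theorem_of_calculus[OF p])
      (simp add: has_field_derivative_at_within flip: has_real_derivative_iff_has_vector_derivative)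
  show "((\<lambda>x. cos x) has_integral 0) {0..2*pi}"
    using F[of sin cos] by (simp add: DERIV_sin)
  have "((\<lambda>x. - cos x) has_real_derivative sin x) (at x)" for x
    by (auto intro!: derivative_eq_intros)
  from F[OF this] show "((\<lambda>x. sin x) has_integral 0) {0..2*pi}" by simp
  have "((\<lambda>x. (x + sin x * cos x) / 2) has_real_derivative cos x * cos x) (at x)" for x :: real
    by (auto intro!: derivative_eq_intros simp: cs)
  from F[OF this] show "((\<lambda>x. cos x * cos x) has_integral pi) {0..2*pi}" by simp
  have "((\<lambda>x. (x - sin x * cos x) / 2) has_real_derivative sin x * sin x) (at x)" for x :: real
    by (auto intro!: derivative_eq_intros simp: cs)
  from F[OF this] show "((\<lambda>x. sin x * sin x) has_integral pi) {0..2*pi}" by simp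
  have "((\<lambda>x. (sin x * sin x) / 2) has_real_derivative cos x * sin x) (at x)" for x :: real
    by (auto intro!: derivative_eq_intros)
  from F[OF this] show "((\<lambda>x. cos x * sin x) has_integral 0) {0..2*pi}" by simp
qed

lemma cis_smult: "cis \<theta> *s b = cos \<theta> *\<^sub>R b + sin \<theta> *\<^sub>R (\<i> *s b)"
  by (simp add: vec_eq_iff complex_eq_iff)

text \<open>The integral \<open>m r\<close> over the circle of radius \<open>r\<close> has first
  derivative 0 and second derivative \<open>pi * levi f a b\<close> at \<open>r = 0\<close>. A
  negative Levi form would make \<open>m\<close> decrease strictly for small \<open>r\<close>,
  against the sub-mean value inequality.\<close>

lemma levi_nonneg_of_submean:
  fixes f :: "complex ^ 'n::finite \<Rightarrow> real"
  assumes f: "cdiff 2 UNIV f" and e: "0 < e"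
    and sm: "\<And>r. 0 < r \<Longrightarrow> r < e \<Longrightarrow> f a \<le> 1 / (2 * pi) * integral {0..2*pi} (\<lambda>\<theta>. f (a + r *\<^sub>R (cis \<theta> *s b)))"
  shows "0 \<le> levi f a b"
proof (rule ccontr)
  assume neg: "\<not> 0 \<le> levi f a b"
  define c where "c = \<i> *s b"
  define v where "v \<theta> = cos \<theta> *\<^sub>R b + sin \<theta> *\<^sub>R c" for \<theta>
  have v: "cis \<theta> *s b = v \<theta>" for \<theta> unfolding v_def c_def by (rule cis_smult)
  have cv: "continuous_on S v" for S unfolding v_def by (intro continuous_intros)
  let ?D = "\<lambda>u y. frechet_derivative f (at y) u"
  have f2: "cdiff (Suc (Suc 0)) UNIV f" using f by (simp add: numeral_2_eq_2)
  have f1: "cdiff (Suc 0) UNIV (?D u)" for u using f2 by (simp only: cdiff.simps(2)[of "Suc 0"])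
  have cf: "continuous_on UNIV f" by (rule cdiff_continuous[OF f])
  have cD: "continuous_on UNIV (?D u)" for u by (rule cdiff_continuous[OF f1])
  have cE: "continuous_on UNIV (\<lambda>y. D2 f y u w)" for u w using f1[of u] by (simp add: D2_def)
  have lin: "linear (frechet_derivative f (at y))" for y
    using cdiff_has_derivative[OF f2] has_derivative_linear by blast
  define m where "m r = integral (cbox 0 (2*pi)) (\<lambda>\<theta>. f (a + r *\<^sub>R v \<theta>))" for r
  define P where "P r \<theta> = cos \<theta> * ?D b (a + r *\<^sub>R v \<theta>) + sin \<theta> * ?D c (a + r *\<^sub>R v \<theta>)" for r \<theta>
  define Q where "Q r \<theta> = (cos \<theta> * cos \<theta>) * D2 f (a + r *\<^sub>R v \<theta>) b b + (cos \<theta> * sin \<theta>) * D2 f (a + r *\<^sub>R v \<theta>) b c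
      + (cos \<theta> * sin \<theta>) * D2 f (a + r *\<^sub>R v \<theta>) c b + (sin \<theta> * sin \<theta>) * D2 f (a + r *\<^sub>R v \<theta>) c c" for r \<theta>
  have d1: "((\<lambda>r. f (a + r *\<^sub>R v \<theta>)) has_real_derivative P r \<theta>) (at r within S)" for r \<theta> S
    using has_vector_derivative_line[OF f2, of a "v \<theta>" r S]
    by (simp add: has_real_derivative_iff_has_vector_derivative P_def v_def linear_scale[OF lin] linear_add[OF lin])
  have d2u: "((\<lambda>r. ?D u (a + r *\<^sub>R v \<theta>)) has_real_derivative
      (cos \<theta> * D2 f (a + r *\<^sub>R v \<theta>) u b + sin \<theta> * D2 f (a + r *\<^sub>R v \<theta>) u c)) (at r within S)" for u r \<theta> S
    using has_vector_derivative_line[OF f1[of u], of a "v \<theta>" r S, folded D2_def]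
    by (simp add: has_real_derivative_iff_has_vector_derivative v_def
        linear_scale[OF D2_linear(1)[OF f]] linear_add[OF D2_linear(1)[OF f]])
  have d2: "((\<lambda>r. P r \<theta>) has_real_derivative Q r \<theta>) (at r within S)" for r \<theta> S
    unfolding P_def[abs_def] Q_def
    by (rule DERIV_cong[OF DERIV_add[OF DERIV_cmult[OF d2u] DERIV_cmult[OF d2u]]]) (simp add: algebra_simps)
  have cl: "continuous_on (UNIV \<times> S) (\<lambda>x. a + fst x *\<^sub>R v (snd x))" for S
    unfolding v_def by (intro continuous_intros)
  have m1: "(m has_real_derivative integral (cbox 0 (2*pi)) (P r)) (at r within UNIV)" for r
    unfolding m_def[abs_def]
  proof (rule leibniz_rule_field_derivative[OF d1])
    show "(\<lambda>\<theta>. f (a + r *\<^sub>R v \<theta>)) integrable_on cbox 0 (2*pi)" for r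
      by (rule integrable_continuous) (auto intro!: continuous_intros continuous_on_compose2[OF cf] cv)
    show "continuous_on (UNIV \<times> cbox 0 (2*pi)) (\<lambda>(r, \<theta>). P r \<theta>)"
      unfolding P_def split_beta
      by (intro continuous_intros continuous_on_compose2[OF cD cl]) auto
  qed auto
  have m2: "((\<lambda>r. integral (cbox 0 (2*pi)) (P r)) has_real_derivative integral (cbox 0 (2*pi)) (Q r)) (at r within UNIV)" for r
  proof (rule leibniz_rule_field_derivative[OF d2])
    show "P r integrable_on cbox 0 (2*pi)" for r
      unfolding P_def by (rule integrable_continuous) (auto intro!: continuous_intros continuous_on_compose2[OF cD] cv)
    show "continuous_on (UNIV \<times> cbox 0 (2*pi)) (\<lambda>(r, \<theta>). Q r \<theta>)"
      unfolding Q_def split_beta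
      by (intro continuous_intros continuous_on_compose2[OF cE cl]) auto
  qed auto
  \<comment> \<open>At \<open>r = 0\<close> the derivatives of \<open>f\<close> are constant along
    the circle, so only trigonometric integrals remain.\<close>
  have "(P 0 has_integral 0 * ?D b a + 0 * ?D c a) {0..2*pi}"
    unfolding P_def[abs_def] by (simp only: scaleR_zero_left add_0_right, intro has_integral_add has_integral_mult_left trig_integrals)
  then have P0: "integral (cbox 0 (2*pi)) (P 0) = 0" by (simp add: integral_unique)
  have "(Q 0 has_integral pi * D2 f a b b + 0 * D2 f a b c + 0 * D2 f a c b + pi * D2 f a c c) {0..2*pi}"
    unfolding Q_def[abs_def] by (simp only: scaleR_zero_left add_0_right, intro has_integral_add has_integral_mult_left trig_integrals)
  then have "integral (cbox 0 (2*pi)) (Q 0) = pi * levi f a b"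
    by (simp add: integral_unique levi_def c_def algebra_simps)
  then have "integral (cbox 0 (2*pi)) (Q 0) < 0" using neg by (simp add: mult_pos_neg)
  from DERIV_neg_dec_right[OF m2[of 0] this] P0
  obtain d where d: "d > 0" "\<And>h. 0 < h \<Longrightarrow> h < d \<Longrightarrow> integral (cbox 0 (2*pi)) (P h) < 0" by auto
  define r where "r = min d e / 2"
  have r: "0 < r" "r < d" "r < e" using d(1) e by (auto simp: r_def)
  have "m r < m 0"
  proof (rule DERIV_neg_imp_decreasing_open[OF r(1)])
    show "\<exists>y. (m has_real_derivative y) (at x) \<and> y < 0" if "0 < x" "x < r" for x
      using m1[of x] d(2)[of x] that r by auto
    show "continuous_on {0..r} m"
      using m1 by (meson DERIV_isCont continuous_at_imp_continuous_on)
  qed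
  moreover have "m 0 = 2 * pi * f a" by (simp add: m_def)
  moreover have "2 * pi * f a \<le> m r"
    using sm[OF r(1,3)] by (simp add: v m_def field_simps)
  ultimately show False by simp
qed

text \<open>\<open>psh\<close> speaks of means of truncations. Truncating at a level below all
  values of \<open>q\<close> keeps the truncated function under \<open>q\<close>.\<close>

lemma psh_le_mean:
  fixes u :: "complex ^ 'n::finite \<Rightarrow> ereal"
  assumes u: "psh \<Omega> u" and disc: "\<And>\<zeta>::complex. norm \<zeta> \<le> 1 \<Longrightarrow> a + \<zeta> *s b \<in> \<Omega>"
    and q: "continuous_on {0..2*pi} q" and le: "\<And>\<theta>. u (a + cis \<theta> *s b) \<le> ereal (q \<theta>)"
  shows "u a \<le> ereal (1 / (2 * pi) * integral {0..2*pi} q)"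
proof -
  have Om: "open \<Omega>" and usc: "openin (top_of_set \<Omega>) {z\<in>\<Omega>. u z < c}" for c
    using u by (auto simp: psh_def usc_on_def)
  have a: "a \<in> \<Omega>" using disc[of 0] by simp
  obtain N where N: "\<And>\<theta>. \<theta> \<in> {0..2*pi} \<Longrightarrow> \<bar>q \<theta>\<bar> \<le> N"
    using compact_imp_bounded[OF compact_continuous_image[OF q compact_Icc]]
    unfolding bounded_iff real_norm_def ball_simps by blast
  define g where "g \<theta> = real_of_ereal (max (u (a + cis \<theta> *s b)) (ereal (- N)))" for \<theta>
  have in_disc: "a + cis \<theta> *s b \<in> \<Omega>" for \<theta> by (rule disc) simp
  have fin: "u (a + cis \<theta> *s b) < \<infinity>" for \<theta>
    using u in_disc by (auto simp: psh_def usc_on_def)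
  have g: "ereal (g \<theta>) = max (u (a + cis \<theta> *s b)) (ereal (- N))" for \<theta>
    unfolding g_def using fin[of \<theta>] by (cases "u (a + cis \<theta> *s b)") (auto simp: max_def)
  have lo: "- N \<le> g \<theta>" for \<theta>
  proof -
    have "ereal (-N) \<le> ereal (g \<theta>)" unfolding g by simp
    then show ?thesis by simp
  qed
  have hi: "g \<theta> \<le> q \<theta>" if "\<theta> \<in> {0..2*pi}" for \<theta>
  proof -
    have "ereal (g \<theta>) \<le> ereal (q \<theta>)" unfolding g using le[of \<theta>] N[OF that] by simp
    then show ?thesis by simp
  qed
  have cont: "continuous_on UNIV (\<lambda>\<theta>. a + cis \<theta> *s b)"
    unfolding cis_smult by (intro continuous_intros)
  \<comment> \<open>Upper semicontinuity gives measurability, hence integrability of the bounded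
    truncation. This matters because \<open>integral\<close> has the default value 0 on
    non-integrable functions.\<close>
  have "(\<lambda>\<theta>. u (a + cis \<theta> *s b)) \<in> borel_measurable borel"
  proof (rule borel_measurableI_less)
    fix c
    have "open {z\<in>\<Omega>. u z < c}" using usc Om by (meson openin_open_trans)
    then have "open ((\<lambda>\<theta>. a + cis \<theta> *s b) -` {z\<in>\<Omega>. u z < c})"
      by (rule open_vimage[OF _ cont])
    moreover have "(\<lambda>\<theta>. a + cis \<theta> *s b) -` {z\<in>\<Omega>. u z < c} = {\<theta>\<in>space borel. u (a + cis \<theta> *s b) < c}"
      using in_disc by auto
    ultimately show "{\<theta>\<in>space borel. u (a + cis \<theta> *s b) < c} \<in> sets borel" by auto
  qed
  then have "g \<in> borel_measurable borel" unfolding g_def[abs_def] by measurable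
  then have meas: "g \<in> borel_measurable (lebesgue_on {0..2*pi})"
    by (simp add: measurable_completion measurable_restrict_space1)
  have gi: "g integrable_on {0..2*pi}"
  proof (rule measurable_bounded_by_integrable_imp_integrable[OF meas, where g = "\<lambda>_. N"])
    show "norm (g \<theta>) \<le> N" if "\<theta> \<in> {0..2*pi}" for \<theta>
      using lo[of \<theta>] hi[OF that] N[OF that] by simp
  qed auto
  have "integral {0..2*pi} g \<le> integral {0..2*pi} q"
    by (rule integral_le[OF gi integrable_continuous_real[OF q] hi])
  then have "1 / (2 * pi) * integral {0..2*pi} g \<le> 1 / (2 * pi) * integral {0..2*pi} q"
    by (intro mult_left_mono) auto
  moreover have "u a \<le> ereal (1 / (2 * pi) * integral {0..2*pi} g)"
    using u a disc unfolding psh_def g_def by blast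
  ultimately show ?thesis by (meson ereal_less_eq(3) order_trans)
qed

section \<open>Smooth approximation of bounded plurisubharmonic functions\<close>

text \<open>A directional derivative falls on the kernel and gives a convolution of the same form,
  which drives the induction. The derivative is packaged as a \<open>blinfun\<close> in order to
  differentiate under the integral sign.\<close>

lemma cdiff_convolution:
  fixes G :: "'a::euclidean_space \<Rightarrow> real" and \<eta> :: "'a \<Rightarrow> real"
  assumes G: "continuous_on UNIV G" and "cdiff n UNIV \<eta>"
  shows "cdiff n UNIV (\<lambda>z. integral (cbox a b) (\<lambda>x. G x * \<eta> (z - x)))"
  using assms(2)
proof (induction n arbitrary: \<eta>)
  case 0
  then have c: "continuous_on UNIV \<eta>" by simp
  have "continuous_on UNIV (\<lambda>z. integral (cbox a b) (\<lambda>x. G x * \<eta> (z - x)))"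
  proof (rule integral_continuous_on_param)
    show "continuous_on (UNIV \<times> cbox a b) (\<lambda>(z, x). G x * \<eta> (z - x))"
      unfolding split_beta
      by (intro continuous_intros continuous_on_compose2[OF G] continuous_on_compose2[OF c]) auto
  qed
  then show ?case by simp
next
  case (Suc n)
  have c: "continuous_on UNIV \<eta>" by (rule cdiff_continuous[OF Suc.prems])
  have cD: "continuous_on UNIV (\<lambda>y. frechet_derivative \<eta> (at y) v)" for v
    using Suc.prems cdiff_continuous by (metis cdiff.simps(2))
  have d: "(\<eta> has_derivative frechet_derivative \<eta> (at y)) (at y)" for y
    using cdiff_has_derivative[OF Suc.prems] by blast
  have bl: "bounded_linear (frechet_derivative \<eta> (at y))" for y
    using d has_derivative_bounded_linear by blast
  define B where "B y = Blinfun (frechet_derivative \<eta> (at y))" for y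
  have B: "blinfun_apply (B y) = frechet_derivative \<eta> (at y)" for y
    unfolding B_def using bl by (simp add: bounded_linear_Blinfun_apply)
  have cB: "continuous_on UNIV B"
    by (rule continuous_on_blinfun_componentwise) (simp add: B cD)
  have "((\<lambda>z. integral (cbox a b) (\<lambda>x. G x * \<eta> (z - x))) has_derivative
      blinfun_apply (integral (cbox a b) (\<lambda>x. G x *\<^sub>R B (z - x)))) (at z within UNIV)" for z
  proof (rule leibniz_rule)
    show "((\<lambda>z. G x * \<eta> (z - x)) has_derivative blinfun_apply (G x *\<^sub>R B (z - x))) (at z within UNIV)" for z x
    proof -
      have "((\<lambda>z. z - x) has_derivative (\<lambda>v. v)) (at z)" by (auto intro!: derivative_eq_intros)
      from has_derivative_mult_right[OF has_derivative_compose[OF this d], of "G x"]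
      show ?thesis by (simp add: scaleR_blinfun.rep_eq B)
    qed
    show "(\<lambda>x. G x * \<eta> (z - x)) integrable_on cbox a b" for z
      by (rule integrable_continuous) (intro continuous_intros continuous_on_compose2[OF G] continuous_on_compose2[OF c]; auto)
    show "continuous_on (UNIV \<times> cbox a b) (\<lambda>(z, x). G x *\<^sub>R B (z - x))"
      unfolding split_beta
      by (intro continuous_intros continuous_on_compose2[OF G] continuous_on_compose2[OF cB]) auto
  qed auto
  moreover have "blinfun_apply (integral (cbox a b) (\<lambda>x. G x *\<^sub>R B (z - x))) v
     = integral (cbox a b) (\<lambda>x. G x * frechet_derivative \<eta> (at (z - x)) v)" for z v
  proof -
    have "(\<lambda>x. G x *\<^sub>R B (z - x)) integrable_on cbox a b"
      by (rule integrable_continuous) (intro continuous_intros continuous_on_compose2[OF G] continuous_on_compose2[OF cB]; auto)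
    from integral_linear[OF this bounded_bilinear.bounded_linear_left[OF bounded_bilinear_blinfun_apply, of v]]
    show ?thesis by (simp add: o_def scaleR_blinfun.rep_eq B)
  qed
  ultimately have D: "((\<lambda>z. integral (cbox a b) (\<lambda>x. G x * \<eta> (z - x))) has_derivative
      (\<lambda>v. integral (cbox a b) (\<lambda>x. G x * frechet_derivative \<eta> (at (z - x)) v))) (at z)" for z
    by (metis (no_types, lifting) has_derivative_eq_rhs ext)
  show ?case
    by (rule cdiff_SucI[OF open_UNIV D Suc.IH]) (use Suc.prems in simp)
qed

text \<open>The fourth power of the positive part of \<open>e^2 - x \<bullet> x\<close> is of class
  C^3; dividing by its integral normalizes it.\<close>

lemma smooth_kernel_exists:
  fixes e :: real
  assumes "0 < e"
  obtains \<eta> :: "'a::euclidean_space \<Rightarrow> real" where "cdiff 3 UNIV \<eta>" "\<And>x. 0 \<le> \<eta> x" "\<And>x. \<eta> (- x) = \<eta> x"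
    "\<And>x. e \<le> norm x \<Longrightarrow> \<eta> x = 0" "(\<eta> has_integral 1) UNIV"
proof -
  define k where "k x = max 0 (e\<^sup>2 - x \<bullet> x) ^ 4" for x :: 'a
  have k3: "cdiff 3 UNIV k"
    unfolding k_def[abs_def]
  proof (rule cdiff_compose_real[where g = "\<lambda>t. max 0 t ^ 4"])
    show "cdiff 3 UNIV (\<lambda>x::'a. e\<^sup>2 - x \<bullet> x)"
      by (intro cdiff_diff cdiff_const cdiff_inner cdiff_linear bounded_linear_ident open_UNIV)
    show "cdiff 3 UNIV (\<lambda>t::real. max 0 t ^ 4)" using cdiff_pos_part_power[of 3] by simp
  qed auto
  have k0: "k x = 0" if "e \<le> norm x" for x
  proof -
    have "e\<^sup>2 \<le> (norm x)\<^sup>2" using that assms by (intro power_mono) auto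
    then show ?thesis by (simp add: k_def dot_square_norm)
  qed
  have ck: "continuous_on UNIV k" by (rule cdiff_continuous[OF k3])
  obtain a where a: "cball 0 e \<subseteq> cbox (-a) (a::'a)" using bounded_subset_cbox_symmetric[OF bounded_cball] by blast
  have supp: "x \<in> cbox (-a) a" if "k x \<noteq> 0" for x using a k0[of x] that by force
  define I where "I = integral (cbox (-a) a) k"
  have ki: "k integrable_on cbox (-a) a" using ck by (meson continuous_on_subset integrable_continuous subset_UNIV)
  have kpos: "0 \<le> k x" for x by (simp add: k_def)
  \<comment> \<open>A nonnegative continuous function with integral 0 on the box would vanish at the
    interior point 0, where \<open>k\<close> is positive.\<close>
  have "I \<noteq> 0"
  proof
    assume "I = 0"
    then have "(k has_integral 0) (cbox (-a) a)" using ki by (simp add: I_def has_integral_integrable_integral)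
    moreover have "0 \<in> box (-a) a"
    proof -
      have "a \<bullet> i > 0" if "i \<in> Basis" for i
      proof -
        have "e *\<^sub>R i \<in> cbox (-a) a" using a that assms by force
        then have "e *\<^sub>R i \<bullet> i \<le> a \<bullet> i" using that unfolding mem_box by blast
        then show ?thesis using assms that by simp
      qed
      then show ?thesis by (simp add: mem_box)
    qed
    then have "box (-a) a \<noteq> {}" "0 \<in> cbox (-a) a" using box_subset_cbox by auto
    ultimately have "k 0 = 0"
      using has_integral_0_cbox_imp_0[of "-a" a k 0] ck kpos by (auto intro: continuous_on_subset)
    then show False using assms by (simp add: k_def)
  qed
  moreover have "0 \<le> I" unfolding I_def by (rule integral_nonneg[OF ki]) (rule kpos)
  ultimately have I: "0 < I" by simp
  have "(k has_integral I) UNIV"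
  proof -
    have "bounded {x. k x \<noteq> 0}" by (rule bounded_subset[OF bounded_cbox[of "-a" a]]) (use supp in auto)
    then have "k integrable_on UNIV" by (rule compact_support_integrable[OF ck])
    moreover have "integral UNIV k = I"
      unfolding I_def by (rule integral_UNIV_eq_cbox[symmetric]) (use supp in blast)
    ultimately show ?thesis by (simp add: has_integral_integrable_integral)
  qed
  from has_integral_mult_right[OF this, of "1 / I"] I
  have 1: "((\<lambda>x. 1 / I * k x) has_integral 1) UNIV" by simp
  show ?thesis
  proof (rule that[of "\<lambda>x. 1 / I * k x"])
    show "cdiff 3 UNIV (\<lambda>x. 1 / I * k x)" by (intro cdiff_mult cdiff_const k3 open_UNIV)
    show "0 \<le> 1 / I * k x" for x using I kpos by simp
    show "1 / I * k (- x) = 1 / I * k x" for x by (simp add: k_def)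
    show "1 / I * k x = 0" if "e \<le> norm x" for x using k0[OF that] by simp
  qed (rule 1)
qed

section \<open>Mollification preserving the sub-mean value inequality\<close>

definition circle_mean :: "(complex ^ 'n::finite \<Rightarrow> real) \<Rightarrow> complex ^ 'n \<Rightarrow> complex ^ 'n \<Rightarrow> real" where
  "circle_mean f a b = 1 / (2 * pi) * integral {0..2*pi} (\<lambda>\<theta>. f (a + cis \<theta> *s b))"

text \<open>The untruncated inequality of \<open>psh\<close>, for real functions defined on the
  whole space but tested only on discs inside \<open>pdisc r\<close>.\<close>

definition submean_on :: "real \<Rightarrow> (complex ^ 'n::finite \<Rightarrow> real) \<Rightarrow> bool" where
  "submean_on r f \<longleftrightarrow> (\<forall>a b. (\<forall>\<zeta>::complex. norm \<zeta> \<le> 1 \<longrightarrow> a + \<zeta> *s b \<in> pdisc r) \<longrightarrow> f a \<le> circle_mean f a b)"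

lemma pdisc_add:
  assumes "z \<in> pdisc r" "norm y \<le> d"
  shows "z + y \<in> pdisc (r + d)"
  unfolding pdisc_def
proof (safe)
  fix i
  have "norm ((z + y) $ i) \<le> norm (z $ i) + norm (y $ i)" by (simp add: norm_triangle_ineq)
  also have "\<dots> \<le> norm (z $ i) + norm y" by (simp add: Finite_Cartesian_Product.norm_nth_le)
  also have "\<dots> < r + d" using assms by (auto simp: pdisc_def intro: add_less_le_mono)
  finally show "norm ((z + y) $ i) < r + d" .
qed

lemma continuous_on_circle:
  fixes f :: "complex ^ 'n::finite \<Rightarrow> real"
  assumes "continuous_on UNIV f"
  shows "continuous_on S (\<lambda>\<theta>. f (a + cis \<theta> *s b))"
  unfolding cis_smult by (intro continuous_on_compose2[OF assms] continuous_intros) auto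

text \<open>Convolution averages translates of \<open>G\<close>, and averages preserve the sub-mean
  value inequality by Fubini. Translations of length at most \<open>d\<close> cost \<open>d\<close>
  in the radius; closeness to \<open>G\<close> is uniform continuity.\<close>

lemma mollify:
  fixes G :: "complex ^ 'n::finite \<Rightarrow> real"
  assumes G: "continuous_on UNIV G" and e: "0 < e" and d: "0 < d"
  obtains f where "cdiff 3 UNIV f" "\<And>z. z \<in> pdisc 1 \<Longrightarrow> \<bar>f z - G z\<bar> \<le> e"
    "\<And>r. r \<le> 1 \<Longrightarrow> submean_on (r + d) G \<Longrightarrow> submean_on r f"
proof -
  have "uniformly_continuous_on {z::complex ^ 'n. \<forall>i. norm (z $ i) \<le> 2} G"
    by (rule compact_uniformly_continuous[OF continuous_on_subset[OF G] compact_pdisc]) simp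
  then obtain s where s0: "0 < s" "\<forall>x\<in>{z. \<forall>i. norm (z $ i) \<le> 2}. \<forall>y\<in>{z. \<forall>i. norm (z $ i) \<le> 2}. dist y x < s \<longrightarrow> dist (G y) (G x) < e"
    unfolding uniformly_continuous_on_def using e by meson
  have s: "0 < s" "\<And>x y::complex ^ 'n. \<forall>i. norm (x $ i) \<le> 2 \<Longrightarrow> \<forall>i. norm (y $ i) \<le> 2 \<Longrightarrow> dist y x < s \<Longrightarrow> dist (G y) (G x) < e"
    using s0 by simp_all
  \<comment> \<open>The bound 1 keeps translates of \<open>pdisc 1\<close> within radius 2,
    \<open>d\<close> keeps translated discs where \<open>G\<close> is sub-mean, and \<open>s\<close>
    controls the oscillation of \<open>G\<close>.\<close>
  define t where "t = min 1 (min d s)"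
  have t: "0 < t" "t \<le> 1" "t \<le> d" "t \<le> s" using s d by (auto simp: t_def)
  obtain \<eta> :: "complex ^ 'n \<Rightarrow> real" where \<eta>: "cdiff 3 UNIV \<eta>" "\<And>x. 0 \<le> \<eta> x" "\<And>x. \<eta> (- x) = \<eta> x"
    "\<And>x. t \<le> norm x \<Longrightarrow> \<eta> x = 0" "(\<eta> has_integral 1) UNIV"
    by (rule smooth_kernel_exists[OF t(1)]) blast
  have c\<eta>: "continuous_on UNIV \<eta>" by (rule cdiff_continuous[OF \<eta>(1)])
  obtain p where p: "{z::complex ^ 'n. \<forall>i. norm (z $ i) \<le> 2} \<subseteq> cbox (-p) p"
    using bounded_subset_cbox_symmetric[OF bounded_pdisc] by blast
  define f where "f z = integral (cbox (-p) p) (\<lambda>x. G x * \<eta> (z - x))" for z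
  have f: "cdiff 3 UNIV f" unfolding f_def[abs_def] by (rule cdiff_convolution[OF G \<eta>(1)])
  have in2: "z \<in> cbox (-p) p" if "\<And>i. norm (z $ i) \<le> 2" for z using p that by blast
  have near: "norm ((z + y) $ i) \<le> 2" if "z \<in> pdisc 1" "norm y \<le> 1" for z y i
    using pdisc_add[OF that] by (auto simp: pdisc_def less_imp_le)
  \<comment> \<open>Both the fixed box and its translate by \<open>z\<close> contain the support of
    the integrand, so the translation \<open>x = z + y\<close> and evenness of the kernel move
    \<open>z\<close> into \<open>G\<close>.\<close>
  have f2: "f z = integral (cbox (-p) p) (\<lambda>y. G (z + y) * \<eta> y)" if z: "z \<in> pdisc 1" for z
  proof -
    have "f z = integral UNIV (\<lambda>x. G x * \<eta> (z - x))"
      unfolding f_def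
    proof (rule integral_UNIV_eq_cbox, rule ccontr)
      fix x assume "x \<notin> cbox (-p) p" and "G x * \<eta> (z - x) \<noteq> 0"
      then have "norm (x - z) < t" using \<eta>(4)[of "z - x"] by (force simp: norm_minus_commute)
      then have "norm (x - z) \<le> 1" using t by linarith
      from near[OF z this] have "\<And>i. norm (x $ i) \<le> 2" by simp
      then have "x \<in> cbox (-p) p" by (rule in2)
      then show False using \<open>x \<notin> cbox (-p) p\<close> by blast
    qed
    also have "\<dots> = integral (cbox (-p + z) (p + z)) (\<lambda>x. G x * \<eta> (z - x))"
    proof (rule integral_UNIV_eq_cbox[symmetric], rule ccontr)
      fix x assume x: "x \<notin> cbox (-p + z) (p + z)" and "G x * \<eta> (z - x) \<noteq> 0"
      then have "norm (x - z) < t" using \<eta>(4)[of "z - x"] by (force simp: norm_minus_commute)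
      then have "norm (x - z) \<le> 1" using t by linarith
      then have "norm ((x - z) $ i) \<le> 2" for i
        using Finite_Cartesian_Product.norm_nth_le[of "x - z" i] by linarith
      then have "x - z \<in> cbox (-p) p" by (rule in2)
      then have "x \<in> cbox (-p + z) (p + z)" by (auto simp: mem_box algebra_simps)
      then show False using x by blast
    qed
    also have "\<dots> = integral (cbox (-p) p) ((\<lambda>x. G x * \<eta> (z - x)) \<circ> (+) z)"
      by (rule integral_shift_cbox_plus[symmetric])
    also have "\<dots> = integral (cbox (-p) p) (\<lambda>y. G (z + y) * \<eta> y)"
      by (simp add: o_def \<eta>(3))
    finally show ?thesis .
  qed
  have supp: "y \<in> cbox (-p) p" "norm y \<le> 1" "norm y \<le> d" "norm y < s" if "\<eta> y \<noteq> 0" for y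
  proof -
    have y: "norm y < t" using that \<eta>(4)[of y] by force
    then show "norm y \<le> 1" "norm y \<le> d" "norm y < s" using t by auto
    then show "y \<in> cbox (-p) p"
      using Finite_Cartesian_Product.norm_nth_le[of y] by (intro in2) (meson order_trans one_le_numeral)
  qed
  have \<eta>1: "(\<eta> has_integral 1) (cbox (-p) p)"
  proof -
    have "(\<lambda>x. if x \<in> cbox (-p) p then \<eta> x else 0) = \<eta>" using supp(1) by (auto simp: fun_eq_iff)
    then show ?thesis using \<eta>(5) by (metis has_integral_restrict_UNIV)
  qed
  have gi: "(\<lambda>y. G (z + y) * \<eta> y) integrable_on cbox (-p) p" for z
    by (rule integrable_continuous) (intro continuous_intros continuous_on_compose2[OF G] continuous_on_subset[OF c\<eta>]; auto)
  show ?thesis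
  proof (rule that[OF f])
    fix z :: "complex ^ 'n" assume z: "z \<in> pdisc 1"
    have hi: "((\<lambda>y. (G z + e) * \<eta> y) has_integral (G z + e) * 1) (cbox (-p) p)"
      and lo: "((\<lambda>y. (G z - e) * \<eta> y) has_integral (G z - e) * 1) (cbox (-p) p)"
      by (rule has_integral_mult_right[OF \<eta>1])+
    have cl: "\<bar>G (z + y) - G z\<bar> \<le> e" if "\<eta> y \<noteq> 0" for y
    proof -
      have "dist (z + y) z < s" using supp(4)[OF that] by (simp add: dist_norm)
      moreover have "\<forall>i. norm ((z + y) $ i) \<le> 2" using near[OF z supp(2)[OF that]] by blast
      moreover have "\<forall>i. norm (z $ i) \<le> 2" using near[OF z, of 0] by simp
      ultimately have "dist (G (z + y)) (G z) < e" by (intro s(2)) auto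
      then show ?thesis by (simp add: dist_real_def)
    qed
    have "G (z + y) * \<eta> y \<le> (G z + e) * \<eta> y" for y
      using cl[of y] \<eta>(2)[of y] by (cases "\<eta> y = 0") (auto intro!: mult_right_mono)
    then have "f z \<le> G z + e"
      using has_integral_le[OF integrable_integral[OF gi] hi] by (simp add: f2[OF z])
    moreover have "(G z - e) * \<eta> y \<le> G (z + y) * \<eta> y" for y
      using cl[of y] \<eta>(2)[of y] by (cases "\<eta> y = 0") (auto intro!: mult_right_mono)
    then have "G z - e \<le> f z"
      using has_integral_le[OF lo integrable_integral[OF gi]] by (simp add: f2[OF z])
    ultimately show "\<bar>f z - G z\<bar> \<le> e" by linarith
  next
    fix r :: real assume r: "r \<le> 1" and sm: "submean_on (r + d) G"
    show "submean_on r f"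
      unfolding submean_on_def
    proof (intro allI impI)
      fix a b :: "complex ^ 'n" assume disc: "\<forall>\<zeta>::complex. norm \<zeta> \<le> 1 \<longrightarrow> a + \<zeta> *s b \<in> pdisc r"
      have in1: "a + cis \<theta> *s b \<in> pdisc 1" for \<theta> using disc pdisc_mono[OF r] by auto
      have a1: "a \<in> pdisc 1" using disc[rule_format, of 0] pdisc_mono[OF r] by auto
      have cc: "continuous_on (cbox (-p, 0) (p, 2*pi)) (\<lambda>(y, \<theta>). G (a + cis \<theta> *s b + y) * \<eta> y)"
        unfolding split_beta cis_smult
        by (intro continuous_intros continuous_on_compose2[OF G] continuous_on_compose2[OF c\<eta>]) auto
      have "circle_mean f a b = 1 / (2 * pi) * integral (cbox 0 (2*pi)) (\<lambda>\<theta>. integral (cbox (-p) p) (\<lambda>y. G (a + cis \<theta> *s b + y) * \<eta> y))"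
        unfolding circle_mean_def using f2[OF in1] by simp
      also have "\<dots> = 1 / (2 * pi) * integral (cbox (-p) p) (\<lambda>y. integral (cbox 0 (2*pi)) (\<lambda>\<theta>. G (a + cis \<theta> *s b + y) * \<eta> y))"
        using integral_swap_continuous[OF cc] by simp
      also have "\<dots> = integral (cbox (-p) p) (\<lambda>y. circle_mean G (a + y) b * \<eta> y)"
        by (simp add: circle_mean_def add_ac flip: integral_mult_right)
      finally have e: "circle_mean f a b = integral (cbox (-p) p) (\<lambda>y. circle_mean G (a + y) b * \<eta> y)" .
      have "continuous_on UNIV (\<lambda>y. integral (cbox 0 (2*pi)) (\<lambda>\<theta>. G (a + y + cis \<theta> *s b)))"
      proof (rule integral_continuous_on_param)
        show "continuous_on (UNIV \<times> cbox 0 (2*pi)) (\<lambda>(y, \<theta>). G (a + y + cis \<theta> *s b))"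
          unfolding split_beta cis_smult by (intro continuous_intros continuous_on_compose2[OF G]) auto
      qed
      then have "continuous_on UNIV (\<lambda>y. circle_mean G (a + y) b)"
        unfolding circle_mean_def by (intro continuous_intros) simp
      then have mi: "(\<lambda>y. circle_mean G (a + y) b * \<eta> y) integrable_on cbox (-p) p"
        using c\<eta> by (intro integrable_continuous continuous_intros) (auto intro: continuous_on_subset)
      have "integral (cbox (-p) p) (\<lambda>y. G (a + y) * \<eta> y) \<le> integral (cbox (-p) p) (\<lambda>y. circle_mean G (a + y) b * \<eta> y)"
      proof (rule integral_le[OF gi mi])
        fix y
        show "G (a + y) * \<eta> y \<le> circle_mean G (a + y) b * \<eta> y"
        proof (cases "\<eta> y = 0")
          case False
          have "a + y + \<zeta> *s b \<in> pdisc (r + d)" if "norm \<zeta> \<le> 1" for \<zeta>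
            using pdisc_add[OF disc[rule_format, OF that] supp(3)[OF False]] by (simp add: add_ac)
          then have "G (a + y) \<le> circle_mean G (a + y) b"
            using sm unfolding submean_on_def by blast
          then show ?thesis using \<eta>(2) by (intro mult_right_mono)
        qed simp
      qed
      then show "f a \<le> circle_mean f a b" unfolding e f2[OF a1] .
    qed
  qed
qed

lemma norm_smult_vec:
  fixes b :: "complex ^ 'n::finite"
  shows "norm (c *s b) = norm c * norm b"
  by (simp add: norm_vec_def norm_mult L2_set_right_distrib)

lemma circle_mean_add_const:
  assumes "continuous_on UNIV f"
  shows "circle_mean (\<lambda>z. f z + c) a b = circle_mean f a b + c"
proof -
  have "integral {0..2*pi} (\<lambda>\<theta>. f (a + cis \<theta> *s b) + c) = integral {0..2*pi} (\<lambda>\<theta>. f (a + cis \<theta> *s b)) + integral {0..2*pi} (\<lambda>\<theta>. c)"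
    by (rule integral_add) (auto intro!: integrable_continuous_real continuous_on_circle[OF assms])
  then show ?thesis by (simp add: circle_mean_def field_simps)
qed

lemma submean_on_add_const:
  assumes "continuous_on UNIV f" "submean_on r f"
  shows "submean_on r (\<lambda>z. f z + c)"
  using assms(2) by (simp add: submean_on_def circle_mean_add_const[OF assms(1)])

lemma small_disc_in_open:
  fixes a b :: "complex ^ 'n::finite"
  assumes "open S" "a \<in> S"
  obtains e where "0 < e" "\<And>r \<zeta>. 0 \<le> r \<Longrightarrow> r < e \<Longrightarrow> norm \<zeta> \<le> 1 \<Longrightarrow> a + \<zeta> *s (r *\<^sub>R b) \<in> S"
proof -
  obtain d where d: "0 < d" "ball a d \<subseteq> S" using assms open_contains_ball by blast
  show ?thesis
  proof (rule that[of "d / (norm b + 1)"])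
    show "0 < d / (norm b + 1)" using d by (simp add: add_nonneg_pos)
    fix r \<zeta> assume r: "0 \<le> r" "r < d / (norm b + 1)" and z: "norm (\<zeta>::complex) \<le> 1"
    have "r * norm b \<le> r * (norm b + 1)" using r by (intro mult_left_mono) auto
    also have "\<dots> < d" using r by (simp add: pos_less_divide_eq add_nonneg_pos)
    finally have "norm (\<zeta> *s (r *\<^sub>R b)) < d"
      using r z mult_left_le_one_le[of "r * norm b" "norm \<zeta>"] by (simp add: norm_smult_vec)
    then show "a + \<zeta> *s (r *\<^sub>R b) \<in> S" using d(2) by (auto simp: dist_norm)
  qed
qed

lemma levi_nonneg_of_submean_on:
  assumes f: "cdiff 2 UNIV f" and sm: "submean_on r f" and a: "a \<in> pdisc r"
  shows "0 \<le> levi f a b"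
proof -
  obtain e where e: "0 < e" "\<And>s \<zeta>. 0 \<le> s \<Longrightarrow> s < e \<Longrightarrow> norm \<zeta> \<le> 1 \<Longrightarrow> a + \<zeta> *s (s *\<^sub>R b) \<in> pdisc r"
    using small_disc_in_open[OF open_pdisc a, of b] by metis
  show ?thesis
  proof (rule levi_nonneg_of_submean[OF f e(1)])
    fix s assume s: "0 < s" "s < e"
    have "f a \<le> circle_mean f a (s *\<^sub>R b)"
      using sm e(2) s unfolding submean_on_def by (meson less_imp_le)
    moreover have "cis \<theta> *s (s *\<^sub>R b) = s *\<^sub>R (cis \<theta> *s b)" for \<theta> by (simp add: vec_eq_iff)
    ultimately show "f a \<le> 1 / (2 * pi) * integral {0..2*pi} (\<lambda>\<theta>. f (a + s *\<^sub>R (cis \<theta> *s b)))"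
      by (simp add: circle_mean_def)
  qed
qed

text \<open>Truncation from below only increases the mean.\<close>

lemma psh_of_submean_on:
  assumes f: "continuous_on UNIV f" and sm: "submean_on r f"
  shows "psh (pdisc r) (\<lambda>z. ereal (f z))"
proof -
  have "openin (top_of_set (pdisc r)) {z\<in>pdisc r. ereal (f z) < c}" for c
  proof -
    have "open {z. ereal (f z) < c}"
      by (rule open_Collect_less) (auto intro!: continuous_intros f)
    moreover have "{z\<in>pdisc r. ereal (f z) < c} = pdisc r \<inter> {z. ereal (f z) < c}" by auto
    ultimately show ?thesis by (simp add: openin_open_Int)
  qed
  moreover have "ereal (f a) \<le> ereal (1 / (2 * pi) *
      integral {0..2*pi} (\<lambda>\<theta>. real_of_ereal (max (ereal (f (a + cis \<theta> *s b))) (ereal (- N)))))"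
    if "\<forall>\<zeta>::complex. norm \<zeta> \<le> 1 \<longrightarrow> a + \<zeta> *s b \<in> pdisc r" for a b and N :: real
  proof -
    have m: "real_of_ereal (max (ereal x) (ereal y)) = max x y" for x y by (simp add: max_def)
    have "f a \<le> circle_mean f a b" using sm that unfolding submean_on_def by blast
    also have "\<dots> \<le> 1 / (2 * pi) * integral {0..2*pi} (\<lambda>\<theta>. max (f (a + cis \<theta> *s b)) (- N))"
      unfolding circle_mean_def
      by (intro mult_left_mono integral_le integrable_continuous_real continuous_on_circle[OF f]
           continuous_on_max continuous_on_const) auto
    finally show ?thesis by (simp add: m)
  qed
  ultimately show ?thesis
    unfolding psh_def usc_on_def using open_pdisc in_components_nonempty by fastforce
qed

lemma C2_on_of_cdiff:
  assumes "cdiff 2 UNIV f" "open U"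
  shows "C2_on U f"
proof -
  have "cdiff 2 U f" using cdiff_subset[OF assms(1)] by blast
  then show ?thesis using assms(2) by (simp add: C2_on_def numeral_2_eq_2)
qed

lemma compact_subset_pdisc:
  fixes K :: "(complex ^ 'n::finite) set"
  assumes "compact K" "K \<subseteq> pdisc 1"
  shows "\<exists>r<1. K \<subseteq> pdisc r"
proof (cases "K = {}")
  case False
  have "\<exists>m<1. \<forall>z\<in>K. norm (z $ i) < m" for i
  proof -
    have "continuous_on K (\<lambda>z. norm (z $ i))" by (intro continuous_intros)
    then obtain y where y: "y \<in> K" "\<forall>z\<in>K. norm (z $ i) \<le> norm (y $ i)"
      using continuous_attains_sup[OF assms(1) False] by metis
    have "norm (y $ i) < 1" using y(1) assms(2) by (auto simp: pdisc_def)
    then obtain m where "norm (y $ i) < m" "m < 1" using dense by blast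
    then show ?thesis using y(2) by (meson le_less_trans)
  qed
  then obtain m where m: "\<And>i. m i < 1" "\<And>i z. z \<in> K \<Longrightarrow> norm (z $ i) < m i" by metis
  have "Max (range m) < 1" using m(1) by (subst Max_less_iff) auto
  moreover have "K \<subseteq> pdisc (Max (range m))"
  proof
    fix z assume zK: "z \<in> K"
    have "norm (z $ i) < Max (range m)" for i
    proof -
      have "m i \<le> Max (range m)" by simp
      then show ?thesis using m(2)[OF zK, of i] by linarith
    qed
    then show "z \<in> pdisc (Max (range m))" by (simp add: pdisc_def)
  qed
  ultimately show ?thesis by blast
qed (use zero_less_one in blast)

section \<open>Sup-convolution of bounded plurisubharmonic functions\<close>

locale bounded_psh =
  fixes g :: "complex ^ 'n::finite \<Rightarrow> ereal" and M :: real
  assumes psh: "psh polydisc g"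
    and lower: "z \<in> polydisc \<Longrightarrow> ereal (- M) \<le> g z" and upper: "z \<in> polydisc \<Longrightarrow> g z \<le> 0"
begin

definition gr :: "complex ^ 'n \<Rightarrow> real" where "gr z = real_of_ereal (g z)"

lemma gr: "z \<in> polydisc \<Longrightarrow> g z = ereal (gr z)"
  unfolding gr_def using lower[of z] upper[of z] by (cases "g z") auto

lemma gr_bounds: "z \<in> polydisc \<Longrightarrow> - M \<le> gr z" "z \<in> polydisc \<Longrightarrow> gr z \<le> 0"
  using lower[of z] upper[of z] gr[of z] by auto

lemma zero_in: "0 \<in> polydisc" by (simp add: polydisc_def)

lemma M_nonneg: "0 \<le> M" using gr_bounds[OF zero_in] by linarith

text \<open>Sup-convolution: translates of \<open>g\<close> are psh, so the supremum keeps the sub-mean value property, while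
  the quadratic penalty makes it continuous. Unlike circle averages it decreases to \<open>g\<close> for trivial reasons.\<close>

definition supconv :: "real \<Rightarrow> complex ^ 'n \<Rightarrow> real" where
  "supconv k z = (SUP x\<in>polydisc. gr x - k * (norm (x - z))\<^sup>2)"

lemma supconv_ge:
  assumes "0 \<le> k" "x \<in> polydisc"
  shows "gr x - k * (norm (x - z))\<^sup>2 \<le> supconv k z"
  unfolding supconv_def
proof (rule cSUP_upper[OF assms(2)], rule bdd_aboveI2)
  fix x :: "complex ^ 'n" assume "x \<in> polydisc"
  then show "gr x - k * (norm (x - z))\<^sup>2 \<le> 0" using gr_bounds(2)[of x] assms(1)
    by (meson diff_le_0_iff_le mult_nonneg_nonneg order_trans zero_le_power2)
qed

lemma supconv_le:
  assumes "\<And>x. x \<in> polydisc \<Longrightarrow> gr x - k * (norm (x - z))\<^sup>2 \<le> c"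
  shows "supconv k z \<le> c"
  unfolding supconv_def using zero_in assms by (intro cSUP_least) auto

lemma supconv_ge_gr: "0 \<le> k \<Longrightarrow> z \<in> polydisc \<Longrightarrow> gr z \<le> supconv k z"
  using supconv_ge[of k z z] by simp

lemma supconv_nonpos: "0 \<le> k \<Longrightarrow> supconv k z \<le> 0"
  using gr_bounds(2) by (intro supconv_le) (meson diff_le_0_iff_le mult_nonneg_nonneg order_trans zero_le_power2)

lemma supconv_antimono:
  assumes "0 \<le> k" "k \<le> l"
  shows "supconv l z \<le> supconv k z"
proof (rule supconv_le)
  fix x :: "complex ^ 'n" assume x: "x \<in> polydisc"
  have "gr x - l * (norm (x - z))\<^sup>2 \<le> gr x - k * (norm (x - z))\<^sup>2"
    using assms by (simp add: mult_right_mono)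
  also have "\<dots> \<le> supconv k z" by (rule supconv_ge[OF assms(1) x])
  finally show "gr x - l * (norm (x - z))\<^sup>2 \<le> supconv k z" .
qed

text \<open>After adding \<open>k * (z \<bullet> z)\<close> the function is a supremum of functions
  affine in \<open>z\<close>, hence convex and therefore continuous.\<close>

lemma continuous_on_supconv:
  assumes k: "0 \<le> k"
  shows "continuous_on UNIV (supconv k)"
proof -
  have n: "gr x - k * (norm (x - z))\<^sup>2 + k * (z \<bullet> z) = gr x - k * (x \<bullet> x) + 2 * k * (x \<bullet> z)" for x z
    by (simp add: power2_norm_eq_inner inner_diff_left inner_diff_right inner_commute algebra_simps)
  have "convex_on UNIV (\<lambda>z. supconv k z + k * (z \<bullet> z))"
  proof (rule convex_onI)
    fix t :: real and y z :: "complex ^ 'n"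
    assume t: "0 < t" "t < 1"
    let ?w = "(1 - t) *\<^sub>R y + t *\<^sub>R z" and ?c = "(1 - t) * (supconv k y + k * (y \<bullet> y)) + t * (supconv k z + k * (z \<bullet> z))"
    have "supconv k ?w \<le> ?c - k * (?w \<bullet> ?w)"
    proof (rule supconv_le)
      fix x :: "complex ^ 'n" assume x: "x \<in> polydisc"
      have "gr x - k * (norm (x - ?w))\<^sup>2 + k * (?w \<bullet> ?w)
         = (1 - t) * (gr x - k * (x \<bullet> x) + 2 * k * (x \<bullet> y)) + t * (gr x - k * (x \<bullet> x) + 2 * k * (x \<bullet> z))"
        unfolding n by (simp add: inner_add_right algebra_simps)
      also have "\<dots> \<le> ?c"
        unfolding n[symmetric] using t supconv_ge[OF k x] k by (intro add_mono mult_left_mono) auto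
      finally show "gr x - k * (norm (x - ?w))\<^sup>2 \<le> ?c - k * (?w \<bullet> ?w)" by simp
    qed
    then show "supconv k ?w + k * (?w \<bullet> ?w) \<le> ?c" by simp
  qed simp
  then have "continuous_on UNIV (\<lambda>z. supconv k z + k * (z \<bullet> z))"
    by (rule convex_on_continuous[OF open_UNIV])
  then have "continuous_on UNIV (\<lambda>z. (supconv k z + k * (z \<bullet> z)) - k * (z \<bullet> z))"
    by (rule continuous_on_diff) (intro continuous_intros)
  then show ?thesis by simp
qed

text \<open>Near \<open>z\<close> semicontinuity keeps \<open>g\<close> below
  \<open>gr z + e\<close>. At distance at least \<open>d\<close> the penalty
  \<open>k d^2 \<ge> M\<close> wins, as \<open>gr\<close> takes values between \<open>- M\<close>
  and 0.\<close>

lemma supconv_tendsto: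
  assumes z: "z \<in> polydisc" and e: "0 < e"
  obtains K where "0 \<le> K" "\<And>k. K \<le> k \<Longrightarrow> supconv k z \<le> gr z + e"
proof -
  have "open {x\<in>polydisc. g x < ereal (gr z + e)}"
    using psh unfolding psh_def usc_on_def by (meson openin_open_trans)
  moreover have "z \<in> {x\<in>polydisc. g x < ereal (gr z + e)}" using z e gr[OF z] by simp
  ultimately obtain d where d: "0 < d" "ball z d \<subseteq> {x\<in>polydisc. g x < ereal (gr z + e)}"
    using open_contains_ball by blast
  show ?thesis
  proof (rule that[of "M / d\<^sup>2"])
    show K0: "0 \<le> M / d\<^sup>2" using M_nonneg by simp
    fix k assume k: "M / d\<^sup>2 \<le> k"
    have k0: "0 \<le> k" using K0 k by linarith
    have kM: "M \<le> k * d\<^sup>2" using k d(1) by (simp add: pos_divide_le_eq)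
    show "supconv k z \<le> gr z + e"
    proof (rule supconv_le)
      fix x :: "complex ^ 'n" assume x: "x \<in> polydisc"
      show "gr x - k * (norm (x - z))\<^sup>2 \<le> gr z + e"
      proof (cases "norm (x - z) < d")
        case True
        then have "g x < ereal (gr z + e)" using subsetD[OF d(2), of x] by (simp add: dist_norm norm_minus_commute)
        then have "gr x < gr z + e" using gr[OF x] by simp
        moreover have "0 \<le> k * (norm (x - z))\<^sup>2" using k0 by simp
        ultimately show ?thesis by linarith
      next
        case False
        then have "d\<^sup>2 \<le> (norm (x - z))\<^sup>2" using d(1) by (intro power_mono) auto
        then have "k * d\<^sup>2 \<le> k * (norm (x - z))\<^sup>2" using k0 by (rule mult_left_mono)
        then show ?thesis using kM gr_bounds(2)[OF x] gr_bounds(1)[OF z] e by linarith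
      qed
    qed
  qed
qed

text \<open>Each competitor \<open>x\<close> in the supremum is treated separately. If it is within
  \<open>d\<close> of \<open>a\<close>, the disc shifted by \<open>x - a\<close> stays in the
  polydisc, \<open>g\<close> is sub-mean on it, and the penalty is constant along the shift.\<close>

lemma submean_on_supconv:
  assumes r: "r + d \<le> 1" "0 < d" and k: "M \<le> k * d\<^sup>2" "0 \<le> k"
  shows "submean_on r (supconv k)"
  unfolding submean_on_def
proof (intro allI impI)
  fix a b :: "complex ^ 'n" assume disc: "\<forall>\<zeta>::complex. norm \<zeta> \<le> 1 \<longrightarrow> a + \<zeta> *s b \<in> pdisc r"
  note cc = continuous_on_circle[OF continuous_on_supconv[OF k(2)]]
  show "supconv k a \<le> circle_mean (supconv k) a b"
  proof (rule supconv_le)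
    fix x :: "complex ^ 'n" assume x: "x \<in> polydisc"
    show "gr x - k * (norm (x - a))\<^sup>2 \<le> circle_mean (supconv k) a b"
    proof (cases "norm (x - a) \<le> d")
      case True
      have in1: "x + \<zeta> *s b \<in> polydisc" if "norm \<zeta> \<le> 1" for \<zeta>
        using pdisc_add[OF disc[rule_format, OF that] True] pdisc_mono[OF r(1)]
        by (auto simp: polydisc_eq_pdisc algebra_simps)
      have "g x \<le> ereal (1 / (2 * pi) * integral {0..2*pi} (\<lambda>\<theta>. supconv k (a + cis \<theta> *s b) + k * (norm (x - a))\<^sup>2))"
      proof (rule psh_le_mean[OF psh in1])
        show "continuous_on {0..2*pi} (\<lambda>\<theta>. supconv k (a + cis \<theta> *s b) + k * (norm (x - a))\<^sup>2)"
          by (intro continuous_intros cc)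
        show "g (x + cis \<theta> *s b) \<le> ereal (supconv k (a + cis \<theta> *s b) + k * (norm (x - a))\<^sup>2)" for \<theta>
          using supconv_ge[OF k(2) in1, of "cis \<theta>" "a + cis \<theta> *s b"] gr[OF in1, of "cis \<theta>"] by simp
      qed auto
      then have "gr x \<le> circle_mean (\<lambda>z. supconv k z + k * (norm (x - a))\<^sup>2) a b"
        using gr[OF x] by (simp add: circle_mean_def)
      then show ?thesis
        by (simp add: circle_mean_add_const[OF continuous_on_supconv[OF k(2)]])
    next
      \<comment> \<open>A distant competitor contributes at most \<open>- M\<close>, which lies
        below \<open>supconv k\<close> on the whole circle.\<close>
      case False
      then have "d\<^sup>2 \<le> (norm (x - a))\<^sup>2" using r(2) by (intro power_mono) auto
      then have "k * d\<^sup>2 \<le> k * (norm (x - a))\<^sup>2" using k(2) by (rule mult_left_mono)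
      then have "gr x - k * (norm (x - a))\<^sup>2 \<le> - M" using k(1) gr_bounds(2)[OF x] by linarith
      also have "- M = 1 / (2 * pi) * integral {0..2*pi} (\<lambda>\<theta>. - M)" by simp
      also have "\<dots> \<le> circle_mean (supconv k) a b"
        unfolding circle_mean_def
      proof (intro mult_left_mono integral_le integrable_continuous_real cc continuous_on_const)
        fix \<theta>
        have "a + cis \<theta> *s b \<in> polydisc"
          using disc[rule_format, of "cis \<theta>"] pdisc_mono[of r 1] r by (auto simp: polydisc_eq_pdisc)
        then show "- M \<le> supconv k (a + cis \<theta> *s b)"
          using supconv_ge_gr[OF k(2)] gr_bounds(1) order_trans by blast
      qed simp
      finally show ?thesis .
    qed
  qed
qed

definition rad :: "nat \<Rightarrow> real" where "rad j = 1 - 1 / (real j + 2)"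

lemma rad_eventually:
  assumes "R < 1"
  obtains J where "\<And>j. J \<le> j \<Longrightarrow> R \<le> rad j"
proof -
  obtain n :: nat where n: "inverse (real (Suc n)) < 1 - R" using reals_Archimedean[of "1 - R"] assms by auto
  have "R \<le> rad j" if "n \<le> j" for j
  proof -
    have "1 / (real j + 2) \<le> inverse (real (Suc n))" using that by (simp add: inverse_eq_divide frac_le)
    then show ?thesis using n by (simp add: rad_def)
  qed
  then show ?thesis using that by blast
qed

text \<open>The conclusions beyond \<open>smooth_approx\<close> serve the later gluing: C^3 on the
  whole space, bounds and monotonicity on the whole polydisc, and the sign of the Levi form.\<close>

lemma smooth_approx_exists:
  obtains f where "smooth_approx polydisc g (\<lambda>j. pdisc (rad j)) f" "\<And>j. cdiff 3 UNIV (f j)"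
    "\<And>j z. z \<in> polydisc \<Longrightarrow> gr z \<le> f j z \<and> f j z \<le> 2" "\<And>j z. z \<in> polydisc \<Longrightarrow> f (Suc j) z \<le> f j z"
    "\<And>j z b. z \<in> pdisc (rad j) \<Longrightarrow> 0 \<le> levi (f j) z b"
proof -
  \<comment> \<open>Half the distance from \<open>rad j\<close> to 1: one half is spent on
    sup-convolution, the other on mollification.\<close>
  define dd where "dd j = 1 / (2 * (real j + 2))" for j
  \<comment> \<open>Chosen so that \<open>k j * (dd j)^2 = M + 1\<close>, enough for
    \<open>submean_on_supconv\<close>.\<close>
  define k where "k j = (M + 1) * (4 * (real j + 2)\<^sup>2)" for j
  have dd: "0 < dd j" "rad j + dd j + dd j = 1" for j
  proof -
    have "dd j + dd j = 1 / (real j + 2)" by (simp add: dd_def field_simps)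
    then show "0 < dd j" "rad j + dd j + dd j = 1" by (auto simp: rad_def dd_def[of j] algebra_simps)
  qed
  have k0: "0 \<le> k j" for j using M_nonneg by (simp add: k_def)
  have kd: "M \<le> k j * (dd j)\<^sup>2" for j
  proof -
    have "4 * (real j + 2)\<^sup>2 * (dd j)\<^sup>2 = (2 * (real j + 2) * dd j)\<^sup>2" by (simp add: power2_eq_square algebra_simps)
    also have "2 * (real j + 2) * dd j = 1" by (simp add: dd_def)
    finally show ?thesis unfolding k_def by (simp add: mult.assoc)
  qed
  have kmono: "k j \<le> k (Suc j)" for j
    using M_nonneg unfolding k_def by (intro mult_left_mono power_mono) auto
  have kj: "real j \<le> k j" for j
  proof -
    have "real j \<le> 1 * (4 * (real j + 2)\<^sup>2)" by (simp add: power2_eq_square algebra_simps)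
    also have "\<dots> \<le> k j" unfolding k_def using M_nonneg by (intro mult_right_mono) auto
    finally show ?thesis .
  qed
  \<comment> \<open>The shift \<open>(1/2)^j\<close> absorbs the mollification error of a quarter of
    it: \<open>f j\<close> exceeds the sup-convolution by between 3/4 and 5/4 of the shift. Since
    5/4 of the next shift is 5/8 of this one, the sequence decreases.\<close>
  define G where "G j z = supconv (k j) z + (1/2) ^ j" for j z
  have cG: "continuous_on UNIV (G j)" for j
    unfolding G_def by (intro continuous_intros continuous_on_supconv k0)
  have smG: "submean_on (rad j + dd j) (G j)" for j
    unfolding G_def
    by (rule submean_on_add_const[OF continuous_on_supconv[OF k0] submean_on_supconv[OF _ dd(1)[of j] kd k0]])
       (simp add: dd(2))
  have "\<exists>f. cdiff 3 UNIV f \<and> (\<forall>z\<in>pdisc 1. \<bar>f z - G j z\<bar> \<le> (1/4) * (1/2) ^ j) \<and> submean_on (rad j) f" for j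
    by (rule mollify[OF cG[of j], of "(1/4) * (1/2) ^ j" "dd j"])
       (use dd[of j] smG[of j] in \<open>auto simp: rad_def\<close>)
  then obtain f where f: "\<And>j. cdiff 3 UNIV (f j)" "\<And>j z. z \<in> pdisc 1 \<Longrightarrow> \<bar>f j z - G j z\<bar> \<le> (1/4) * (1/2) ^ j"
    "\<And>j. submean_on (rad j) (f j)"
    by metis
  have f2: "cdiff 2 UNIV (f j)" for j using cdiff_le[OF f(1)] by simp
  have radle: "rad j \<le> 1" "rad j \<le> rad (Suc j)" for j by (auto simp: rad_def field_simps)
  have sub: "pdisc (rad j) \<subseteq> (polydisc :: (complex ^ 'n) set)" for j
    unfolding polydisc_eq_pdisc by (rule pdisc_mono[OF radle(1)])
  have up: "f j z \<le> supconv (k j) z + 5/4 * (1/2) ^ j" and lo: "supconv (k j) z + 3/4 * (1/2) ^ j \<le> f j z"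
    if "z \<in> polydisc" for j z
    using f(2)[OF that[unfolded polydisc_eq_pdisc], of j, unfolded G_def] by linarith+
  have ge: "gr z \<le> f j z" if "z \<in> polydisc" for j z
  proof -
    have "0 \<le> 3/4 * (1/2::real) ^ j" by simp
    then show ?thesis using lo[OF that, of j] supconv_ge_gr[OF k0 that, of j] by linarith
  qed
  have dec: "f (Suc j) z \<le> f j z" if "z \<in> polydisc" for j z
  proof -
    have "0 \<le> (1/2::real) ^ j" "(1/2::real) ^ Suc j = 1/2 * (1/2) ^ j" by simp_all
    then show ?thesis
      using up[OF that, of "Suc j"] lo[OF that, of j] supconv_antimono[OF k0 kmono, of j z] by linarith
  qed
  have conv: "(\<lambda>j. f j z) \<longlonglongrightarrow> gr z" if z: "z \<in> polydisc" for z
  proof (rule LIMSEQ_I)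
    fix e :: real assume e: "0 < e"
    obtain K where K: "0 \<le> K" "\<And>k. K \<le> k \<Longrightarrow> supconv k z \<le> gr z + e / 2"
      using supconv_tendsto[OF z, of "e/2"] e by (metis half_gt_zero)
    obtain N1 :: nat where N1: "K \<le> real N1" using real_arch_simple by blast
    obtain N2 where N2: "(1/2::real) ^ N2 < e / 4" using real_arch_pow_inv[of "e/4" "1/2"] e by auto
    show "\<exists>N. \<forall>j\<ge>N. norm (f j z - gr z) < e"
    proof (intro exI allI impI)
      fix j assume j: "max N1 N2 \<le> j"
      have "K \<le> k j" using N1 kj[of j] j by linarith
      then have 1: "supconv (k j) z \<le> gr z + e / 2" by (rule K(2))
      have "(1/2::real) ^ j \<le> (1/2) ^ N2" using j by (intro power_decreasing) auto
      then have "(1/2::real) ^ j < e / 4" using N2 by linarith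
      then have "f j z < gr z + e" using up[OF z, of j] 1 e by linarith
      then show "norm (f j z - gr z) < e" using ge[OF z, of j] by simp
    qed
  qed
  have un: "(\<Union>j. pdisc (rad j)) = (polydisc :: (complex ^ 'n) set)"
  proof (rule equalityI)
    show "(\<Union>j. pdisc (rad j)) \<subseteq> (polydisc :: (complex ^ 'n) set)" using sub by blast
    show "(polydisc :: (complex ^ 'n) set) \<subseteq> (\<Union>j. pdisc (rad j))"
    proof
      fix z :: "complex ^ 'n" assume z: "z \<in> polydisc"
      then obtain R where R: "R < 1" "{z} \<subseteq> pdisc R"
        using compact_subset_pdisc[of "{z}"] by (auto simp: polydisc_eq_pdisc)
      obtain J where "R \<le> rad J" using rad_eventually[OF R(1)] by blast
      then have "z \<in> pdisc (rad J)" using R(2) pdisc_mono by blast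
      then show "z \<in> (\<Union>j. pdisc (rad j))" by blast
    qed
  qed
  show ?thesis
  proof (rule that[of f])
    show "smooth_approx polydisc g (\<lambda>j. pdisc (rad j)) f"
      unfolding smooth_approx_def
    proof (intro conjI allI ballI un)
      show "pdisc (rad j) \<subseteq> pdisc (rad (Suc j))" for j by (rule pdisc_mono[OF radle(2)])
      show "C2_on (pdisc (rad j)) (f j)" for j by (rule C2_on_of_cdiff[OF f2 open_pdisc])
      show "psh (pdisc (rad j)) (\<lambda>z. ereal (f j z))" for j
        by (rule psh_of_submean_on[OF cdiff_continuous[OF f2] f(3)])
      show "f (Suc j) z \<le> f j z" if "z \<in> pdisc (rad j)" for j z
        using dec sub that by blast
      show "(\<lambda>j. ereal (f j z)) \<longlonglongrightarrow> g z" if "z \<in> polydisc" for z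
        using conv[OF that] by (simp add: gr[OF that])
    qed
    show "gr z \<le> f j z \<and> f j z \<le> 2" if "z \<in> polydisc" for j z
    proof -
      have "(1/2::real) ^ j \<le> 1" by (simp add: power_le_one)
      then show ?thesis using ge[OF that, of j] up[OF that, of j] supconv_nonpos[OF k0, of j z] by linarith
    qed
    show "0 \<le> levi (f j) z b" if "z \<in> pdisc (rad j)" for j z b
      by (rule levi_nonneg_of_submean_on[OF f2 f(3) that])
  qed (use f(1) dec in auto)
qed

end

section \<open>Maximum principles\<close>

text \<open>Without a maximum the sets \<open>{h < h y}\<close> would cover \<open>K\<close>; in a
  finite subcover the centre with the largest value is left uncovered.\<close>

lemma usc_attains_max:
  fixes h :: "'a::topological_space \<Rightarrow> ereal"
  assumes K: "compact K" "K \<noteq> {}" and usc: "\<And>c. openin (top_of_set K) {x\<in>K. h x < c}"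
  shows "\<exists>a\<in>K. \<forall>x\<in>K. h x \<le> h a"
proof (rule ccontr)
  assume "\<not> ?thesis"
  then have "K \<subseteq> \<Union> ((\<lambda>y. {x\<in>K. h x < h y}) ` K)" by (force simp: not_le)
  moreover have "\<forall>c\<in>(\<lambda>y. {x\<in>K. h x < h y}) ` K. openin (top_of_set K) c" using usc by blast
  ultimately obtain D where D: "D \<subseteq> (\<lambda>y. {x\<in>K. h x < h y}) ` K" "finite D" "K \<subseteq> \<Union>D"
    using K(1) unfolding compact_eq_openin_cover by meson
  obtain Y where Y0: "Y \<subseteq> K" "finite Y" "D = (\<lambda>y. {x\<in>K. h x < h y}) ` Y"
    using finite_subset_image[OF D(2,1)] by blast
  have Y: "finite Y" "Y \<subseteq> K" "K \<subseteq> (\<Union>y\<in>Y. {x\<in>K. h x < h y})" using Y0 D(3) by auto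
  have "Y \<noteq> {}" using Y K(2) by auto
  then have "Max (h ` Y) \<in> h ` Y" using Y(1) by (intro Max_in) auto
  then obtain y where "y \<in> Y" "h y = Max (h ` Y)" by (metis imageE)
  then have y: "y \<in> Y" "\<And>z. z \<in> Y \<Longrightarrow> h z \<le> h y" using Y(1) by auto
  then obtain z where "z \<in> Y" "h y < h z" using Y by blast
  then show False using y(2) by (meson not_le)
qed

lemma Dini_usc:
  fixes h :: "nat \<Rightarrow> 'a::topological_space \<Rightarrow> ereal"
  assumes K: "compact K" and usc: "\<And>j. openin (top_of_set K) {x\<in>K. h j x < c}"
    and dec: "\<And>j x. x \<in> K \<Longrightarrow> h (Suc j) x \<le> h j x" and lim: "\<And>x. x \<in> K \<Longrightarrow> \<exists>j. h j x < c"
  shows "\<exists>J. \<forall>j\<ge>J. \<forall>x\<in>K. h j x < c"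
proof -
  have mono: "h j x \<le> h i x" if "x \<in> K" "i \<le> j" for i j x
    using that(2) by (rule lift_Suc_antimono_le[of "\<lambda>j. h j x", rotated]) (rule dec[OF that(1)])
  have "K \<subseteq> \<Union> ((\<lambda>j. {x\<in>K. h j x < c}) ` UNIV)" using lim by blast
  moreover have "\<forall>s\<in>range (\<lambda>j. {x\<in>K. h j x < c}). openin (top_of_set K) s" using usc by blast
  ultimately obtain D where D: "D \<subseteq> range (\<lambda>j. {x\<in>K. h j x < c})" "finite D" "K \<subseteq> \<Union>D"
    using K unfolding compact_eq_openin_cover by meson
  obtain Y where Y0: "finite Y" "D = (\<lambda>j. {x\<in>K. h j x < c}) ` Y"
    using finite_subset_image[OF D(2,1)] by blast
  have Y: "finite Y" "K \<subseteq> (\<Union>j\<in>Y. {x\<in>K. h j x < c})" using Y0 D(3) by auto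
  show ?thesis
  proof (intro exI allI impI ballI)
    fix j x assume j: "Max (insert 0 Y) \<le> j" and x: "x \<in> K"
    obtain i where i: "i \<in> Y" "h i x < c" using Y x by blast
    then have "i \<le> j" using j Y(1) by simp
    then show "h j x < c" using mono[OF x] i(2) by (meson le_less_trans)
  qed
qed

lemma psh_compose_openin:
  fixes u :: "complex ^ 'n::finite \<Rightarrow> ereal" and \<phi> :: "'b::topological_space \<Rightarrow> complex ^ 'n"
  assumes u: "psh \<Omega> u" and \<phi>: "continuous_on A \<phi>" "\<phi> ` A \<subseteq> \<Omega>"
  shows "openin (top_of_set A) {x\<in>A. u (\<phi> x) < c}"
proof -
  have "open {z\<in>\<Omega>. u z < c}" using u unfolding psh_def usc_on_def by (meson openin_open_trans)
  from continuous_openin_preimage_gen[OF \<phi>(1) this]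
  have "openin (top_of_set A) (A \<inter> \<phi> -` {z\<in>\<Omega>. u z < c})" .
  moreover have "A \<inter> \<phi> -` {z\<in>\<Omega>. u z < c} = {x\<in>A. u (\<phi> x) < c}" using \<phi>(2) by auto
  ultimately show ?thesis by simp
qed

text \<open>The map \<open>\<phi>\<close> lets the same statement serve compact subsets of the
  domain and annuli in a complex line.\<close>

lemma psh_plus_continuous_attains_max:
  fixes u :: "complex ^ 'n::finite \<Rightarrow> ereal" and \<phi> :: "'b::topological_space \<Rightarrow> complex ^ 'n" and q :: "'b \<Rightarrow> real"
  assumes u: "psh \<Omega> u" and A: "compact A" "A \<noteq> {}"
    and \<phi>: "continuous_on A \<phi>" "\<phi> ` A \<subseteq> \<Omega>" and q: "continuous_on A q"
  shows "\<exists>a\<in>A. \<forall>x\<in>A. u (\<phi> x) + ereal (q x) \<le> u (\<phi> a) + ereal (q a)"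
proof (rule usc_attains_max[OF A])
  fix c
  \<comment> \<open>A real number \<open>p\<close> inserted between the two summands splits the
    sublevel set into relatively open pieces.\<close>
  have "{x\<in>A. u (\<phi> x) + ereal (q x) < c} = (\<Union>p. {x\<in>A. u (\<phi> x) < ereal p} \<inter> {x\<in>A. ereal (p + q x) < c})" (is "?L = ?R")
  proof (rule equalityI; rule subsetI)
    fix x assume x: "x \<in> ?L"
    have fin: "u (\<phi> x) < \<infinity>" using u \<phi>(2) x unfolding psh_def usc_on_def by blast
    have "u (\<phi> x) < c - ereal (q x)"
      using x fin by (cases "u (\<phi> x)"; cases c) auto
    then obtain p where "u (\<phi> x) < ereal p" "ereal p < c - ereal (q x)" using ereal_dense2 by blast
    moreover from this have "ereal (p + q x) < c" by (cases c) auto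
    ultimately show "x \<in> ?R" using x by auto
  next
    fix x assume "x \<in> ?R"
    then obtain p where p: "x \<in> A" "u (\<phi> x) < ereal p" "ereal (p + q x) < c" by auto
    have "u (\<phi> x) + ereal (q x) \<le> ereal (p + q x)" using p(2) by (cases "u (\<phi> x)") auto
    then show "x \<in> ?L" using p by auto
  qed
  moreover have "openin (top_of_set A) {x\<in>A. ereal (p + q x) < c}" for p
  proof -
    have "continuous_on A (\<lambda>x. ereal (p + q x))" by (intro continuous_intros q)
    from continuous_openin_preimage_gen[OF this open_lessThan, of c]
    show ?thesis by (simp add: vimage_def Int_def)
  qed
  moreover have "openin (top_of_set A) (\<Union>p. {x\<in>A. u (\<phi> x) < ereal p} \<inter> {x\<in>A. ereal (p + q x) < c})"
    by (rule openin_Union) (use calculation(2) psh_compose_openin[OF u \<phi>] in blast)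
  ultimately show "openin (top_of_set A) {x\<in>A. u (\<phi> x) + ereal (q x) < c}"
    by (simp only:)
qed

section \<open>Maximum principles with a strictly subharmonic perturbation\<close>

lemma has_integral_norm_circle:
  fixes a b :: "complex ^ 'n::finite"
  shows "((\<lambda>\<theta>. (norm (a + cis \<theta> *s b))\<^sup>2) has_integral 2 * pi * ((norm a)\<^sup>2 + (norm b)\<^sup>2)) {0..2*pi}"
proof -
  have "(norm (a + cis \<theta> *s b))\<^sup>2 = ((norm a)\<^sup>2 + (norm b)\<^sup>2) + cos \<theta> * (2 * (a \<bullet> b)) + sin \<theta> * (2 * (a \<bullet> (\<i> *s b)))" for \<theta>
  proof -
    have "(norm (a + cis \<theta> *s b))\<^sup>2 = (norm a)\<^sup>2 + (norm (cis \<theta> *s b))\<^sup>2 + 2 * (a \<bullet> (cis \<theta> *s b))"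
      by (simp add: power2_norm_eq_inner inner_add_left inner_add_right inner_commute)
    also have "norm (cis \<theta> *s b) = norm b" by (simp add: norm_smult_vec)
    finally show ?thesis by (simp add: cis_smult inner_add_right algebra_simps)
  qed
  moreover have "((\<lambda>\<theta>. ((norm a)\<^sup>2 + (norm b)\<^sup>2) + cos \<theta> * (2 * (a \<bullet> b)) + sin \<theta> * (2 * (a \<bullet> (\<i> *s b)))) has_integral
     2 * pi * ((norm a)\<^sup>2 + (norm b)\<^sup>2) + 0 * (2 * (a \<bullet> b)) + 0 * (2 * (a \<bullet> (\<i> *s b)))) {0..2*pi}"
    using has_integral_const_real[of "(norm a)\<^sup>2 + (norm b)\<^sup>2" 0 "2*pi"]
    by (intro has_integral_add has_integral_mult_left trig_integrals) simp
  ultimately show ?thesis by simp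
qed

text \<open>The boundary condition controls only the modulus, so the sign comes from the maximum
  principle. Adding \<open>\<delta> * (norm z)^2\<close> makes the sub-mean value inequality strict,
  which excludes an interior maximum.\<close>

lemma cegrell_E0_nonpos:
  fixes g :: "complex ^ 'n::finite \<Rightarrow> ereal"
  assumes g: "g \<in> cegrell_E0 polydisc" and z0: "z0 \<in> polydisc"
  shows "g z0 \<le> 0"
proof (rule ccontr)
  assume "\<not> g z0 \<le> 0"
  then have pos: "0 < g z0" by simp
  have psh: "psh polydisc g" using g by (simp add: cegrell_E0_def)
  obtain M where "\<And>z. z \<in> polydisc \<Longrightarrow> \<bar>g z\<bar> \<le> ereal M" using g by (auto simp: cegrell_E0_def)
  then have fin: "\<bar>g z\<bar> \<noteq> \<infinity>" if "z \<in> polydisc" for z using that by fastforce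
  define h where "h z = real_of_ereal (g z)" for z
  have h: "g z = ereal (h z)" if "z \<in> polydisc" for z using fin[OF that] by (simp add: h_def ereal_real)
  define G0 where "G0 = h z0"
  have G0: "0 < G0" using pos h[OF z0] by (simp add: G0_def)
  define n where "n = real CARD('n)"
  have nn: "norm z \<le> n" if "z \<in> (polydisc :: (complex ^ 'n) set)" for z
    using norm_pdisc_le[of z 1] that by (auto simp: polydisc_def n_def less_imp_le)
  \<comment> \<open>The perturbation stays below \<open>G0 / 4\<close> on the polydisc, so off
    \<open>K\<close> the perturbed function is below \<open>G0 / 2 + G0 / 4\<close>, less than its
    value at \<open>z0\<close>.\<close>
  define \<delta> where "\<delta> = G0 / (4 * (n\<^sup>2 + 1))"
  have \<delta>: "0 < \<delta>" "\<delta> * n\<^sup>2 \<le> G0 / 4"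
  proof -
    have p: "0 < 4 * (n\<^sup>2 + 1)" by (simp add: add_nonneg_pos)
    show "0 < \<delta>" unfolding \<delta>_def using G0 p by simp
    have "\<delta> * n\<^sup>2 \<le> \<delta> * (n\<^sup>2 + 1)" using \<open>0 < \<delta>\<close> by simp
    also have "\<dots> = G0 / 4" unfolding \<delta>_def using p by (simp add: field_simps)
    finally show "\<delta> * n\<^sup>2 \<le> G0 / 4" .
  qed
  obtain K where K: "compact K" "K \<subseteq> polydisc" "\<And>z. z \<in> polydisc - K \<Longrightarrow> \<bar>g z\<bar> < ereal (G0 / 2)"
    using g G0 unfolding cegrell_E0_def by (auto dest!: spec[of _ "G0 / 2"])
  \<comment> \<open>Adjoining \<open>z0\<close> makes the compact set nonempty and its maximum at
    least \<open>G0\<close>.\<close>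
  have "\<exists>a\<in>insert z0 K. \<forall>x\<in>insert z0 K. g (id x) + ereal (\<delta> * (norm x)\<^sup>2) \<le> g (id a) + ereal (\<delta> * (norm a)\<^sup>2)"
    by (rule psh_plus_continuous_attains_max[OF psh]) (use K z0 in \<open>auto intro!: continuous_intros\<close>)
  then obtain a where a: "a \<in> insert z0 K" "\<And>x. x \<in> insert z0 K \<Longrightarrow> g x + ereal (\<delta> * (norm x)\<^sup>2) \<le> g a + ereal (\<delta> * (norm a)\<^sup>2)"
    by auto
  have aD: "a \<in> polydisc" using a(1) K z0 by auto
  define H where "H = h a + \<delta> * (norm a)\<^sup>2"
  have HK: "h x + \<delta> * (norm x)\<^sup>2 \<le> H" if "x \<in> insert z0 K" for x
  proof -
    have "x \<in> polydisc" using that K z0 by auto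
    then show ?thesis using a(2)[OF that] by (simp add: h aD H_def)
  qed
  have GH: "G0 \<le> H" using HK[of z0] \<delta> by (simp add: G0_def) (smt (verit) mult_nonneg_nonneg zero_le_power2)
  have all: "h x + \<delta> * (norm x)\<^sup>2 \<le> H" if x: "x \<in> polydisc" for x
  proof (cases "x \<in> insert z0 K")
    case False
    then have "h x < G0 / 2" using K(3)[of x] x by (simp add: h)
    moreover have "\<delta> * (norm x)\<^sup>2 \<le> \<delta> * n\<^sup>2"
      using nn[OF x] \<delta>(1) by (intro mult_left_mono power_mono) auto
    ultimately show ?thesis using \<delta>(2) GH G0 by linarith
  qed (rule HK)
  define e1 where "e1 = (axis undefined 1 :: complex ^ 'n)"
  obtain e where e: "0 < e" "\<And>r \<zeta>. 0 \<le> r \<Longrightarrow> r < e \<Longrightarrow> norm \<zeta> \<le> 1 \<Longrightarrow> a + \<zeta> *s (r *\<^sub>R e1) \<in> polydisc"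
    using small_disc_in_open[OF open_pdisc aD[unfolded polydisc_eq_pdisc], of e1] unfolding polydisc_eq_pdisc by metis
  define b where "b = (e / 2) *\<^sub>R e1"
  have disc: "a + \<zeta> *s b \<in> polydisc" if "norm \<zeta> \<le> 1" for \<zeta>
    unfolding b_def using e that by auto
  have b0: "0 < norm b"
    using e(1) by (simp add: b_def e1_def axis_eq_0_iff)
  let ?q = "\<lambda>\<theta>. H - \<delta> * (norm (a + cis \<theta> *s b))\<^sup>2"
  have "g a \<le> ereal (1 / (2 * pi) * integral {0..2*pi} ?q)"
  proof (rule psh_le_mean[OF psh disc])
    show "continuous_on {0..2*pi} ?q" unfolding cis_smult by (intro continuous_intros)
    show "g (a + cis \<theta> *s b) \<le> ereal (?q \<theta>)" for \<theta>
      using all[OF disc[of "cis \<theta>"]] h[OF disc[of "cis \<theta>"]] by simp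
  qed auto
  also have "integral {0..2*pi} ?q = 2 * pi * H - \<delta> * (2 * pi * ((norm a)\<^sup>2 + (norm b)\<^sup>2))"
    using has_integral_const_real[of H 0 "2*pi"]
    by (intro integral_unique has_integral_diff has_integral_mult_right has_integral_norm_circle) simp
  also have "1 / (2 * pi) * (2 * pi * H - \<delta> * (2 * pi * ((norm a)\<^sup>2 + (norm b)\<^sup>2))) = H - \<delta> * ((norm a)\<^sup>2 + (norm b)\<^sup>2)"
    by (simp add: field_simps)
  finally have "h a \<le> H - \<delta> * ((norm a)\<^sup>2 + (norm b)\<^sup>2)"
    unfolding h[OF aD] by simp
  then have "\<delta> * (norm b)\<^sup>2 \<le> 0" by (simp add: H_def algebra_simps)
  then show False using \<delta>(1) b0 by (simp add: mult_le_0_iff)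
qed

text \<open>\<open>Ln (1 + z / w)\<close> is holomorphic on the closed disc of radius
  \<open>t\<close> and vanishes at 0; the real part of Cauchy's formula is the mean value property
  of the logarithm.\<close>

lemma has_integral_ln_circle:
  fixes w :: complex
  assumes t: "0 < t" "t < norm w"
  shows "((\<lambda>\<theta>. ln (norm (w + t * cis \<theta>))) has_integral 2 * pi * ln (norm w)) {0..2*pi}"
proof -
  have w0: "w \<noteq> 0" using t by auto
  have re: "0 < Re (1 + z / w)" if "norm z \<le> t" for z
  proof -
    have "norm (z / w) < 1" using that t by (simp add: norm_divide divide_less_eq)
    then have "\<bar>Re (z / w)\<bar> < 1" using abs_Re_le_cmod le_less_trans by blast
    then show ?thesis by simp
  qed
  have hol: "(\<lambda>z. Ln (1 + z / w)) holomorphic_on cball 0 t"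
  proof (intro holomorphic_intros w0)
    fix z :: complex assume "z \<in> cball 0 t"
    then have "0 < Re (1 + z / w)" by (intro re) simp
    then show "1 + z / w \<notin> \<real>\<^sub>\<le>\<^sub>0" unfolding complex_nonpos_Reals_iff by linarith
  qed
  have "((\<lambda>u. Ln (1 + u / w) / (u - 0)) has_contour_integral (2 * of_real pi * \<i> * Ln (1 + 0 / w))) (circlepath 0 t)"
    by (rule Cauchy_integral_circlepath_simple[OF hol]) (use t in simp)
  then have "((\<lambda>u. Ln (1 + u / w) / u) has_contour_integral 0) (part_circlepath 0 t 0 (2*pi))"
    by (simp add: circlepath_def)
  then have "((\<lambda>\<theta>. Ln (1 + (0 + t * cis \<theta>) / w) / (0 + t * cis \<theta>) * t * \<i> * cis \<theta>) has_integral 0) {0..2*pi}"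
    by (subst (asm) has_contour_integral_part_circlepath_iff) auto
  moreover have "Ln (1 + (0 + t * cis \<theta>) / w) / (0 + t * cis \<theta>) * t * \<i> * cis \<theta> = \<i> * Ln (1 + t * cis \<theta> / w)" for \<theta>
    using t by (simp add: field_simps)
  ultimately have "((\<lambda>\<theta>. \<i> * Ln (1 + t * cis \<theta> / w)) has_integral 0) {0..2*pi}" by (simp only:)
  from has_integral_Im[OF this]
  have 1: "((\<lambda>\<theta>. Re (Ln (1 + t * cis \<theta> / w))) has_integral 0) {0..2*pi}" by simp
  have "ln (norm (w + t * cis \<theta>)) = ln (norm w) + Re (Ln (1 + t * cis \<theta> / w))" for \<theta>
  proof -
    have nz: "1 + t * cis \<theta> / w \<noteq> 0"
      using re[of "t * cis \<theta>"] t by (force simp: norm_mult)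
    have "w + t * cis \<theta> = w * (1 + t * cis \<theta> / w)" using w0 by (simp add: field_simps)
    then have "norm (w + t * cis \<theta>) = norm w * norm (1 + t * cis \<theta> / w)" by (simp only: norm_mult)
    then show ?thesis using nz w0 by (simp add: ln_mult Re_Ln)
  qed
  then show ?thesis
    using has_integral_add[OF has_integral_const_real[of "ln (norm w)" 0 "2*pi"] 1] by simp
qed

text \<open>On an annulus, \<open>u - c' ln \<bar>\<zeta>\<bar> + \<delta>
  \<bar>\<zeta>\<bar>^2\<close> is compared with its boundary values. On a small inner circle the
  surplus \<open>c - c'\<close> beats the constant \<open>C\<close>; on an outer circle near the
  unit circle \<open>u \<le> 0\<close> is enough. The conclusion is free of \<open>e\<close> and
  \<open>C\<close>.\<close>

lemma psh_log_growth:
  fixes u :: "complex ^ 'n::finite \<Rightarrow> ereal"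
  assumes u: "psh \<Omega> u" and disc: "\<And>\<zeta>::complex. norm \<zeta> < 1 \<Longrightarrow> p + \<zeta> *s b \<in> \<Omega>"
    and nonpos: "\<And>\<zeta>::complex. norm \<zeta> < 1 \<Longrightarrow> u (p + \<zeta> *s b) \<le> 0"
    and c: "0 < c'" "c' < c" and e: "0 < e"
    and growth: "\<And>\<zeta>::complex. 0 < norm \<zeta> \<Longrightarrow> norm \<zeta> < e \<Longrightarrow> u (p + \<zeta> *s b) \<le> ereal (c * ln (norm \<zeta>) + C)"
    and z1: "0 < norm \<zeta>1" "norm \<zeta>1 < 1"
  shows "u (p + \<zeta>1 *s b) \<le> ereal (c' * ln (norm \<zeta>1))"
proof (rule ccontr)
  assume neg: "\<not> ?thesis"
  then obtain x1 where x1: "u (p + \<zeta>1 *s b) = ereal x1"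
    using nonpos[OF z1(2)] by (cases "u (p + \<zeta>1 *s b)") auto
  define \<gamma> where "\<gamma> = x1 - c' * ln (norm \<zeta>1)"
  have \<gamma>: "0 < \<gamma>" using neg x1 by (simp add: \<gamma>_def)
  define \<delta> where "\<delta> = \<gamma> / 4"
  have \<delta>: "0 < \<delta>" using \<gamma> by (simp add: \<delta>_def)
  \<comment> \<open>The second entry makes \<open>- c' ln \<rho>\<close> at most a quarter of the
    supposed excess \<open>\<gamma>\<close>; with \<open>\<delta> = \<gamma> / 4\<close> the outer
    circle stays below \<open>\<gamma>\<close>.\<close>
  define \<rho> where "\<rho> = max ((norm \<zeta>1 + 1) / 2) (exp (- \<gamma> / (4 * c')))"
  have \<rho>: "norm \<zeta>1 < \<rho>" "\<rho> < 1" "0 < \<rho>" using z1 \<gamma> c by (auto simp: \<rho>_def less_max_iff_disj field_simps)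
  have lnr: "- c' * ln \<rho> \<le> \<gamma> / 4"
  proof -
    have "exp (- \<gamma> / (4 * c')) \<le> \<rho>" by (simp add: \<rho>_def)
    then have "- \<gamma> / (4 * c') \<le> ln \<rho>" using \<rho>(3) by (simp add: ln_ge_iff)
    then show ?thesis using c(1) by (simp add: field_simps)
  qed
  \<comment> \<open>The exponential makes \<open>(c - c') ln r + C\<close> nonpositive, which rules
    out the inner circle.\<close>
  define r where "r = min (min (norm \<zeta>1) e / 2) (exp (- \<bar>C\<bar> / (c - c')))"
  have r: "0 < r" "r < norm \<zeta>1" "r < e" using z1 e by (auto simp: r_def min_less_iff_disj)
  have lnC: "(c - c') * ln r + C \<le> 0"
  proof -
    have "ln r \<le> ln (exp (- \<bar>C\<bar> / (c - c')))"
      using r(1) by (subst ln_le_cancel_iff) (auto simp: r_def)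
    then have "ln r \<le> - \<bar>C\<bar> / (c - c')" by (simp only: ln_exp)
    then have "(c - c') * ln r \<le> - \<bar>C\<bar>" using c(2) by (simp add: field_simps)
    then show ?thesis by linarith
  qed
  define A where "A = {\<zeta>::complex. r \<le> norm \<zeta> \<and> norm \<zeta> \<le> \<rho>}"
  have A: "compact A"
  proof -
    have "A = cball 0 \<rho> - ball 0 r" by (auto simp: A_def)
    then show ?thesis by (simp add: compact_diff)
  qed
  have z1A: "\<zeta>1 \<in> A" using r \<rho> by (simp add: A_def)
  define q where "q \<zeta> = - c' * ln (norm \<zeta>) + \<delta> * (norm \<zeta>)\<^sup>2" for \<zeta> :: complex
  have "\<exists>a\<in>A. \<forall>x\<in>A. u (p + x *s b) + ereal (q x) \<le> u (p + a *s b) + ereal (q a)"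
  proof (rule psh_plus_continuous_attains_max[OF u A])
    show "A \<noteq> {}" using z1A by blast
    have "continuous_on A (\<lambda>x. \<chi> i. p $ i + x * b $ i)" by (intro continuous_intros)
    moreover have "(\<lambda>x. \<chi> i. p $ i + x * b $ i) = (\<lambda>x. p + x *s b)" by (auto simp: vec_eq_iff fun_eq_iff)
    ultimately show "continuous_on A (\<lambda>x. p + x *s b)" by (simp only:)
    show "(\<lambda>x. p + x *s b) ` A \<subseteq> \<Omega>" using disc \<rho> by (auto simp: A_def)
    show "continuous_on A q" unfolding q_def using r by (intro continuous_intros) (auto simp: A_def)
  qed
  then obtain w where w: "w \<in> A" "\<And>x. x \<in> A \<Longrightarrow> u (p + x *s b) + ereal (q x) \<le> u (p + w *s b) + ereal (q w)" by blast
  have w1: "norm w < 1" using w(1) \<rho> by (simp add: A_def)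
  have qz1: "\<gamma> \<le> x1 + q \<zeta>1" using \<delta> by (simp add: q_def \<gamma>_def)
  have ge: "ereal \<gamma> \<le> u (p + w *s b) + ereal (q w)"
    using w(2)[OF z1A] qz1 x1 by (metis ereal_less_eq(3) order_trans plus_ereal.simps(1))
  then obtain x where x: "u (p + w *s b) = ereal x" using nonpos[OF w1] by (cases "u (p + w *s b)") auto
  define H where "H = x + q w"
  have H: "\<gamma> \<le> H" using ge x by (simp add: H_def)
  have dq: "\<delta> * (norm w)\<^sup>2 \<le> \<delta>" using w1 \<delta> by (simp add: mult_left_le power_le_one)
  have "norm w \<noteq> \<rho>"
  proof
    assume "norm w = \<rho>"
    then have "q w \<le> \<gamma> / 4 + \<delta>" using lnr dq by (simp add: q_def)
    moreover have "x \<le> 0" using nonpos[OF w1] x by simp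
    ultimately show False using H \<gamma> by (simp add: H_def \<delta>_def)
  qed
  moreover have "norm w \<noteq> r"
  proof
    assume wr: "norm w = r"
    have "x \<le> c * ln r + C" using growth[of w] wr r x by simp
    then have "x + q w \<le> ((c - c') * ln r + C) + \<delta>" using dq wr by (simp add: q_def algebra_simps)
    then show False using H \<gamma> lnC by (simp add: H_def \<delta>_def)
  qed
  ultimately have wi: "r < norm w" "norm w < \<rho>" using w(1) by (auto simp: A_def)
  \<comment> \<open>The circle of radius \<open>t\<close> about \<open>w\<close> stays in the
    annulus and its disc avoids 0, so the logarithm is harmonic there.\<close>
  define t where "t = min (norm w - r) (\<rho> - norm w) / 2"
  have t: "0 < t" "t \<le> norm w - r" "t \<le> \<rho> - norm w" "t < norm w" using wi r by (auto simp: t_def)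
  have inA: "w + t * \<zeta> \<in> A" if "norm \<zeta> = 1" for \<zeta> :: complex
  proof -
    have n: "norm (t * \<zeta>) = t" using that t(1) by (simp add: norm_mult)
    show ?thesis using norm_triangle_ineq[of w "t * \<zeta>"] norm_diff_ineq[of w "t * \<zeta>"] n t by (simp add: A_def)
  qed
  have shift: "p + w *s b + \<zeta> *s (t *\<^sub>R b) = p + (w + t * \<zeta>) *s b" for \<zeta> :: complex
    by (simp add: vec_eq_iff algebra_simps vector_scaleR_component scaleR_conv_of_real[where 'a = complex])
  let ?q = "\<lambda>\<theta>. (H + c' * ln (norm (w + t * cis \<theta>))) - \<delta> * (norm (w + t * cis \<theta>))\<^sup>2"
  have "u (p + w *s b) \<le> ereal (1 / (2 * pi) * integral {0..2*pi} ?q)"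
  proof (rule psh_le_mean[OF u])
    show "p + w *s b + \<zeta> *s (t *\<^sub>R b) \<in> \<Omega>" if "norm \<zeta> \<le> 1" for \<zeta>
    proof -
      have "norm (w + t * \<zeta>) \<le> norm w + norm (t * \<zeta>)" by (rule norm_triangle_ineq)
      also have "norm (t * \<zeta>) \<le> t" using that t(1) by (simp add: norm_mult mult_left_le)
      finally have "norm (w + t * \<zeta>) < 1" using t \<rho> by linarith
      then show ?thesis unfolding shift by (rule disc)
    qed
    have nz: "w + t * cis \<theta> \<noteq> 0" for \<theta> using inA[of "cis \<theta>"] r by (auto simp: A_def)
    show "continuous_on {0..2*pi} ?q" using nz by (intro continuous_intros) auto
    show "u (p + w *s b + cis \<theta> *s (t *\<^sub>R b)) \<le> ereal (?q \<theta>)" for \<theta>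
    proof -
      have "u (p + (w + t * cis \<theta>) *s b) + ereal (q (w + t * cis \<theta>)) \<le> ereal H"
        using w(2)[OF inA[of "cis \<theta>"]] x by (simp add: H_def)
      then show ?thesis unfolding shift
        by (cases "u (p + (w + t * cis \<theta>) *s b)") (auto simp: q_def)
    qed
  qed
  also have "integral {0..2*pi} ?q = (2 * pi * H + c' * (2 * pi * ln (norm w))) - \<delta> * (2 * pi * ((norm w)\<^sup>2 + t\<^sup>2))"
  proof (rule integral_unique, intro has_integral_diff has_integral_add has_integral_mult_right)
    show "((\<lambda>x. H) has_integral 2 * pi * H) {0..2*pi}" using has_integral_const_real[of H 0 "2*pi"] by simp
    show "((\<lambda>\<theta>. ln (norm (w + t * cis \<theta>))) has_integral 2 * pi * ln (norm w)) {0..2*pi}"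
      by (rule has_integral_ln_circle[OF t(1,4)])
    have "(norm (w + t * cis \<theta>))\<^sup>2 = ((norm w)\<^sup>2 + t\<^sup>2) + cos \<theta> * (2 * t * Re w) + sin \<theta> * (2 * t * Im w)" for \<theta>
    proof -
      have "(norm (w + t * cis \<theta>))\<^sup>2 = (Re w + t * cos \<theta>)\<^sup>2 + (Im w + t * sin \<theta>)\<^sup>2" by (simp add: cmod_power2)
      also have "\<dots> = ((Re w)\<^sup>2 + (Im w)\<^sup>2) + t\<^sup>2 * ((cos \<theta>)\<^sup>2 + (sin \<theta>)\<^sup>2) + cos \<theta> * (2 * t * Re w) + sin \<theta> * (2 * t * Im w)"
        by algebra
      finally show ?thesis by (simp add: cmod_power2)
    qed
    moreover have "((\<lambda>\<theta>. ((norm w)\<^sup>2 + t\<^sup>2) + cos \<theta> * (2 * t * Re w) + sin \<theta> * (2 * t * Im w)) has_integral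
       2 * pi * ((norm w)\<^sup>2 + t\<^sup>2) + 0 * (2 * t * Re w) + 0 * (2 * t * Im w)) {0..2*pi}"
      using has_integral_const_real[of "(norm w)\<^sup>2 + t\<^sup>2" 0 "2*pi"]
      by (intro has_integral_add has_integral_mult_left trig_integrals) simp
    ultimately show "((\<lambda>\<theta>. (norm (w + t * cis \<theta>))\<^sup>2) has_integral 2 * pi * ((norm w)\<^sup>2 + t\<^sup>2)) {0..2*pi}" by simp
  qed
  also have "1 / (2 * pi) * ((2 * pi * H + c' * (2 * pi * ln (norm w))) - \<delta> * (2 * pi * ((norm w)\<^sup>2 + t\<^sup>2)))
      = H + c' * ln (norm w) - \<delta> * ((norm w)\<^sup>2 + t\<^sup>2)"
    by (simp add: field_simps)
  finally have "x \<le> H + c' * ln (norm w) - \<delta> * ((norm w)\<^sup>2 + t\<^sup>2)"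
    unfolding x by simp
  then have "\<delta> * t\<^sup>2 \<le> 0" by (simp add: H_def q_def algebra_simps)
  then show False using \<delta> t(1) by (simp add: mult_le_0_iff)
qed

section \<open>Mass estimates\<close>

definition cutoff :: "real \<Rightarrow> real \<Rightarrow> complex ^ 'n::finite \<Rightarrow> real" where
  "cutoff r' r z = (\<Prod>i\<in>UNIV. max 0 (min 1 ((r - norm (z $ i)) / (r - r'))))"

lemma continuous_on_cutoff: "continuous_on S (cutoff r' r)"
  unfolding cutoff_def[abs_def] divide_inverse by (intro continuous_intros)

lemma cutoff_bounds: "0 \<le> cutoff r' r z" "cutoff r' r z \<le> 1"
  unfolding cutoff_def by (auto intro!: prod_nonneg prod_le_1)

lemma cutoff_eq_1:
  assumes "r' < r" "\<forall>i. norm (z $ i) \<le> r'"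
  shows "cutoff r' r z = 1"
  unfolding cutoff_def
proof (rule prod.neutral, safe)
  fix i
  have "1 \<le> (r - norm (z $ i)) / (r - r')" using assms by simp
  then show "max 0 (min 1 ((r - norm (z $ i)) / (r - r'))) = 1" by simp
qed

lemma cutoff_eq_0:
  assumes "r' < r" "z \<notin> pdisc r"
  shows "cutoff r' r z = 0"
proof -
  obtain i where "r \<le> norm (z $ i)" using assms(2) by (auto simp: pdisc_def not_less)
  then have "max 0 (min 1 ((r - norm (z $ i)) / (r - r'))) = 0" using assms(1) by (simp add: divide_le_0_iff)
  then show ?thesis unfolding cutoff_def by (meson finite UNIV_I prod_zero)
qed

lemma bounded_cutoff_support:
  assumes "r' < r"
  shows "bounded {z::complex ^ 'n::finite. cutoff r' r z \<noteq> 0}"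
  by (rule bounded_subset[OF bounded_pdisc[of r]])
     (use cutoff_eq_0[OF assms] in \<open>auto simp: pdisc_def intro: less_imp_le\<close>)

lemma test_fun_cutoff:
  assumes "r' < r" "r < 1"
  shows "test_fun polydisc (cutoff r' r :: complex ^ 'n::finite \<Rightarrow> real)"
proof -
  have "{z::complex ^ 'n. cutoff r' r z \<noteq> 0} \<subseteq> {z. \<forall>i. norm (z $ i) \<le> r}"
    using cutoff_eq_0[OF assms(1)] by (auto simp: pdisc_def intro: less_imp_le)
  then have "closure {z::complex ^ 'n. cutoff r' r z \<noteq> 0} \<subseteq> {z. \<forall>i. norm (z $ i) \<le> r}"
    using closed_pdisc by (rule closure_minimal)
  also have "\<dots> \<subseteq> polydisc" using assms(2) by (auto simp: polydisc_def intro: le_less_trans)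
  finally show ?thesis
    unfolding test_fun_def
    using continuous_on_cutoff cutoff_bounds bounded_cutoff_support[OF assms(1)] by auto
qed

lemma cutoff_MA_integrable:
  assumes "cdiff 3 UNIV f" "r' < r"
  shows "(\<lambda>z. cutoff r' r z * MA_density f z) integrable_on UNIV"
  using cdiff_le[OF assms(1), of 2] assms(2)
  by (intro weighted_MA_integrable continuous_on_cutoff bounded_cutoff_support) auto

text \<open>A Chern--Levine--Nirenberg estimate: gluing replaces \<open>f\<close> by a fixed function near the boundary without changing
  it on the support of the cutoff.\<close>

lemma MA_integrals_bounded:
  fixes M :: real
  assumes r: "0 < r" "r' < r" "r < 1"
  shows "\<exists>R C. r < R \<and> R < 1 \<and> (\<forall>f::complex ^ 'n::finite \<Rightarrow> real. cdiff 3 UNIV f \<longrightarrow>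
      (\<forall>z\<in>pdisc R. \<forall>b. 0 \<le> levi f z b) \<longrightarrow> (\<forall>z\<in>pdisc R. - M \<le> f z \<and> f z \<le> 2) \<longrightarrow>
      integral UNIV (\<lambda>z. cutoff r' r z * MA_density f z) \<le> C)"
proof -
  define t where "t = (1 + r) / 2"
  define R where "R = (1 + t) / 2"
  have t: "r < t" "t < R" "R < 1" "0 < t" using r by (auto simp: t_def R_def)
  define n where "n = real CARD('n)"
  have n: "0 < n" by (simp add: n_def)
  \<comment> \<open>This steepness makes each exponential at most \<open>1 / (4 n)\<close> on
    \<open>pdisc r\<close>, while outside \<open>pdisc t\<close> at least one of them is at least
    1.\<close>
  define k where "k = ln (4 * n) / (t\<^sup>2 - r\<^sup>2)"
  have n1: "1 \<le> n" by (simp add: n_def Suc_leI)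
  have rt: "r\<^sup>2 < t\<^sup>2" using t r by (intro power_strict_mono) auto
  have k: "0 \<le> k" "exp (k * (r\<^sup>2 - t\<^sup>2)) = 1 / (4 * n)"
  proof -
    show "0 \<le> k" using n1 rt by (simp add: k_def)
    have "k * (r\<^sup>2 - t\<^sup>2) = - ln (4 * n)" using rt by (simp add: k_def field_simps)
    then show "exp (k * (r\<^sup>2 - t\<^sup>2)) = 1 / (4 * n)" using n by (simp add: exp_minus inverse_eq_divide)
  qed
  \<comment> \<open>Then \<open>w \<le> - A/4 \<le> - M - 3\<close> on \<open>pdisc r\<close> and
    \<open>w \<ge> A/2 \<ge> 5\<close> off \<open>pdisc t\<close>: gaps of 3 to the bounds
    \<open>- M\<close> and 2 of \<open>f\<close>.\<close>
  define A where "A = 4 * \<bar>M\<bar> + 20"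
  have A: "20 \<le> A" "M + 3 \<le> A / 4" by (auto simp: A_def)
  define h where "h x = A * exp (k * (x - t\<^sup>2)) - A / (2 * n)" for x :: real
  define h1 where "h1 x = A * k * exp (k * (x - t\<^sup>2))" for x :: real
  define h2 where "h2 x = A * k * k * exp (k * (x - t\<^sup>2))" for x :: real
  have d1: "(h has_real_derivative h1 x) (at x)" and d2: "(h1 has_real_derivative h2 x) (at x)" for x
    unfolding h_def[abs_def] h1_def[abs_def] h2_def by (auto intro!: derivative_eq_intros)
  define w where "w = (\<lambda>z::complex ^ 'n. \<Sum>i\<in>UNIV. h ((z $ i - 0 $ i) \<bullet> (z $ i - 0 $ i)))"
  have ce: "cdiff 3 UNIV (\<lambda>x. exp (k * (x - t\<^sup>2)))"
    by (intro cdiff_compose_real[OF open_UNIV open_UNIV _ _ cdiff_exp] UNIV_I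
        cdiff_mult cdiff_diff cdiff_const cdiff_linear bounded_linear_ident open_UNIV)
  have ch: "cdiff 3 UNIV h"
    unfolding h_def[abs_def] by (intro cdiff_diff cdiff_mult cdiff_const ce open_UNIV)
  have w: "cdiff 3 UNIV w" unfolding w_def by (rule separable_cdiff[OF open_UNIV _ ch]) simp
  have lw: "0 \<le> levi w z b" for z b
    unfolding w_def
  proof (rule separable_levi_nonneg[OF d1 d2])
    fix x :: real assume x: "0 \<le> x"
    show "0 \<le> h1 x + x * h2 x" using x A k(1) by (auto simp: h1_def h2_def intro!: add_nonneg_nonneg)
  qed
  have wsum: "w z = A * (\<Sum>i\<in>UNIV. exp (k * ((norm (z $ i))\<^sup>2 - t\<^sup>2))) - A / 2" for z
  proof -
    have "w z = (\<Sum>i\<in>UNIV. A * exp (k * ((norm (z $ i))\<^sup>2 - t\<^sup>2)) - A / (2 * n))"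
      by (simp add: w_def h_def dot_square_norm)
    also have "\<dots> = A * (\<Sum>i\<in>UNIV. exp (k * ((norm (z $ i))\<^sup>2 - t\<^sup>2))) - n * (A / (2 * n))"
      by (simp add: sum_subtractf sum_distrib_left n_def)
    finally show ?thesis using n by simp
  qed
  have w_in: "w z \<le> - M - 3" if z: "z \<in> pdisc r" for z
  proof -
    have "exp (k * ((norm (z $ i))\<^sup>2 - t\<^sup>2)) \<le> 1 / (4 * n)" for i
    proof -
      have "(norm (z $ i))\<^sup>2 \<le> r\<^sup>2" using z by (intro power_mono) (auto simp: pdisc_def less_imp_le)
      then have "exp (k * ((norm (z $ i))\<^sup>2 - t\<^sup>2)) \<le> exp (k * (r\<^sup>2 - t\<^sup>2))" using k(1) by (simp add: mult_left_mono)
      then show ?thesis unfolding k(2) .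
    qed
    then have "(\<Sum>i\<in>UNIV. exp (k * ((norm (z $ i))\<^sup>2 - t\<^sup>2))) \<le> (\<Sum>i\<in>(UNIV::'n set). 1 / (4 * n))" by (intro sum_mono)
    also have "\<dots> = 1 / 4" using n by (simp add: n_def)
    finally have "A * (\<Sum>i\<in>UNIV. exp (k * ((norm (z $ i))\<^sup>2 - t\<^sup>2))) \<le> A * (1 / 4)" using A by (intro mult_left_mono) auto
    then show ?thesis using A unfolding wsum by linarith
  qed
  have w_out: "5 \<le> w z" if z: "z \<notin> pdisc t" for z
  proof -
    obtain i where i: "t \<le> norm (z $ i)" using z by (auto simp: pdisc_def not_less)
    have "1 \<le> exp (k * ((norm (z $ i))\<^sup>2 - t\<^sup>2))" using i t k(1) by (simp add: power_mono)
    also have "\<dots> \<le> (\<Sum>i\<in>UNIV. exp (k * ((norm (z $ i))\<^sup>2 - t\<^sup>2)))"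
      by (rule member_le_sum) auto
    finally have "A * 1 \<le> A * (\<Sum>i\<in>UNIV. exp (k * ((norm (z $ i))\<^sup>2 - t\<^sup>2)))" using A by (intro mult_left_mono) auto
    then show ?thesis using A unfolding wsum by linarith
  qed
  define C where "C = integral UNIV (\<lambda>z. cutoff t R z * MA_density w z)"
  show ?thesis
  proof (intro exI conjI allI impI)
    fix f :: "complex ^ 'n \<Rightarrow> real"
    assume f: "cdiff 3 UNIV f" and lf: "\<forall>z\<in>pdisc R. \<forall>b. 0 \<le> levi f z b"
      and bf: "\<forall>z\<in>pdisc R. - M \<le> f z \<and> f z \<le> 2"
    obtain F where F: "cdiff 3 UNIV F" "\<And>z b. z \<in> pdisc R \<Longrightarrow> 0 \<le> levi F z b"
      "\<And>z. z \<notin> pdisc t \<Longrightarrow> F z = w z"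
      "\<And>z. z \<in> pdisc R \<Longrightarrow> w z + 3 \<le> f z \<Longrightarrow> F z = f z"
      \<comment> \<open>The roles are exchanged: the fixed \<open>w\<close> prevails outside, and
        \<open>f\<close> is glued in.\<close>
      by (rule psh_glue[OF w f t(2), of thesis]) (use lw lf bf w_out in fastforce)+
    have rR: "pdisc r \<subseteq> (pdisc R :: (complex ^ 'n) set)" using t by (intro pdisc_mono) auto
    have Ff: "MA_density F z = MA_density f z" if z: "z \<in> pdisc r" for z
    proof (rule MA_density_cong_open[OF open_pdisc z])
      show "F y = f y" if "y \<in> pdisc r" for y
        using F(4)[of y] w_in[OF that] bf rR that by fastforce
      show "cdiff 2 (pdisc r) F" using cdiff_le[OF cdiff_subset[OF F(1)]] by simp
    qed
    have "integral UNIV (\<lambda>z. cutoff r' r z * MA_density f z) \<le> integral UNIV (\<lambda>z. cutoff t R z * MA_density F z)"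
    proof (rule integral_le)
      fix z :: "complex ^ 'n"
      have nn: "0 \<le> MA_density F z" if "z \<in> pdisc R"
        using MA_density_nonneg[OF cdiff_le[OF F(1)] F(2)[OF that]] by simp
      show "cutoff r' r z * MA_density f z \<le> cutoff t R z * MA_density F z"
      proof (cases "z \<in> pdisc r")
        case True
        have "\<forall>i. norm (z $ i) \<le> t" using True t(1) by (auto simp: pdisc_def intro: less_imp_le less_trans)
        then have "cutoff t R z = 1" by (rule cutoff_eq_1[OF t(2)])
        then show ?thesis using Ff[OF True] nn True rR cutoff_bounds[of r' r z]
          by (auto intro: mult_left_le_one_le)
      next
        case False
        have "0 \<le> cutoff t R z * MA_density F z"
          using nn cutoff_bounds(1)[of t R z] cutoff_eq_0[OF t(2), of z] by (cases "z \<in> pdisc R") auto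
        then show ?thesis using cutoff_eq_0[OF r(2) False] by simp
      qed
    qed (intro cutoff_MA_integrable f F r t)+
    also have "\<dots> = C"
      unfolding C_def
      by (rule weighted_MA_eq[OF w F(1) F(3) continuous_on_cutoff bounded_cutoff_support[OF t(2)] cutoff_eq_1[OF t(2)]])
    finally show "integral UNIV (\<lambda>z. cutoff r' r z * MA_density f z) \<le> C" .
  qed (use t in auto)
qed

text \<open>Bounded integrals along an approximation converge only along a subsequence, which must
  count as an approximation itself.\<close>

lemma smooth_approx_subseq:
  assumes a: "smooth_approx \<Omega> \<phi> U f" and s: "strict_mono (s :: nat \<Rightarrow> nat)"
  shows "smooth_approx \<Omega> \<phi> (U \<circ> s) (f \<circ> s)"
proof -
  have U: "U j \<subseteq> U (Suc j)" "C2_on (U j) (f j)" "psh (U j) (\<lambda>z. ereal (f j z))"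
    and un: "(\<Union>j. U j) = \<Omega>" and dec: "\<And>j z. z \<in> U j \<Longrightarrow> f (Suc j) z \<le> f j z"
    and lim: "\<And>z. z \<in> \<Omega> \<Longrightarrow> (\<lambda>j. ereal (f j z)) \<longlonglongrightarrow> \<phi> z" for j
    using a unfolding smooth_approx_def by blast+
  have mono: "U i \<subseteq> U j" if "i \<le> j" for i j using that U(1) by (rule lift_Suc_mono_le[rotated])
  have dec': "f (i + d) z \<le> f i z" if "z \<in> U i" for i d z
  proof (induction d)
    case (Suc d)
    have "z \<in> U (i + d)" using that mono[of i "i + d"] by auto
    then show ?case using dec[of z "i + d"] Suc by simp
  qed simp
  have le: "s j \<le> s (Suc j)" for j using s by (simp add: strict_mono_less_eq)
  have "f (s (Suc j)) z \<le> f (s j) z" if "z \<in> U (s j)" for j z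
    using dec'[OF that, of "s (Suc j) - s j"] le[of j] by simp
  moreover have "(\<Union>j. U (s j)) = \<Omega>"
  proof -
    have "U j \<subseteq> U (s j)" for j by (rule mono) (rule seq_suble[OF s])
    then show ?thesis using un by blast
  qed
  moreover have "(\<lambda>j. ereal (f (s j) z)) \<longlonglongrightarrow> \<phi> z" if "z \<in> \<Omega>" for z
    using LIMSEQ_subseq_LIMSEQ[OF lim[OF that] s] by (simp add: o_def)
  ultimately show ?thesis
    unfolding smooth_approx_def using U mono[OF le] by (simp add: o_def)
qed

text \<open>Gluing \<open>w\<close> into the smooth approximants of \<open>g\<close> does not change their total mass, and the glued function is \<open>w\<close>
  on the box.\<close>

lemma (in bounded_psh) MA_mass_ge:
  fixes w :: "complex ^ 'n \<Rightarrow> real"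
  assumes w: "cdiff 3 UNIV w" "\<And>z b. 0 \<le> levi w z b" "\<And>z. z \<in> polydisc \<Longrightarrow> w z \<le> - 4"
    and r0: "r0 < 1" "\<And>z. z \<in> polydisc \<Longrightarrow> z \<notin> pdisc r0 \<Longrightarrow> - 1 \<le> gr z"
    and box: "cbox x y \<subseteq> pdisc r0" "\<And>z. z \<in> cbox x y \<Longrightarrow> gr z + 4 < w z"
      "0 \<le> q" "\<And>z. z \<in> cbox x y \<Longrightarrow> q \<le> MA_density w z"
  shows "ereal (q * measure lborel (cbox x y)) \<le> MA_mass polydisc g"
proof -
  \<comment> \<open>The entry 1/2 guards against a nonpositive \<open>r0\<close>, so that
    \<open>r\<close> is positive as \<open>MA_integrals_bounded\<close> requires.\<close>
  define r' where "r' = max r0 (1/2)"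
  define r where "r = (1 + r') / 2"
  have r: "0 < r" "r' < r" "r < 1" "r0 \<le> r'" using r0(1) by (auto simp: r'_def r_def max_def)
  obtain f where f: "smooth_approx polydisc g (\<lambda>j. pdisc (rad j)) f" "\<And>j. cdiff 3 UNIV (f j)"
    "\<And>j z. z \<in> polydisc \<Longrightarrow> gr z \<le> f j z \<and> f j z \<le> 2" "\<And>j z. z \<in> polydisc \<Longrightarrow> f (Suc j) z \<le> f j z"
    "\<And>j z b. z \<in> pdisc (rad j) \<Longrightarrow> 0 \<le> levi (f j) z b"
    using smooth_approx_exists by blast
  obtain R C where RC: "r < R" "R < 1" "\<And>f::complex ^ 'n \<Rightarrow> real. cdiff 3 UNIV f \<Longrightarrow>
      (\<And>z b. z \<in> pdisc R \<Longrightarrow> 0 \<le> levi f z b) \<Longrightarrow> (\<And>z. z \<in> pdisc R \<Longrightarrow> - M \<le> f z \<and> f z \<le> 2) \<Longrightarrow>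
      integral UNIV (\<lambda>z. cutoff r' r z * MA_density f z) \<le> C"
    using MA_integrals_bounded[OF r(1-3), of M] by blast
  have sub: "pdisc s \<subseteq> (polydisc :: (complex ^ 'n) set)" if "s \<le> 1" for s
    unfolding polydisc_eq_pdisc by (rule pdisc_mono[OF that])
  obtain J1 where J1: "\<And>j. J1 \<le> j \<Longrightarrow> R \<le> rad j" using rad_eventually[OF RC(2)] by blast
  have boxD: "cbox x y \<subseteq> polydisc" using box(1) sub[of r0] r0(1) by auto
  \<comment> \<open>The gap 4 between \<open>gr\<close> and \<open>w\<close> exceeds the width 3 of
    the smoothed maximum; Dini's theorem passes the gap 3 to \<open>f j\<close> uniformly on the
    box.\<close>
  have "\<exists>J. \<forall>j\<ge>J. \<forall>z\<in>cbox x y. ereal (f j z - w z) < ereal (- 3)"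
  proof (rule Dini_usc[OF compact_cbox])
    fix j
    have c: "continuous_on (cbox x y) (\<lambda>z. ereal (f j z - w z))"
      using cdiff_continuous[OF f(2)] cdiff_continuous[OF w(1)]
      by (intro continuous_intros) (auto intro: continuous_on_subset)
    from continuous_openin_preimage_gen[OF c open_lessThan, of "ereal (- 3)"]
    show "openin (top_of_set (cbox x y)) {z\<in>cbox x y. ereal (f j z - w z) < ereal (- 3)}"
      by (simp add: vimage_def Int_def)
  next
    fix z assume z: "z \<in> cbox x y"
    then have zD: "z \<in> polydisc" using boxD by blast
    then show "ereal (f (Suc j) z - w z) \<le> ereal (f j z - w z)" for j using f(4) by simp
    have "(\<lambda>j. ereal (f j z)) \<longlonglongrightarrow> g z" using f(1) zD unfolding smooth_approx_def by blast
    then have "(\<lambda>j. f j z) \<longlonglongrightarrow> gr z" by (simp add: gr[OF zD])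
    then have "\<forall>\<^sub>F j in sequentially. f j z < w z - 4"
      by (rule order_tendstoD) (use box(2)[OF z] in simp)
    then obtain j where "f j z < w z - 4" by (meson eventually_happens trivial_limit_sequentially)
    then show "\<exists>j. ereal (f j z - w z) < ereal (- 3)" by (intro exI[of _ j]) simp
  qed
  then obtain J2 where J2: "\<And>j z. J2 \<le> j \<Longrightarrow> z \<in> cbox x y \<Longrightarrow> f j z + 3 < w z" by (auto simp: algebra_simps)
  define I where "I j = integral UNIV (\<lambda>z. cutoff r' r z * MA_density (f j) z)" for j
  define J where "J = max J1 J2"
  have up: "I j \<le> C" if "J \<le> j" for j
  proof -
    have jR: "pdisc R \<subseteq> (pdisc (rad j) :: (complex ^ 'n) set)" using J1[of j] that by (intro pdisc_mono) (simp add: J_def)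
    show ?thesis
      unfolding I_def
    proof (rule RC(3)[OF f(2)])
      show "0 \<le> levi (f j) z b" if "z \<in> pdisc R" for z b using f(5) jR that by blast
      show "- M \<le> f j z \<and> f j z \<le> 2" if "z \<in> pdisc R" for z
      proof -
        have "z \<in> polydisc" using that sub[of R] RC by auto
        then show ?thesis using f(3)[of z j] gr_bounds(1)[of z] by auto
      qed
    qed
  qed
  have low: "q * measure lborel (cbox x y) \<le> I j" if j: "J \<le> j" for j
  proof -
    have jr: "pdisc r \<subseteq> (pdisc (rad j) :: (complex ^ 'n) set)" using J1[of j] RC j by (intro pdisc_mono) (auto simp: J_def)
    have rD: "pdisc r \<subseteq> (polydisc :: (complex ^ 'n) set)" using sub r by simp
    \<comment> \<open>Near the boundary \<open>f j \<ge> gr \<ge> -1\<close> while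
      \<open>w \<le> -4\<close>: exactly the gap 3.\<close>
    have out: "w z + 3 \<le> f j z" if "z \<in> pdisc r" "z \<notin> pdisc r'" for z
    proof -
      have zD: "z \<in> polydisc" using that rD by blast
      have "z \<notin> pdisc r0" using that(2) pdisc_mono[OF r(4)] by blast
      then show ?thesis using r0(2)[OF zD] w(3)[OF zD] f(3)[OF zD, of j] by linarith
    qed
    obtain F where F: "cdiff 3 UNIV F" "\<And>z b. z \<in> pdisc r \<Longrightarrow> 0 \<le> levi F z b"
      "\<And>z. z \<notin> pdisc r' \<Longrightarrow> F z = f j z"
      "\<And>z. z \<in> pdisc r \<Longrightarrow> f j z + 3 \<le> w z \<Longrightarrow> F z = w z"
      by (rule psh_glue[OF f(2)[of j] w(1) r(2), of thesis]) (use f(5) jr w(2) out in blast)+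
    have boxr: "z \<in> pdisc r'" "z \<in> pdisc r" if "z \<in> cbox x y" for z
      using that box(1) pdisc_mono[OF r(4)] pdisc_mono[of r' r] r(2) by auto
    have MAw: "MA_density F z = MA_density w z" if z: "z \<in> cbox x y" for z
    proof (rule MA_density_cong_open)
      have "open {z. f j z + 3 < w z}"
        using cdiff_continuous[OF f(2)] cdiff_continuous[OF w(1)] by (intro open_Collect_less continuous_intros)
      then show "open (pdisc r \<inter> {z. f j z + 3 < w z})" using open_pdisc by blast
      show "z \<in> pdisc r \<inter> {z. f j z + 3 < w z}" using boxr(2)[OF z] J2[OF _ z, of j] j by (simp add: J_def)
      show "F v = w v" if "v \<in> pdisc r \<inter> {z. f j z + 3 < w z}" for v using F(4) that by auto
      show "cdiff 2 (pdisc r \<inter> {z. f j z + 3 < w z}) F" using cdiff_le[OF cdiff_subset[OF F(1)]] by simp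
    qed
    have "q * measure lborel (cbox x y) = integral UNIV (\<lambda>z. if z \<in> cbox x y then q else 0)"
      by (simp add: integral_restrict_UNIV)
    also have "\<dots> \<le> integral UNIV (\<lambda>z. cutoff r' r z * MA_density F z)"
    proof (rule integral_le)
      show "(\<lambda>z. if z \<in> cbox x y then q else 0) integrable_on UNIV"
        unfolding integrable_restrict_UNIV by (rule integrable_const)
      fix z :: "complex ^ 'n"
      show "(if z \<in> cbox x y then q else 0) \<le> cutoff r' r z * MA_density F z"
      proof (cases "z \<in> cbox x y")
        case True
        have "\<forall>i. norm (z $ i) \<le> r'" using boxr(1)[OF True] by (auto simp: pdisc_def less_imp_le)
        then have "cutoff r' r z = 1" by (rule cutoff_eq_1[OF r(2)])
        then show ?thesis using True MAw[OF True] box(4)[OF True] by simp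
      next
        case False
        have "0 \<le> MA_density F z" if "z \<in> pdisc r"
          using MA_density_nonneg[OF cdiff_le[OF F(1)] F(2)[OF that]] by simp
        then show ?thesis using False cutoff_bounds(1)[of r' r z] cutoff_eq_0[OF r(2), of z] by (cases "z \<in> pdisc r") auto
      qed
    qed (intro cutoff_MA_integrable F r)
    also have "\<dots> = I j"
      unfolding I_def
      by (rule weighted_MA_eq[OF f(2) F(1) F(3) continuous_on_cutoff bounded_cutoff_support[OF r(2)] cutoff_eq_1[OF r(2)]])
    finally show ?thesis .
  qed
  \<comment> \<open>\<open>MA_test_integrals\<close> contains only limits. The integrals lie in a
    compact interval from some index on, so a subsequence converges and keeps the lower
    bound.\<close>
  have "\<exists>l s. l \<in> {q * measure lborel (cbox x y)..C} \<and> strict_mono s \<and> ((\<lambda>j. I (j + J)) \<circ> s) \<longlonglongrightarrow> l"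
    using compact_Icc[of "q * measure lborel (cbox x y)" C] low up
    unfolding compact_eq_seq_compact_metric seq_compact_def by (metis atLeastAtMost_iff le_add2)
  then obtain l s where l: "q * measure lborel (cbox x y) \<le> l" and s: "strict_mono s" and lim: "((\<lambda>j. I (j + J)) \<circ> s) \<longlonglongrightarrow> l" by auto
  have s': "strict_mono (\<lambda>j. s j + J)" using s by (simp add: strict_mono_def)
  have "ereal l \<in> MA_test_integrals polydisc g (cutoff r' r)"
    unfolding MA_test_integrals_def
    using smooth_approx_subseq[OF f(1) s'] lim by (fastforce simp: I_def o_def)
  then have "ereal l \<le> Sup (MA_test_integrals polydisc g (cutoff r' r))" by (rule Sup_upper)
  also have "\<dots> \<le> MA_mass polydisc g"
    unfolding MA_mass_def by (rule SUP_upper) (simp add: test_fun_cutoff r)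
  finally show ?thesis using l by (meson ereal_less_eq(3) order_trans)
qed

section \<open>Lelong numbers of slices and the Cegrell classes\<close>

lemma Sup_slice_nonpos:
  fixes u :: "complex ^ ('k::finite + 'm::finite) \<Rightarrow> ereal"
  assumes "\<And>z. z \<in> polydisc \<Longrightarrow> u z \<le> 0" "z' \<in> polydisc" "r < 1"
  shows "Sup ((\<lambda>x. u (join_coords z' x)) ` ball 0 r) \<le> 0"
proof (rule Sup_least, clarify)
  fix x assume "x \<in> ball (0 :: complex ^ 'm) r"
  then have "norm (x $ i) < 1" for i
    using Finite_Cartesian_Product.norm_nth_le[of x i] assms(3) by simp
  then have "join_coords z' x \<in> polydisc"
    using assms(2) by (auto simp: polydisc_def join_coords_def split: sum.split)
  then show "u (join_coords z' x) \<le> 0" by (rule assms(1))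
qed

text \<open>The Lelong number controls \<open>u\<close> only on radii that depend on
  \<open>z'\<close>. Applying \<open>psh_log_growth\<close> to the disc
  \<open>\<zeta> \<mapsto> (z', \<zeta> y)\<close> with \<open>x = s y\<close> removes this
  dependence at the price of \<open>c / 2\<close> for \<open>c\<close>.\<close>

lemma lelong_bound:
  fixes u :: "complex ^ ('k::finite + 'm::finite) \<Rightarrow> ereal"
  assumes u: "psh polydisc u" "\<And>z. z \<in> polydisc \<Longrightarrow> u z \<le> 0"
    and z': "z' \<in> polydisc" and c: "0 < c" "ereal c < lelong0 (\<lambda>x. u (join_coords z' x))"
    and s: "0 < s" "s < 1" and x: "\<And>i. norm (x $ i) \<le> s"
  shows "u (join_coords z' x) \<le> ereal (c / 2 * ln s)"
proof -
  define v where "v y = u (join_coords z' y)" for y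
  define y where "y = (\<chi> i. x $ i / complex_of_real s)"
  define p where "p = (join_coords z' 0 :: complex ^ ('k + 'm))"
  define b where "b = (join_coords 0 y :: complex ^ ('k + 'm))"
  have y1: "norm (y $ i) \<le> 1" for i using x[of i] s by (simp add: y_def norm_divide)
  have line: "p + \<zeta> *s b = join_coords z' (\<zeta> *s y)" for \<zeta>
    by (auto simp: vec_eq_iff p_def b_def join_coords_def split: sum.split)
  have inD: "p + \<zeta> *s b \<in> polydisc" if "norm \<zeta> < 1" for \<zeta>
  proof -
    have "norm (\<zeta> * y $ i) < 1" for i
      using y1[of i] that mult_left_le[of "norm (y $ i)" "norm \<zeta>"] by (simp add: norm_mult)
    then show ?thesis using z' unfolding line by (auto simp: polydisc_def join_coords_def split: sum.split)
  qed
  have "\<forall>\<^sub>F r in at_right 0. ereal c < Sup (v ` ball 0 r) / ereal (ln r)"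
    using c(2) le_Liminf_iff[of "lelong0 v" "at_right 0" "\<lambda>r. Sup (v ` ball 0 r) / ereal (ln r)"]
    by (simp add: lelong0_def v_def[abs_def])
  then obtain e0 where e0: "0 < e0" "\<And>r. 0 < r \<Longrightarrow> r < e0 \<Longrightarrow> ereal c < Sup (v ` ball 0 r) / ereal (ln r)"
    unfolding eventually_at_right_field by auto
  define e1 where "e1 = min e0 1"
  have small: "v t \<le> ereal (c * ln r)" if r: "0 < r" "r < e1" and t: "norm t < r" for r t
  proof -
    have lnr: "ln r < 0" using r by (simp add: e1_def)
    have "ereal c < Sup (v ` ball 0 r) / ereal (ln r)" using e0(2) r by (simp add: e1_def)
    moreover have "Sup (v ` ball 0 r) \<le> 0"
      unfolding v_def[abs_def] by (rule Sup_slice_nonpos[OF u(2) z']) (use r in \<open>simp_all add: e1_def\<close>)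
    ultimately have "Sup (v ` ball 0 r) \<le> ereal (c * ln r)"
      using lnr by (cases "Sup (v ` ball 0 r)") (auto simp: field_simps)
    moreover have "v t \<le> Sup (v ` ball 0 r)" by (rule Sup_upper) (use t in auto)
    ultimately show ?thesis by (rule order_trans[rotated])
  qed
  define m where "m = real CARD('m)"
  have m: "1 \<le> m" by (simp add: m_def Suc_leI)
  have ny: "norm y \<le> m" using norm_pdisc_le[of y 1] y1 by (simp add: m_def)
  have "u (p + complex_of_real s *s b) \<le> ereal (c / 2 * ln (norm (complex_of_real s)))"
  proof (rule psh_log_growth[OF u(1) inD])
    show "u (p + \<zeta> *s b) \<le> 0" if "norm \<zeta> < 1" for \<zeta> using u(2) inD[OF that] by blast
    show "0 < c / 2" "c / 2 < c" using c by auto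
    \<comment> \<open>The factor \<open>m\<close> passes from coordinates to the Euclidean norm, and
      2 makes the inclusion in an open ball strict; together they cost the constant
      \<open>c * ln (2 * m)\<close>.\<close>
    show "0 < e1 / (2 * m)" using e0(1) m by (simp add: e1_def)
    fix \<zeta> :: complex assume z: "0 < norm \<zeta>" "norm \<zeta> < e1 / (2 * m)"
    have "norm (\<zeta> *s y) \<le> norm \<zeta> * m" using ny by (simp add: norm_smult_vec mult_left_mono)
    also have "\<dots> < 2 * m * norm \<zeta>" using z m by simp
    finally have "v (\<zeta> *s y) \<le> ereal (c * ln (2 * m * norm \<zeta>))"
      using z m by (intro small) (auto simp: field_simps)
    also have "ln (2 * m * norm \<zeta>) = ln (norm \<zeta>) + ln (2 * m)" using z m by (simp add: ln_mult)
    finally show "u (p + \<zeta> *s b) \<le> ereal (c * ln (norm \<zeta>) + c * ln (2 * m))"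
      by (simp add: line v_def distrib_left)
  qed (use s in auto)
  moreover have "complex_of_real s *s y = x" using s by (simp add: vec_eq_iff y_def)
  ultimately show ?thesis using s by (simp add: line)
qed

lemma cegrell_F_D:
  assumes "\<psi> \<in> cegrell_F \<Omega>"
  obtains g C where "\<And>j. g j \<in> cegrell_E0 \<Omega>" "\<And>j z. z \<in> \<Omega> \<Longrightarrow> g (Suc j) z \<le> g j z"
    "\<And>z. z \<in> \<Omega> \<Longrightarrow> (\<lambda>j. g j z) \<longlonglongrightarrow> \<psi> z" "\<And>j. MA_mass \<Omega> (g j) \<le> ereal C"
proof -
  obtain g where g: "\<And>j. g j \<in> cegrell_E0 \<Omega>" "\<And>j z. z \<in> \<Omega> \<Longrightarrow> g (Suc j) z \<le> g j z"
    "\<And>z. z \<in> \<Omega> \<Longrightarrow> (\<lambda>j. g j z) \<longlonglongrightarrow> \<psi> z" "(SUP j. MA_mass \<Omega> (g j)) < \<infinity>"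
    using assms unfolding cegrell_F_def by blast
  obtain C where "(SUP j. MA_mass \<Omega> (g j)) \<le> ereal C"
    using g(4) by (cases "SUP j. MA_mass \<Omega> (g j)") auto
  then have "MA_mass \<Omega> (g j) \<le> ereal C" for j by (meson SUP_upper UNIV_I order_trans)
  then show ?thesis using that g by blast
qed

lemma cegrell_F_nonpos:
  assumes "\<psi> \<in> cegrell_F (polydisc :: (complex ^ 'n::finite) set)" "z \<in> polydisc"
  shows "\<psi> z \<le> 0"
proof -
  obtain g C where g: "\<And>j. g j \<in> cegrell_E0 (polydisc :: (complex ^ 'n) set)"
    "\<And>z. z \<in> polydisc \<Longrightarrow> (\<lambda>j. g j z) \<longlonglongrightarrow> \<psi> z"
    by (rule cegrell_F_D[OF assms(1)]) blast
  show ?thesis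
    by (rule LIMSEQ_le_const2[OF g(2)[OF assms(2)]]) (use cegrell_E0_nonpos[OF g(1) assms(2)] in auto)
qed

lemma cegrell_E_local:
  assumes "u \<in> cegrell_E (polydisc :: (complex ^ 'n::finite) set)" "r < 1"
  obtains \<psi> where "\<psi> \<in> cegrell_F polydisc" "\<And>z. z \<in> pdisc r \<Longrightarrow> \<psi> z = u z"
proof -
  have "closure (pdisc r) \<subseteq> {z::complex ^ 'n. \<forall>i. norm (z $ i) \<le> r}"
    by (rule closure_minimal[OF _ closed_pdisc]) (auto simp: pdisc_def intro: less_imp_le)
  moreover have "{z::complex ^ 'n. \<forall>i. norm (z $ i) \<le> r} \<subseteq> polydisc"
    using assms(2) by (auto simp: polydisc_def intro: le_less_trans)
  moreover have "compact (closure (pdisc r :: (complex ^ 'n) set))"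
    unfolding compact_closure by (rule bounded_subset[OF bounded_pdisc[of r]]) (auto simp: pdisc_def intro: less_imp_le)
  moreover have "open (pdisc r :: (complex ^ 'n) set)" by (rule open_pdisc)
  ultimately have "open (pdisc r :: (complex ^ 'n) set) \<and> compact (closure (pdisc r :: (complex ^ 'n) set))
      \<and> closure (pdisc r) \<subseteq> (polydisc :: (complex ^ 'n) set)"
    by blast
  moreover have "open \<omega> \<and> compact (closure \<omega>) \<and> closure \<omega> \<subseteq> polydisc \<Longrightarrow> \<exists>\<psi>\<in>cegrell_F polydisc. \<forall>z\<in>\<omega>. \<psi> z = u z" for \<omega>
    using assms(1) unfolding cegrell_E_def by simp
  ultimately show ?thesis using that by meson
qed

lemma cegrell_E_nonpos:
  assumes "u \<in> cegrell_E (polydisc :: (complex ^ 'n::finite) set)" "z \<in> polydisc"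
  shows "u z \<le> 0"
proof -
  obtain r where r: "r < 1" "{z} \<subseteq> pdisc r"
    using compact_subset_pdisc[of "{z}"] assms(2) by (auto simp: polydisc_eq_pdisc)
  obtain \<psi> where "\<psi> \<in> cegrell_F polydisc" "\<psi> z = u z"
    using cegrell_E_local[OF assms(1) r(1)] r(2) by (metis insert_subset)
  then show ?thesis using cegrell_F_nonpos[OF _ assms(2), of \<psi>] by simp
qed

lemma cegrell_E0_bounded_psh:
  assumes "g \<in> cegrell_E0 (polydisc :: (complex ^ 'n::finite) set)"
  obtains M where "bounded_psh g M"
proof -
  obtain M where M: "\<And>z. z \<in> polydisc \<Longrightarrow> \<bar>g z\<bar> \<le> ereal M" using assms unfolding cegrell_E0_def by blast
  have "ereal (- M) \<le> g z" if "z \<in> polydisc" for z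
    using M[OF that] by (cases "g z") auto
  then have "bounded_psh g M"
    using assms cegrell_E0_nonpos[OF assms] by unfold_locales (auto simp: cegrell_E0_def)
  then show ?thesis by (rule that)
qed

section \<open>The comparison function and its mass on a box\<close>

text \<open>Real boxes have an explicit volume. Half-sides \<open>\<sigma> i / 2\<close> in both
  real directions keep the modulus at most \<open>\<sigma> i\<close>.\<close>

lemma cbox_norm_le:
  fixes p z :: "complex ^ 'n::finite"
  assumes "z \<in> cbox (p - (\<chi> i. Complex (\<sigma> i / 2) (\<sigma> i / 2))) (p + (\<chi> i. Complex (\<sigma> i / 2) (\<sigma> i / 2)))"
  shows "norm (z $ i - p $ i) \<le> \<sigma> i"
proof -
  have B: "axis i 1 \<in> (Basis :: (complex ^ 'n) set)" "axis i \<i> \<in> (Basis :: (complex ^ 'n) set)"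
    by (auto simp: Basis_vec_def Basis_complex_def)
  have "\<bar>Re (z $ i - p $ i)\<bar> \<le> \<sigma> i / 2" "\<bar>Im (z $ i - p $ i)\<bar> \<le> \<sigma> i / 2"
    using bspec[OF assms[unfolded mem_box] B(1)] bspec[OF assms[unfolded mem_box] B(2)]
    by (simp_all add: inner_axis inner_complex_def del: le_divide_eq_numeral1) linarith+
  then show ?thesis using cmod_le[of "z $ i - p $ i"] by linarith
qed

lemma measure_cbox_complex:
  fixes p :: "complex ^ 'n::finite"
  assumes "\<And>i. 0 \<le> \<sigma> i"
  shows "measure lborel (cbox (p - (\<chi> i. Complex (\<sigma> i / 2) (\<sigma> i / 2))) (p + (\<chi> i. Complex (\<sigma> i / 2) (\<sigma> i / 2))))
     = (\<Prod>i\<in>UNIV. (\<sigma> i)\<^sup>2)"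
proof -
  let ?q = "\<chi> i. Complex (\<sigma> i / 2) (\<sigma> i / 2)"
  have q: "?q \<bullet> axis i e = \<sigma> i / 2" if "e \<in> Basis" for i e
    using that by (auto simp: inner_axis inner_complex_def Basis_complex_def)
  have B: "(Basis :: (complex ^ 'n) set) = (\<lambda>(i, e). axis i e) ` (UNIV \<times> Basis)"
    by (auto simp: Basis_vec_def)
  have inj: "inj_on (\<lambda>(i, e). axis i e :: complex ^ 'n) (UNIV \<times> Basis)"
    by (auto simp: inj_on_def axis_eq_axis nonzero_Basis)
  have "measure lborel (cbox (p - ?q) (p + ?q)) = (\<Prod>b\<in>Basis. (p + ?q) \<bullet> b - (p - ?q) \<bullet> b)"
    by (rule content_cbox) (clarsimp simp: B inner_add_left inner_diff_left q assms)
  also have "\<dots> = (\<Prod>b\<in>Basis. 2 * (?q \<bullet> b))" by (simp add: inner_add_left inner_diff_left)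
  also have "\<dots> = (\<Prod>(i, e)\<in>UNIV \<times> Basis. 2 * (?q \<bullet> axis i e))"
    unfolding B prod.reindex[OF inj] by (simp add: o_def split_beta)
  also have "\<dots> = (\<Prod>i\<in>UNIV. \<Prod>e\<in>(Basis :: complex set). \<sigma> i)"
    unfolding prod.cartesian_product[symmetric] by (intro prod.cong refl) (simp add: q)
  also have "\<dots> = (\<Prod>i\<in>UNIV. (\<sigma> i)\<^sup>2)" by simp
  finally show ?thesis .
qed

text \<open>The function \<open>\<alpha> |z' - a|\<^sup>2 + \<beta> \<Sum> ln (|z''\<^sub>i|\<^sup>2 + s\<^sup>2) + const\<close>. With \<open>\<alpha>\<close> of order \<open>- ln s\<close> and \<open>\<beta>\<close> constant it
  has size \<open>- ln s\<close>, and its mass on \<open>Q\<close> is of order \<open>(- ln s) ^ k\<close>.\<close>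

lemma comparison_function:
  fixes a :: "complex ^ 'k::finite" and \<alpha> \<beta> s h :: real
  assumes a: "a \<in> polydisc" and pos: "0 < \<alpha>" "0 < \<beta>" "0 < s" "s < 1" "0 < h"
  defines "p \<equiv> (join_coords a 0 :: complex ^ ('k + 'm::finite))"
    and "\<sigma> \<equiv> (\<lambda>i::'k + 'm. case i of Inl _ \<Rightarrow> h | Inr _ \<Rightarrow> s)"
  defines "Q \<equiv> cbox (p - (\<chi> i. Complex (\<sigma> i / 2) (\<sigma> i / 2))) (p + (\<chi> i. Complex (\<sigma> i / 2) (\<sigma> i / 2)))"
  obtains w q where "cdiff 3 UNIV w" "\<And>z b. 0 \<le> levi w z b" "\<And>z. z \<in> polydisc \<Longrightarrow> w z \<le> - 4"
    "\<And>z. 2 * CARD('m) * \<beta> * ln s - (4 * CARD('k) * \<alpha> + CARD('m) * \<beta> + 4) \<le> w z"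
    "0 \<le> q" "\<And>z. z \<in> Q \<Longrightarrow> q \<le> MA_density w z"
    "q * measure lborel Q = \<alpha> ^ CARD('k) * (\<beta> / 4) ^ CARD('m) * (h\<^sup>2) ^ CARD('k)"
proof -
  \<comment> \<open>On the polydisc each quadratic term is at most \<open>4 \<alpha>\<close> and
    each logarithmic term at most \<open>\<beta>\<close>; subtracting \<open>D\<close> leaves
    \<open>w \<le> -4\<close>.\<close>
  define D where "D = 4 * CARD('k) * \<alpha> + CARD('m) * \<beta> + 4"
  define n where "n = real CARD('k + 'm)"
  have n: "0 < n" unfolding n_def by (simp only: of_nat_0_less_iff zero_less_card_finite)
  define f where "f i t = (case i of Inl _ \<Rightarrow> \<alpha> * t - D / n | Inr _ \<Rightarrow> \<beta> * ln (t + s\<^sup>2) - D / n)" for i :: "'k + 'm" and t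
  define f1 where "f1 i t = (case i of Inl _ \<Rightarrow> \<alpha> | Inr _ \<Rightarrow> \<beta> / (t + s\<^sup>2))" for i :: "'k + 'm" and t
  define f2 where "f2 i t = (case i of Inl _ \<Rightarrow> 0 | Inr _ \<Rightarrow> - \<beta> / (t + s\<^sup>2)\<^sup>2)" for i :: "'k + 'm" and t
  have s2: "0 < t + s\<^sup>2" if "0 \<le> t" for t using that pos by (simp add: add_nonneg_pos)
  have d1: "(f i has_real_derivative f1 i t) (at t)" if "0 \<le> t" for i t
    using s2[OF that] by (cases i) (auto simp: f_def[abs_def] f1_def intro!: derivative_eq_intros)
  have d2: "(f1 i has_real_derivative f2 i t) (at t)" if "0 \<le> t" for i t
    using s2[OF that] by (cases i) (auto simp: f1_def[abs_def] f2_def power2_eq_square intro!: derivative_eq_intros)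
  \<comment> \<open>These are the diagonal entries of the complex Hessian. In the \<open>z''\<close>
    directions they form a bump of height \<open>\<beta> / s^2\<close> and width
    \<open>s\<close>.\<close>
  have f12: "f1 i t + t * f2 i t = (case i of Inl _ \<Rightarrow> \<alpha> | Inr _ \<Rightarrow> \<beta> * s\<^sup>2 / (t + s\<^sup>2)\<^sup>2)" if "0 \<le> t" for i t
  proof (cases i)
    case (Inr j)
    let ?T = "t + s\<^sup>2"
    have "\<beta> / ?T = \<beta> * ?T / ?T\<^sup>2" using s2[OF that] by (simp add: power2_eq_square)
    then have "f1 i t + t * f2 i t = (\<beta> * ?T - t * \<beta>) / ?T\<^sup>2" by (simp add: f1_def f2_def Inr diff_divide_distrib)
    also have "\<beta> * ?T - t * \<beta> = \<beta> * s\<^sup>2" by (simp add: algebra_simps)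
    finally show ?thesis using Inr by simp
  qed (simp add: f1_def f2_def)
  have f12_nonneg: "0 \<le> f1 i t + t * f2 i t" if "0 \<le> t" for i t
    unfolding f12[OF that] using pos by (auto split: sum.split)
  have cf: "cdiff 3 {- (s\<^sup>2)<..} (f i)" for i
  proof (cases i)
    case (Inl j)
    have "cdiff 3 {- (s\<^sup>2)<..} (\<lambda>t. \<alpha> * t - D / n)"
      by (intro cdiff_diff cdiff_mult cdiff_const cdiff_linear bounded_linear_ident open_greaterThan)
    then show ?thesis using Inl by (simp add: f_def[abs_def])
  next
    case (Inr j)
    have "cdiff 3 {- (s\<^sup>2)<..} (\<lambda>t. t + s\<^sup>2)"
      by (intro cdiff_add cdiff_const cdiff_linear bounded_linear_ident open_greaterThan)
    then have "cdiff 3 {- (s\<^sup>2)<..} (\<lambda>t. ln (t + s\<^sup>2))"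
      by (rule cdiff_compose_real[OF open_greaterThan open_greaterThan _ _ cdiff_ln, rotated]) auto
    then have "cdiff 3 {- (s\<^sup>2)<..} (\<lambda>t. \<beta> * ln (t + s\<^sup>2) - D / n)"
      by (intro cdiff_diff cdiff_mult cdiff_const open_greaterThan)
    then show ?thesis using Inr by (simp add: f_def[abs_def])
  qed
  define w where "w = (\<lambda>z. \<Sum>i\<in>UNIV. f i ((z $ i - p $ i) \<bullet> (z $ i - p $ i)))"
  have sumsplit: "(\<Sum>i\<in>UNIV. F i) = (\<Sum>i\<in>UNIV. F (Inl i)) + (\<Sum>i\<in>UNIV. F (Inr i))" for F :: "'k + 'm \<Rightarrow> real"
    unfolding UNIV_Plus_UNIV[symmetric] by (subst sum.Plus) auto
  have prodsplit: "(\<Prod>i\<in>UNIV. F i) = (\<Prod>i\<in>UNIV. F (Inl i)) * (\<Prod>i\<in>UNIV. F (Inr i))" for F :: "'k + 'm \<Rightarrow> real"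
    unfolding UNIV_Plus_UNIV[symmetric] by (subst prod.Plus) auto
  have wz: "w z = (\<Sum>i\<in>UNIV. \<alpha> * (norm (z $ Inl i - a $ i))\<^sup>2) + (\<Sum>i\<in>UNIV. \<beta> * ln ((norm (z $ Inr i))\<^sup>2 + s\<^sup>2)) - D" for z
  proof -
    have nn: "real CARD('k) * (D / n) + real CARD('m) * (D / n) = D"
      using n by (simp add: n_def add_divide_distrib[symmetric] distrib_right[symmetric])
    have "w z = (\<Sum>i\<in>UNIV. \<alpha> * (norm (z $ Inl i - a $ i))\<^sup>2 - D / n) + (\<Sum>i\<in>UNIV. \<beta> * ln ((norm (z $ Inr i))\<^sup>2 + s\<^sup>2) - D / n)"
      unfolding w_def sumsplit by (simp add: f_def p_def join_coords_def dot_square_norm)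
    also have "\<dots> = (\<Sum>i\<in>UNIV. \<alpha> * (norm (z $ Inl i - a $ i))\<^sup>2) + (\<Sum>i\<in>UNIV. \<beta> * ln ((norm (z $ Inr i))\<^sup>2 + s\<^sup>2))
        - (real CARD('k) * (D / n) + real CARD('m) * (D / n))"
      by (simp add: sum_subtractf)
    finally show ?thesis unfolding nn .
  qed
  \<comment> \<open>On \<open>Q\<close> the squared moduli in \<open>z''\<close> are at most
    \<open>s^2\<close>, which gives the bound \<open>\<beta> / (4 s^2)\<close> for each of those
    entries.\<close>
  define q where "q = \<alpha> ^ CARD('k) * (\<beta> / (4 * s\<^sup>2)) ^ CARD('m)"
  show ?thesis
  proof (rule that[of w q])
    show "cdiff 3 UNIV w" unfolding w_def
    proof (rule separable_cdiff[OF open_greaterThan _ cf], rule subsetI)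
      fix t :: real assume "t \<in> {0..}"
      then show "t \<in> {- (s\<^sup>2)<..}" using s2[of t] by simp
    qed
    show "0 \<le> levi w z b" for z b
      unfolding w_def by (rule separable_levi_nonneg[where h = f and ?h1.0 = f1 and ?h2.0 = f2]) (use d1 d2 f12_nonneg in auto)
    show "w z \<le> - 4" if z: "z \<in> polydisc" for z
    proof -
      have 1: "\<alpha> * (norm (z $ Inl i - a $ i))\<^sup>2 \<le> \<alpha> * 4" for i
      proof -
        have "norm (z $ Inl i) \<le> 1" "norm (a $ i) \<le> 1" using z a by (auto simp: polydisc_def less_imp_le)
        then have "norm (z $ Inl i - a $ i) \<le> 2" using norm_triangle_ineq4[of "z $ Inl i" "a $ i"] by linarith
        then have "(norm (z $ Inl i - a $ i))\<^sup>2 \<le> 2\<^sup>2" by (intro power_mono) auto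
        then show ?thesis using pos by simp
      qed
      have 2: "\<beta> * ln ((norm (z $ Inr i))\<^sup>2 + s\<^sup>2) \<le> \<beta> * 1" for i
      proof -
        have "(norm (z $ Inr i))\<^sup>2 \<le> 1" "s\<^sup>2 \<le> 1" using z pos by (auto simp: polydisc_def less_imp_le power_le_one)
        moreover have "ln ((norm (z $ Inr i))\<^sup>2 + s\<^sup>2) \<le> (norm (z $ Inr i))\<^sup>2 + s\<^sup>2 - 1"
          by (rule ln_le_minus_one) (rule s2, simp)
        ultimately show ?thesis using pos by (intro mult_left_mono) auto
      qed
      have "(\<Sum>i\<in>UNIV. \<alpha> * (norm (z $ Inl i - a $ i))\<^sup>2) \<le> (\<Sum>i\<in>(UNIV::'k set). \<alpha> * 4)"
        "(\<Sum>i\<in>UNIV. \<beta> * ln ((norm (z $ Inr i))\<^sup>2 + s\<^sup>2)) \<le> (\<Sum>i\<in>(UNIV::'m set). \<beta> * 1)"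
        by (intro sum_mono 1 2)+
      then show ?thesis by (simp add: wz D_def)
    qed
    show "2 * CARD('m) * \<beta> * ln s - (4 * CARD('k) * \<alpha> + CARD('m) * \<beta> + 4) \<le> w z" for z
    proof -
      have "\<beta> * (2 * ln s) \<le> \<beta> * ln ((norm (z $ Inr i))\<^sup>2 + s\<^sup>2)" for i
      proof -
        have "2 * ln s = ln (s\<^sup>2)" using pos by (simp add: ln_realpow)
        also have "\<dots> \<le> ln ((norm (z $ Inr i))\<^sup>2 + s\<^sup>2)"
          using pos s2[of "(norm (z $ Inr i))\<^sup>2"] by (subst ln_le_cancel_iff) auto
        finally show ?thesis using pos by (intro mult_left_mono) auto
      qed
      then have "(\<Sum>i\<in>(UNIV::'m set). \<beta> * (2 * ln s)) \<le> (\<Sum>i\<in>UNIV. \<beta> * ln ((norm (z $ Inr i))\<^sup>2 + s\<^sup>2))" by (intro sum_mono)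
      moreover have "0 \<le> (\<Sum>i\<in>UNIV. \<alpha> * (norm (z $ Inl i - a $ i))\<^sup>2)" using pos by (intro sum_nonneg) auto
      ultimately show ?thesis by (simp add: wz D_def algebra_simps)
    qed
    show "0 \<le> q" using pos by (simp add: q_def)
    show "q \<le> MA_density w z" if z: "z \<in> Q" for z
    proof -
      let ?t = "\<lambda>i. (z $ i - p $ i) \<bullet> (z $ i - p $ i)"
      have l: "\<alpha> \<le> f1 (Inl i) (?t (Inl i)) + ?t (Inl i) * f2 (Inl i) (?t (Inl i))" for i
        unfolding f12[OF inner_ge_zero] by simp
      have r: "\<beta> / (4 * s\<^sup>2) \<le> f1 (Inr i) (?t (Inr i)) + ?t (Inr i) * f2 (Inr i) (?t (Inr i))" for i
      proof -
        have "norm (z $ Inr i - p $ Inr i) \<le> s"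
          using cbox_norm_le[OF z[unfolded Q_def], of "Inr i"] by (simp add: \<sigma>_def)
        then have ts: "?t (Inr i) \<le> s\<^sup>2" by (simp add: dot_square_norm power_mono)
        have "(?t (Inr i) + s\<^sup>2)\<^sup>2 \<le> (2 * s\<^sup>2)\<^sup>2" using ts by (intro power_mono) auto
        also have "\<dots> = 4 * s\<^sup>2 * s\<^sup>2" by (simp add: power2_eq_square)
        finally have "\<beta> * s\<^sup>2 / (4 * s\<^sup>2 * s\<^sup>2) \<le> \<beta> * s\<^sup>2 / (?t (Inr i) + s\<^sup>2)\<^sup>2"
          using pos s2[OF inner_ge_zero, of "z $ Inr i - p $ Inr i"] by (intro divide_left_mono) auto
        moreover have "\<beta> * s\<^sup>2 / (4 * s\<^sup>2 * s\<^sup>2) = \<beta> / (4 * s\<^sup>2)" using pos by simp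
        ultimately show ?thesis unfolding f12[OF inner_ge_zero] by simp
      qed
      have "q = (\<Prod>i\<in>(UNIV::'k set). \<alpha>) * (\<Prod>i\<in>(UNIV::'m set). \<beta> / (4 * s\<^sup>2))" by (simp add: q_def)
      also have "\<dots> \<le> (\<Prod>i\<in>UNIV. f1 (Inl i) (?t (Inl i)) + ?t (Inl i) * f2 (Inl i) (?t (Inl i)))
          * (\<Prod>i\<in>UNIV. f1 (Inr i) (?t (Inr i)) + ?t (Inr i) * f2 (Inr i) (?t (Inr i)))"
        using l r pos by (intro mult_mono prod_mono conjI prod_nonneg) (auto intro: f12_nonneg)
      also have "\<dots> = (\<Prod>i\<in>UNIV. f1 i (?t i) + ?t i * f2 i (?t i))" by (rule prodsplit[symmetric])
      also have "\<dots> = 1 * \<dots>" by simp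
      also have "\<dots> \<le> (4 ^ CARD('k + 'm) * fact CARD('k + 'm)) * (\<Prod>i\<in>UNIV. f1 i (?t i) + ?t i * f2 i (?t i))"
      proof (rule mult_right_mono)
        have "1 * 1 \<le> (4::real) ^ CARD('k + 'm) * fact CARD('k + 'm)"
          by (rule mult_mono) (auto simp: one_le_power fact_ge_1)
        then show "1 \<le> (4::real) ^ CARD('k + 'm) * fact CARD('k + 'm)" by simp
        show "0 \<le> (\<Prod>i\<in>UNIV. f1 i (?t i) + ?t i * f2 i (?t i))" by (intro prod_nonneg) (auto intro: f12_nonneg)
      qed
      also have "\<dots> = MA_density w z"
        unfolding w_def by (rule separable_MA_density[symmetric]) (use d1 d2 in auto)
      finally show ?thesis .
    qed
    have "measure lborel Q = (\<Prod>i\<in>UNIV. (\<sigma> i)\<^sup>2)"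
      unfolding Q_def by (rule measure_cbox_complex) (use pos in \<open>auto simp: \<sigma>_def split: sum.split\<close>)
    also have "\<dots> = (h\<^sup>2) ^ CARD('k) * (s\<^sup>2) ^ CARD('m)" unfolding prodsplit by (simp add: \<sigma>_def)
    finally have "q * measure lborel Q = \<alpha> ^ CARD('k) * ((\<beta> / (4 * s\<^sup>2)) ^ CARD('m) * (s\<^sup>2) ^ CARD('m)) * (h\<^sup>2) ^ CARD('k)"
      by (simp add: q_def)
    \<comment> \<open>Density and volume in \<open>z''\<close> cancel, so the bound depends on
      \<open>s\<close> only through \<open>\<alpha>\<close>.\<close>
    also have "(\<beta> / (4 * s\<^sup>2)) ^ CARD('m) * (s\<^sup>2) ^ CARD('m) = (\<beta> / 4) ^ CARD('m)"
      unfolding power_mult_distrib[symmetric] using pos by simp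
    finally show "q * measure lborel Q = \<alpha> ^ CARD('k) * (\<beta> / 4) ^ CARD('m) * (h\<^sup>2) ^ CARD('k)" .
  qed
qed

section \<open>The contradiction and the theorem\<close>

lemma cegrell_E_lelong_not_bounded_below:
  fixes u :: "complex ^ ('k::finite + 'm::finite) \<Rightarrow> ereal"
  assumes u: "u \<in> cegrell_E polydisc" and a: "a \<in> (polydisc :: (complex ^ 'k) set)" and r0: "0 < r0" and c: "0 < c"
    and lel: "\<And>z'. z' \<in> ball a r0 \<inter> polydisc \<Longrightarrow> ereal c < lelong0 (\<lambda>x. u (join_coords z' x))"
  shows False
proof -
  have upsh: "psh polydisc u" using u by (simp add: cegrell_E_def)
  define k where "k = real CARD('k)"
  define m where "m = real CARD('m)"
  have km: "1 \<le> k" "1 \<le> m" by (auto simp: k_def m_def Suc_leI)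
  obtain A where A: "A < 1" "{a} \<subseteq> pdisc A" using compact_subset_pdisc[of "{a}"] a by (auto simp: polydisc_eq_pdisc)
  have aA: "norm (a $ i) < A" for i using A(2) by (simp add: pdisc_def)
  have A0: "0 < A" using aA[of undefined] norm_ge_zero[of "a $ undefined"] by linarith
  \<comment> \<open>The first entry keeps the box inside \<open>pdisc R\<close>, the second keeps
    its \<open>z'\<close>-part inside \<open>ball a r0\<close>.\<close>
  define h where "h = min ((1 - A) / 4) (r0 / (2 * k))"
  have h: "0 < h" "h \<le> (1 - A) / 4" "k * h < r0"
  proof -
    show "0 < h" using A r0 km by (simp add: h_def)
    show "h \<le> (1 - A) / 4" unfolding h_def by (rule min.cobounded1)
    have "k * h \<le> k * (r0 / (2 * k))" using km by (intro mult_left_mono) (auto simp: h_def)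
    then show "k * h < r0" using km r0 by simp
  qed
  define R where "R = (1 + A) / 2"
  have R: "R < 1" "A + h < R" "1/2 < R" using A A0 h by (auto simp: R_def field_simps)
  \<comment> \<open>\<open>\<psi>\<close>, \<open>g\<close> and the bound \<open>C\<close> depend on
    \<open>R\<close> only. The index \<open>J\<close> selected later depends on \<open>s\<close>,
    but \<open>C\<close> bounds all the masses.\<close>
  obtain \<psi> where \<psi>: "\<psi> \<in> cegrell_F polydisc" "\<And>z. z \<in> pdisc R \<Longrightarrow> \<psi> z = u z"
    by (rule cegrell_E_local[OF u R(1)]) blast
  obtain g C where g: "\<And>j. g j \<in> cegrell_E0 (polydisc :: (complex ^ ('k + 'm)) set)"
    "\<And>j z. z \<in> polydisc \<Longrightarrow> g (Suc j) z \<le> g j z" "\<And>z. z \<in> polydisc \<Longrightarrow> (\<lambda>j. g j z) \<longlonglongrightarrow> \<psi> z"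
    "\<And>j. MA_mass polydisc (g j) \<le> ereal C"
    by (rule cegrell_F_D[OF \<psi>(1)]) blast
  define c1 where "c1 = c / 2"
  have c1: "0 < c1" using c by (simp add: c1_def)
  define \<kappa> where "\<kappa> = (c1 / (16 * k)) ^ CARD('k) * (c1 / (8 * m) / 4) ^ CARD('m) * (h\<^sup>2) ^ CARD('k)"
  have \<kappa>: "0 < \<kappa>" using c1 km h by (simp add: \<kappa>_def)
  \<comment> \<open>\<open>L\<close> is \<open>- ln s\<close>. The second entry yields the gap
    \<open>L2\<close> between \<open>g J\<close> and \<open>w\<close> on the box, the third makes
    \<open>\<kappa> * L\<close> exceed \<open>\<bar>C\<bar>\<close>.\<close>
  define L where "L = max 1 (max ((20 + c1) / c1 * 2) (\<bar>C\<bar> / \<kappa> + 1))"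
  have L: "1 \<le> L" "(20 + c1) / c1 * 2 \<le> L" "\<bar>C\<bar> / \<kappa> < L" by (auto simp: L_def)
  have L2: "10 + c1 / 2 \<le> c1 * L / 4"
  proof -
    have "c1 * ((20 + c1) / c1 * 2) \<le> c1 * L" using L(2) c1 by (intro mult_left_mono) auto
    then have "2 * (20 + c1) \<le> c1 * L" using c1 by simp
    then show ?thesis by simp
  qed
  define s where "s = exp (- L)"
  have s: "0 < s" "s \<le> 1/2" "ln s = - L"
  proof -
    have "s \<le> exp (- 1)" using L(1) by (simp add: s_def)
    also have "exp (- 1) \<le> (1/2 :: real)" using exp_ge_add_one_self[of 1]
      by (simp add: exp_minus inverse_eq_divide)
    finally show "s \<le> 1/2" .
  qed (auto simp: s_def)
  define p where "p = (join_coords a 0 :: complex ^ ('k + 'm))"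
  define \<sigma> where "\<sigma> = (\<lambda>i::'k + 'm. case i of Inl _ \<Rightarrow> h | Inr _ \<Rightarrow> s)"
  define Q where "Q = cbox (p - (\<chi> i. Complex (\<sigma> i / 2) (\<sigma> i / 2))) (p + (\<chi> i. Complex (\<sigma> i / 2) (\<sigma> i / 2)))"
  have Ql: "norm (z $ Inl i - a $ i) \<le> h" and Qr: "norm (z $ Inr j) \<le> s" if "z \<in> Q" for z i j
    using cbox_norm_le[OF that[unfolded Q_def], of "Inl i"] cbox_norm_le[OF that[unfolded Q_def], of "Inr j"]
    by (simp_all add: \<sigma>_def p_def join_coords_def)
  have QR: "Q \<subseteq> pdisc R"
  proof
    fix z assume z: "z \<in> Q"
    have "norm (z $ i) < R" for i
    proof (cases i)
      case (Inl j)
      then show ?thesis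
        using Ql[OF z, of j] aA[of j] norm_triangle_sub[of "z $ Inl j" "a $ j"] R(2) by simp
    next
      case (Inr j)
      then show ?thesis using Qr[OF z, of j] s R by simp
    qed
    then show "z \<in> pdisc R" by (simp add: pdisc_def)
  qed
  have RD: "pdisc R \<subseteq> (polydisc :: (complex ^ ('k + 'm)) set)" unfolding polydisc_eq_pdisc using R by (intro pdisc_mono) simp
  have uQ: "u z \<le> ereal (- c1 * L)" if z: "z \<in> Q" for z
  proof -
    define z' where "z' = (\<chi> i. z $ Inl i)"
    define x where "x = (\<chi> i. z $ Inr i)"
    have zj: "z = join_coords z' x" by (auto simp: vec_eq_iff join_coords_def z'_def x_def split: sum.split)
    have "norm (z' - a) \<le> CARD('k) * h" by (rule norm_pdisc_le) (use Ql[OF z] in \<open>simp add: z'_def\<close>)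
    then have b: "z' \<in> ball a r0" using h(3) by (simp add: dist_norm norm_minus_commute k_def)
    have z'D: "z' \<in> polydisc" using z QR RD by (force simp: polydisc_def z'_def)
    have "u (join_coords z' x) \<le> ereal (c / 2 * ln s)"
    proof (rule lelong_bound[OF upsh cegrell_E_nonpos[OF u] z'D c])
      show "ereal c < lelong0 (\<lambda>x. u (join_coords z' x))" using lel b z'D by blast
      show "norm (x $ i) \<le> s" for i using Qr[OF z, of i] by (simp add: x_def)
    qed (use s in auto)
    then show ?thesis using s by (simp add: zj c1_def)
  qed
  have "\<exists>J. \<forall>j\<ge>J. \<forall>z\<in>Q. g j z < ereal (- c1 * L + 1)"
  proof (rule Dini_usc)
    show "compact Q" unfolding Q_def by (rule compact_cbox)
    show "openin (top_of_set Q) {z\<in>Q. g j z < ereal (- c1 * L + 1)}" for j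
      by (rule psh_compose_openin[of polydisc "g j" Q "\<lambda>z. z"]) (use g(1)[of j] QR RD in \<open>auto simp: cegrell_E0_def\<close>)
    show "g (Suc j) z \<le> g j z" if "z \<in> Q" for j z using g(2) QR RD that by blast
    fix z assume z: "z \<in> Q"
    then have "\<psi> z \<le> ereal (- c1 * L)" using uQ[OF z] \<psi>(2) QR by auto
    also have "\<dots> < ereal (- c1 * L + 1)" by simp
    finally have "\<forall>\<^sub>F j in sequentially. g j z < ereal (- c1 * L + 1)"
      using g(3) QR RD z order_tendstoD(2) by blast
    then show "\<exists>j. g j z < ereal (- c1 * L + 1)" by (meson eventually_happens trivial_limit_sequentially)
  qed
  then obtain J where J: "\<And>z. z \<in> Q \<Longrightarrow> g J z < ereal (- c1 * L + 1)" by blast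
  obtain M where bp: "bounded_psh (g J) M" using cegrell_E0_bounded_psh[OF g(1)[of J]] by blast
  interpret bounded_psh "g J" M by (rule bp)
  obtain K where K: "compact K" "K \<subseteq> polydisc" "\<And>z. z \<in> polydisc - K \<Longrightarrow> \<bar>g J z\<bar> < ereal 1"
    using g(1)[of J] unfolding cegrell_E0_def by (auto dest!: spec[of _ "1::real"])
  \<comment> \<open>The boundary condition with tolerance 1 gives \<open>g J \<ge> -1\<close> off a
    smaller polydisc, as \<open>MA_mass_ge\<close> requires.\<close>
  obtain r1 where r1: "r1 < 1" "K \<subseteq> pdisc r1" using compact_subset_pdisc[OF K(1)] K(2) by (auto simp: polydisc_eq_pdisc)
  define r2 where "r2 = max r1 R"
  have r2: "r2 < 1" "K \<subseteq> pdisc r2" "Q \<subseteq> pdisc r2"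
    using r1 R(1) QR pdisc_mono[of r1 r2] pdisc_mono[of R r2] by (auto simp: r2_def)
  \<comment> \<open>The quadratic and the logarithmic part each use \<open>c1 * L / 4\<close> of the
    available depth \<open>c1 * L\<close>; the other half pays for the constants.\<close>
  define \<alpha> where "\<alpha> = c1 * L / (16 * k)"
  define \<beta> where "\<beta> = c1 / (8 * m)"
  have ab: "0 < \<alpha>" "0 < \<beta>" using c1 L km by (auto simp: \<alpha>_def \<beta>_def)
  obtain w q where w: "cdiff 3 UNIV w" "\<And>z b. 0 \<le> levi w z b" "\<And>z. z \<in> polydisc \<Longrightarrow> w z \<le> - 4"
    and wlow: "\<And>z. 2 * CARD('m) * \<beta> * ln s - (4 * CARD('k) * \<alpha> + CARD('m) * \<beta> + 4) \<le> w z"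
    and q: "0 \<le> q" "\<And>z. z \<in> Q \<Longrightarrow> q \<le> MA_density w z"
    "q * measure lborel Q = \<alpha> ^ CARD('k) * (\<beta> / 4) ^ CARD('m) * (h\<^sup>2) ^ CARD('k)"
    by (rule comparison_function[OF a ab s(1) _ h(1), where 'm = 'm, folded p_def \<sigma>_def, folded Q_def]) (use s in auto)
  have wQ: "gr z + 4 < w z" if z: "z \<in> Q" for z
  proof -
    have zD: "z \<in> polydisc" using z QR RD by blast
    have "gr z < - c1 * L + 1" using J[OF z] gr[OF zD] by simp
    moreover have mk: "m * \<beta> = c1 / 8" "k * \<alpha> = c1 * L / 16" using km by (auto simp: \<alpha>_def \<beta>_def)
    have "2 * (m * \<beta>) * ln s - (4 * (k * \<alpha>) + m * \<beta> + 4) = - (c1 * L / 4) - (c1 * L / 4 + c1 / 8 + 4)"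
      unfolding mk s(3) by (simp add: field_simps)
    then have "- (c1 * L / 4) - (c1 * L / 4 + c1 / 8 + 4) \<le> w z" using wlow[of z] by (simp add: k_def m_def mult.assoc)
    ultimately show ?thesis using L2 c1 by linarith
  qed
  have "ereal (q * measure lborel Q) \<le> MA_mass polydisc (g J)"
    unfolding Q_def
  proof (rule MA_mass_ge[OF w r2(1)])
    show "- 1 \<le> gr z" if "z \<in> polydisc" "z \<notin> pdisc r2" for z
    proof -
      have "z \<notin> K" using that(2) r2(2) by blast
      then show ?thesis using K(3)[of z] that(1) by (simp add: gr)
    qed
  qed (use r2(3) wQ q in \<open>auto simp: Q_def\<close>)
  also have "\<dots> \<le> ereal C" by (rule g(4))
  finally have "q * measure lborel Q \<le> C" by simp
  moreover have "q * measure lborel Q = \<kappa> * L ^ CARD('k)"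
  proof -
    have "\<alpha> ^ CARD('k) = (c1 / (16 * k)) ^ CARD('k) * L ^ CARD('k)"
      unfolding power_mult_distrib[symmetric] by (simp add: \<alpha>_def)
    then show ?thesis unfolding q(3) \<kappa>_def by (simp add: \<beta>_def)
  qed
  \<comment> \<open>The presence of at least one coordinate \<open>z'\<close> makes the mass grow
    with \<open>L\<close>.\<close>
  moreover have "L \<le> L ^ CARD('k)" using L(1) by (simp add: self_le_power)
  then have "\<kappa> * L \<le> \<kappa> * L ^ CARD('k)" using \<kappa> by simp
  moreover have "\<bar>C\<bar> < \<kappa> * L" using L(3) \<kappa> by (simp add: pos_divide_less_eq mult.commute)
  ultimately show False by linarith
qed

theorem theorem4p6:
  fixes u :: "complex ^ ('k::finite + 'm::finite) \<Rightarrow> ereal"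
  assumes "u \<in> cegrell_E polydisc"
  shows "\<forall>z'\<in>(polydisc :: (complex ^ 'k) set). phi_u u z' = 0"
proof (rule ballI, rule ccontr)
  fix a :: "complex ^ 'k" assume a: "a \<in> polydisc" and neq: "phi_u u a \<noteq> 0"
  define l where "l z' = lelong0 (\<lambda>x. u (join_coords z' x))" for z' :: "complex ^ 'k"
  have "0 \<le> l z'" if z': "z' \<in> polydisc" for z'
    unfolding l_def lelong0_def
  proof (rule Liminf_bounded)
    have "0 \<le> Sup ((\<lambda>x. u (join_coords z' x)) ` ball 0 r) / ereal (ln r)" if r: "0 < r" "r < 1" for r
    proof -
      have "Sup ((\<lambda>x. u (join_coords z' x)) ` ball 0 r) \<le> 0"
        by (rule Sup_slice_nonpos[OF cegrell_E_nonpos[OF assms] z' r(2)])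
      then show ?thesis using r
        by (cases "Sup ((\<lambda>x. u (join_coords z' x)) ` ball 0 r)") (auto simp: zero_le_divide_iff)
    qed
    then show "\<forall>\<^sub>F r in at_right 0. 0 \<le> Sup ((\<lambda>x. u (join_coords z' x)) ` ball 0 r) / ereal (ln r)"
      unfolding eventually_at_right_field by (intro exI[of _ 1]) auto
  qed
  then have sup: "(SUP z'\<in>ball a r \<inter> polydisc. - l z') \<le> 0" for r
    by (intro SUP_least) (simp add: ereal_uminus_le_reorder)
  have phi: "phi_u u a = (INF r\<in>{0<..}. SUP z'\<in>ball a r \<inter> polydisc. - l z')"
    by (simp add: phi_u_def usc_reg_def l_def greaterThan_def)
  have "phi_u u a \<le> 0"
    unfolding phi by (rule INF_lower2[of 1]) (use sup in auto)
  then have "phi_u u a < 0" using neq by simp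
  \<comment> \<open>A negative infimum means that one ball has a negative supremum; a real
    \<open>e\<close> strictly between that supremum and 0 makes \<open>- e\<close> a uniform lower
    bound for the Lelong numbers.\<close>
  then obtain r where r: "0 < r" "(SUP z'\<in>ball a r \<inter> polydisc. - l z') < 0"
    unfolding phi INF_less_iff by auto
  then obtain e where e: "(SUP z'\<in>ball a r \<inter> polydisc. - l z') < ereal e" "ereal e < 0"
    using ereal_dense2 by blast
  show False
  proof (rule cegrell_E_lelong_not_bounded_below[OF assms a r(1)])
    show "0 < - e" using e(2) by simp
    fix z' :: "complex ^ 'k" assume "z' \<in> ball a r \<inter> polydisc"
    then have "- l z' \<le> (SUP z'\<in>ball a r \<inter> polydisc. - l z')" by (rule SUP_upper)
    then have "- l z' < ereal e" using e(1) by (rule le_less_trans)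
    then show "ereal (- e) < lelong0 (\<lambda>x. u (join_coords z' x))"
      unfolding l_def by (simp add: ereal_uminus_less_reorder)
  qed
qed

end
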